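(* If $T\in\mathcal{D}_H'(\mathbb{R}^d)$, then for every $\beta\in\mathbb{N}_0^d$ there are a measurable function $t_\beta$ on $\mathbb{R}^d$ with $x^\beta t_\beta\in L_\infty(\mathbb{R}^d)$ and an Euler operator $P(\theta)$ such that $T=P(\theta)t_\beta$. In particular $T\in\mathcal{O}_H'(\mathbb{R}^d)$.
   Context: $\mathbb{R}_*=\mathbb{R}\setminus\{0\}$; $\xi y$ is the coordinatewise product. Euler derivatives: $\theta_j=x_j\partial_j$; an Euler operator is $P(\theta)$ with $P$ a polynomial in $d$ variables. $\mathcal{D}_H'(\mathbb{R}^d)$ is the set of $T\in\mathcal{D}'(\mathbb{R}^d)$ such that for every $\varphi\in\mathcal{D}(\mathbb{R}^d)$ the function $y\mapsto T_\xi\varphi(\xi y)$, $y\in\mathbb{R}_*^d$, is the restriction of a function in $\mathcal{D}(\mathbb{R}^d)$. $\mathcal{O}_H'(\mathbb{R}^d)$ is the set of $T\in\mathcal{D}'(\mathbb{R}^d)$ such that for every $k\in\mathbb{N}_0$ there are finitely many measurable functions $t_\beta$ with $(1+|x|^2)^{k/2}t_\beta\in L_\infty(\mathbb{R}^d)$ and $T=\sum_\beta\theta^\beta t_\beta$. *)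

theory Defs
  imports "HOL-Analysis.Analysis"
begin

text \<open>Points of R^d are vectors real^'d for a finite index type 'd; the product
  x * y on real^'d is coordinatewise. Distributions are complex-valued functionals
  on complex-valued test functions.\<close>

definition partial :: "'d::finite \<Rightarrow> (real^'d \<Rightarrow> complex) \<Rightarrow> real^'d \<Rightarrow> complex" where
  "partial j f x = vector_derivative (\<lambda>t. f (x + t *\<^sub>R axis j 1)) (at 0)"

fun iter_partial :: "'d::finite list \<Rightarrow> (real^'d \<Rightarrow> complex) \<Rightarrow> real^'d \<Rightarrow> complex" where
  "iter_partial [] f = f"
| "iter_partial (j # js) f = partial j (iter_partial js f)"

definition smooth_fun :: "(real^'d::finite \<Rightarrow> complex) \<Rightarrow> bool" where
  "smooth_fun f \<longleftrightarrow> (\<forall>js. continuous_on UNIV (iter_partial js f) \<and>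
      (\<forall>j x. (\<lambda>t. iter_partial js f (x + t *\<^sub>R axis j 1)) differentiable (at (0::real))))"

definition tsupp :: "(real^'d::finite \<Rightarrow> complex) \<Rightarrow> (real^'d) set" where
  "tsupp f = closure {x. f x \<noteq> 0}"

definition test_fun :: "(real^'d::finite \<Rightarrow> complex) \<Rightarrow> bool" where
  "test_fun f \<longleftrightarrow> smooth_fun f \<and> compact (tsupp f)"

definition distribution :: "((real^'d::finite \<Rightarrow> complex) \<Rightarrow> complex) \<Rightarrow> bool" where
  "distribution T \<longleftrightarrow>
     (\<forall>\<phi> \<psi> a. test_fun \<phi> \<and> test_fun \<psi> \<longrightarrow>
        T (\<lambda>x. \<phi> x + \<psi> x) = T \<phi> + T \<psi> \<and> T (\<lambda>x. a * \<phi> x) = a * T \<phi>) \<and>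
     (\<forall>K. compact K \<longrightarrow> (\<exists>C N. \<forall>\<phi> M. test_fun \<phi> \<and> tsupp \<phi> \<subseteq> K \<and>
        (\<forall>js x. length js \<le> N \<longrightarrow> norm (iter_partial js \<phi> x) \<le> M) \<longrightarrow> norm (T \<phi>) \<le> C * M))"

definition dist_eq :: "((real^'d::finite \<Rightarrow> complex) \<Rightarrow> complex) \<Rightarrow> ((real^'d \<Rightarrow> complex) \<Rightarrow> complex) \<Rightarrow> bool" where
  "dist_eq T S \<longleftrightarrow> (\<forall>\<phi>. test_fun \<phi> \<longrightarrow> T \<phi> = S \<phi>)"

text \<open>Euler derivative theta_j = x_j d_j on distributions: (theta_j T)(phi) = - T(d_j(x_j phi)).\<close>
definition euler_dist :: "'d::finite \<Rightarrow> ((real^'d \<Rightarrow> complex) \<Rightarrow> complex) \<Rightarrow> ((real^'d \<Rightarrow> complex) \<Rightarrow> complex)" where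
  "euler_dist j T = (\<lambda>\<phi>. - T (\<lambda>x. \<phi> x + complex_of_real (x $ j) * partial j \<phi> x))"

text \<open>theta_{j1} ... theta_{jn} T for the word [j1,...,jn]. An Euler operator P(theta) is a
  finite linear combination of such monomials (the theta_j commute).\<close>
definition euler_word :: "'d::finite list \<Rightarrow> ((real^'d \<Rightarrow> complex) \<Rightarrow> complex) \<Rightarrow> ((real^'d \<Rightarrow> complex) \<Rightarrow> complex)" where
  "euler_word js T = foldr euler_dist js T"

definition regular :: "(real^'d::finite \<Rightarrow> complex) \<Rightarrow> ((real^'d \<Rightarrow> complex) \<Rightarrow> complex)" where
  "regular t = (\<lambda>\<phi>. LINT x|lborel. t x * \<phi> x)"

definition locally_integrable :: "(real^'d::finite \<Rightarrow> complex) \<Rightarrow> bool" where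
  "locally_integrable t \<longleftrightarrow> (\<forall>K. compact K \<longrightarrow> set_integrable lborel K t)"

definition mono_pow :: "real^'d::finite \<Rightarrow> ('d \<Rightarrow> nat) \<Rightarrow> real" where
  "mono_pow x \<beta> = (\<Prod>j\<in>UNIV. (x $ j) ^ \<beta> j)"

definition DH :: "((real^'d::finite \<Rightarrow> complex) \<Rightarrow> complex) \<Rightarrow> bool" where
  "DH T \<longleftrightarrow> distribution T \<and>
     (\<forall>\<phi>. test_fun \<phi> \<longrightarrow> (\<exists>\<psi>. test_fun \<psi> \<and>
        (\<forall>y. (\<forall>j. y $ j \<noteq> 0) \<longrightarrow> T (\<lambda>\<xi>. \<phi> (\<xi> * y)) = \<psi> y)))"

definition OH :: "((real^'d::finite \<Rightarrow> complex) \<Rightarrow> complex) \<Rightarrow> bool" where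
  "OH T \<longleftrightarrow> distribution T \<and>
     (\<forall>k::nat. \<exists>A t. finite A \<and>
        (\<forall>js\<in>A. t js \<in> borel_measurable lborel \<and>
           (\<exists>C. AE x in lborel. (1 + norm x ^ 2) powr (real k / 2) * norm (t js x) \<le> C)) \<and>
        dist_eq T (\<lambda>\<phi>. \<Sum>js\<in>A. euler_word js (regular (t js)) \<phi>))"

end

theory Submission
  imports Defs
begin

text \<open>
Write \<open>N \<phi>\<close> for the test function extending \<open>y \<mapsto> T\<^sub>\<xi> \<phi>(\<xi> y)\<close>. By a uniform boundedness principle,
\<open>T\<close> vanishes on a neighbourhood of the coordinate hyperplanes, because \<open>N \<phi>\<close> has bounded support.
If \<open>\<phi>\<close> vanishes on \<open>x\<^sub>j = 0\<close>, then its symmetrisation in \<open>x\<^sub>j\<close> is \<open>\<theta>\<^sub>j \<alpha>\<close> for a test function \<open>\<alpha>\<close>, so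
\<open>N \<phi>\<close> vanishes on \<open>y\<^sub>j = 0\<close>; dividing by \<open>x\<^sub>j\<close> repeatedly, \<open>N \<phi>\<close> is \<open>O(|y\<^sub>j|\<^sup>k)\<close> for every \<open>k\<close> if \<open>\<phi>\<close> is
supported in the closed positive orthant, with a constant depending only on finitely many derivatives.

Let \<open>G(u) = \<Prod>\<^sub>j u\<^sub>j\<^sup>p (1 - u\<^sub>j)\<^sup>p\<close> on the unit cube and \<open>0\<close> elsewhere, a function of class \<open>C\<^sup>p\<^sup>-\<^sup>1\<close>. In the group of
points with nonzero coordinates it is, up to a constant, a fundamental solution of
\<open>P(\<theta>) = \<Prod>\<^sub>j \<Prod>\<^sub>p\<^sub>\<le>\<^sub>a\<^sub>\<le>\<^sub>2\<^sub>p (\<theta>\<^sub>j - a)\<close>: Taylor's formula recovers \<open>F(1)\<close> from \<open>P(\<theta>) F\<close>.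
Hence the convolution \<open>t(x) = T\<^sub>\<xi> G(\<xi> / x) / |\<Prod>\<^sub>j x\<^sub>j|\<close>, defined by approximating \<open>G\<close> with test functions,
satisfies \<open>T \<phi> = c \<integral> t P(\<theta>) \<phi>\<close>, and the bound for \<open>N\<close> gives its decay.
\<close>

subsection \<open>Calculus of smooth functions\<close>

text \<open>The quotient phi / x_j is an x_j-derivative of a test function only if its line
  integrals vanish. Symmetrising makes the quotient odd, which secures this, and on y_j = 0 the
  reflection merely doubles N phi. The decay of N phi is obtained for one phi at a time, whereas G
  is only a limit of test functions: a second use of uniform boundedness, for the functionals
  |y_j|^(-k) T_xi phi(xi y), yields one order M for all y and j, and p = M + 1 makes G regular
  enough for that order. Hence P depends on k. A kernel supported in the positive orthant is enough
  because the dilating point x runs through all orthants. The exponents p, ..., 2p come from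
  integration by parts: in v = 1/u the density of G is (v-1)^p / v^(2p+1); each factor theta_j - a
  removes one power of v and differentiates (v-1)^p once, and after p + 1 steps p! times the point
  mass at v = 1 is left. Near the hyperplanes both T and t vanish, so the factor 1 / |prod x_j| does
  no harm and every phi may be cut off there.\<close>

lemma continuous_on_vec_times [continuous_intros]:
  fixes f g :: "'a::topological_space \<Rightarrow> real^'d::finite"
  assumes "continuous_on S f" "continuous_on S g"
  shows "continuous_on S (\<lambda>x. f x * g x)"
proof -
  have eq: "f x * g x = (\<chi> i. f x $ i * g x $ i)" for x by (simp add: vec_eq_iff)
  show ?thesis unfolding eq using assms by (intro continuous_intros)
qed

text \<open>\<open>partial\<close> takes an arbitrary value where the restriction to a coordinate
  line is not differentiable, so the calculus rules carry this predicate; it is the pointwise part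
  of \<open>smooth_fun\<close>.\<close>

definition differentiable_in :: "'d::finite \<Rightarrow> (real^'d \<Rightarrow> complex) \<Rightarrow> bool" where
  "differentiable_in j f \<longleftrightarrow> (\<forall>x. (\<lambda>t. f (x + t *\<^sub>R axis j 1)) differentiable (at (0::real)))"

lemma has_partial:
  assumes "differentiable_in j f"
  shows "((\<lambda>t. f (x + t *\<^sub>R axis j 1)) has_vector_derivative partial j f x) (at 0)"
  using assms unfolding differentiable_in_def partial_def by (simp add: vector_derivative_works)

lemma has_partial_at:
  assumes "differentiable_in j f"
  shows "((\<lambda>t. f (x + t *\<^sub>R axis j 1)) has_vector_derivative partial j f (x + s *\<^sub>R axis j 1)) (at s within A)"
proof -
  have "((\<lambda>t. f ((x + s *\<^sub>R axis j 1) + t *\<^sub>R axis j 1)) has_vector_derivative partial j f (x + s *\<^sub>R axis j 1)) (at (s - s))"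
    using has_partial[OF assms] by simp
  moreover have "((\<lambda>t. t - s) has_vector_derivative 1) (at s)"
    by (auto intro!: derivative_eq_intros)
  ultimately have "((\<lambda>t. f ((x + s *\<^sub>R axis j 1) + t *\<^sub>R axis j 1)) \<circ> (\<lambda>t. t - s)
      has_vector_derivative 1 *\<^sub>R partial j f (x + s *\<^sub>R axis j 1)) (at s)"
    by (intro vector_diff_chain_at) auto
  then have "((\<lambda>t. f (x + t *\<^sub>R axis j 1)) has_vector_derivative partial j f (x + s *\<^sub>R axis j 1)) (at s)"
    by (simp add: o_def algebra_simps)
  then show ?thesis using has_vector_derivative_at_within by blast
qed

lemma partialI:
  assumes "\<And>x. ((\<lambda>t. f (x + t *\<^sub>R axis j 1)) has_vector_derivative g x) (at 0)"
  shows "differentiable_in j f" "partial j f = g"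
  using assms by (auto simp: differentiable_in_def partial_def fun_eq_iff vector_derivative_at
      intro: differentiableI_vector)

lemma smooth_fun_alt:
  "smooth_fun f \<longleftrightarrow> (\<forall>js. continuous_on UNIV (iter_partial js f) \<and> (\<forall>j. differentiable_in j (iter_partial js f)))"
  unfolding smooth_fun_def differentiable_in_def by blast

text \<open>The tool behind the closure properties of smooth functions: it is enough to exhibit a
  class of continuous functions that \<open>partial\<close> maps into itself, since induction on the
  word of derivatives never leaves the class.\<close>

lemma smooth_fun_coinduct:
  assumes "X f"
    and "\<And>f. X f \<Longrightarrow> continuous_on UNIV f"
    and "\<And>f j. X f \<Longrightarrow> differentiable_in j f \<and> X (partial j f)"
  shows "smooth_fun f"
proof -
  have "X (iter_partial js f)" for js
    by (induction js) (use assms in auto)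
  then show ?thesis unfolding smooth_fun_alt using assms by blast
qed

lemma iter_partial_append: "iter_partial (js @ ks) f = iter_partial js (iter_partial ks f)"
  by (induction js) auto

lemma smooth_fun_iter_partial: "smooth_fun f \<Longrightarrow> smooth_fun (iter_partial js f)"
  unfolding smooth_fun_alt by (metis iter_partial_append)

lemma smooth_fun_partial: "smooth_fun f \<Longrightarrow> smooth_fun (partial j f)"
  using smooth_fun_iter_partial[of f "[j]"] by simp

lemma smooth_fun_continuous: "smooth_fun f \<Longrightarrow> continuous_on A f"
  unfolding smooth_fun_def by (metis continuous_on_subset iter_partial.simps(1) top_greatest)

lemma smooth_fun_differentiable: "smooth_fun f \<Longrightarrow> differentiable_in j f"
  unfolding smooth_fun_alt by (metis iter_partial.simps(1))

lemma partial_add: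
  assumes "differentiable_in j f" "differentiable_in j g"
  shows "differentiable_in j (\<lambda>x. f x + g x)" "partial j (\<lambda>x. f x + g x) = (\<lambda>x. partial j f x + partial j g x)"
proof -
  have "((\<lambda>t. f (x + t *\<^sub>R axis j 1) + g (x + t *\<^sub>R axis j 1)) has_vector_derivative
      (partial j f x + partial j g x)) (at 0)" for x
    by (intro derivative_intros has_partial assms)
  note * = partialI[where f="\<lambda>x. f x + g x", OF this]
  show "differentiable_in j (\<lambda>x. f x + g x)" "partial j (\<lambda>x. f x + g x) = (\<lambda>x. partial j f x + partial j g x)"
    by (fact *)+
qed

lemma partial_mult:
  assumes "differentiable_in j f" "differentiable_in j g"
  shows "differentiable_in j (\<lambda>x. f x * g x)"
    "partial j (\<lambda>x. f x * g x) = (\<lambda>x. f x * partial j g x + partial j f x * g x)"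
proof -
  have "((\<lambda>t. f (x + t *\<^sub>R axis j 1) * g (x + t *\<^sub>R axis j 1)) has_vector_derivative
      (f x * partial j g x + partial j f x * g x)) (at 0)" for x
    using has_vector_derivative_mult[OF has_partial[OF assms(1)] has_partial[OF assms(2)]] by fastforce
  note * = partialI[where f="\<lambda>x. f x * g x", OF this]
  show "differentiable_in j (\<lambda>x. f x * g x)"
    "partial j (\<lambda>x. f x * g x) = (\<lambda>x. f x * partial j g x + partial j f x * g x)"
    by (fact *)+
qed

lemma partial_const:
  "differentiable_in j (\<lambda>x. c)" "partial j (\<lambda>x. c) = (\<lambda>x. 0)"
proof -
  have "((\<lambda>t. c) has_vector_derivative 0) (at (0::real))" by (rule has_vector_derivative_const)
  note * = partialI[where f="\<lambda>x. c", OF this]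
  show "differentiable_in j (\<lambda>x. c)" "partial j (\<lambda>x. c) = (\<lambda>x. 0)" by (fact *)+
qed

lemma partial_cmult:
  assumes "differentiable_in j f"
  shows "differentiable_in j (\<lambda>x. c * f x)" "partial j (\<lambda>x. c * f x) = (\<lambda>x. c * partial j f x)"
  using partial_mult[OF partial_const(1) assms] by (simp_all add: partial_const)

lemma smooth_fun_const: "smooth_fun (\<lambda>x. c)"
proof (rule smooth_fun_coinduct[where X="\<lambda>f. \<exists>c. f = (\<lambda>x. c)"])
  show "\<exists>c'. (\<lambda>x. c) = (\<lambda>x. c')" by blast
qed (auto simp: partial_const)

lemma smooth_fun_add:
  assumes "smooth_fun f" "smooth_fun g" shows "smooth_fun (\<lambda>x. f x + g x)"
proof (rule smooth_fun_coinduct[where X="\<lambda>h. \<exists>f g. smooth_fun f \<and> smooth_fun g \<and> h = (\<lambda>x. f x + g x)"])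
  fix h :: "real^'a \<Rightarrow> complex" and j
  assume "\<exists>f g. smooth_fun f \<and> smooth_fun g \<and> h = (\<lambda>x. f x + g x)"
  then obtain f g where h: "smooth_fun f" "smooth_fun g" "h = (\<lambda>x. f x + g x)" by blast
  then show "differentiable_in j h \<and> (\<exists>f g. smooth_fun f \<and> smooth_fun g \<and> partial j h = (\<lambda>x. f x + g x))"
    unfolding h(3) partial_add(2)[OF smooth_fun_differentiable[OF h(1)] smooth_fun_differentiable[OF h(2)]]
    by (intro conjI partial_add(1) smooth_fun_differentiable exI[of _ "partial j f"] exI[of _ "partial j g"]
        smooth_fun_partial h) auto
next
  show "continuous_on UNIV h" if "\<exists>f g. smooth_fun f \<and> smooth_fun g \<and> h = (\<lambda>x. f x + g x)"
    for h :: "real^'a \<Rightarrow> complex"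
    using that by (auto intro: continuous_on_add smooth_fun_continuous)
qed (use assms in blast)

lemma smooth_fun_sum:
  assumes "\<And>i. i \<in> I \<Longrightarrow> smooth_fun (f i)" shows "smooth_fun (\<lambda>x. \<Sum>i\<in>I. f i x)"
  using assms
  by (induction I rule: infinite_finite_induct) (auto intro: smooth_fun_add simp: smooth_fun_const)

text \<open>Single products are not closed under \<open>partial\<close>, since the Leibniz rule
  gives a sum of two; finite sums of products are, and serve as the coinduction class.\<close>

inductive prod_span :: "(real^'d::finite \<Rightarrow> complex) \<Rightarrow> bool" where
  prod: "smooth_fun f \<Longrightarrow> smooth_fun g \<Longrightarrow> prod_span (\<lambda>x. f x * g x)"
| add: "prod_span f \<Longrightarrow> prod_span g \<Longrightarrow> prod_span (\<lambda>x. f x + g x)"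

lemma smooth_fun_mult:
  assumes "smooth_fun f" "smooth_fun g" shows "smooth_fun (\<lambda>x. f x * g x)"
proof (rule smooth_fun_coinduct[where X=prod_span])
  show "continuous_on UNIV h" if "prod_span h" for h :: "real^'a \<Rightarrow> complex"
    using that by induction (auto intro: continuous_on_add continuous_on_mult smooth_fun_continuous)
  show "differentiable_in j h \<and> prod_span (partial j h)" if "prod_span h" for h :: "real^'a \<Rightarrow> complex" and j
    using that
  proof induction
    case (prod f g)
    then show ?case
      using partial_mult[of j f g] smooth_fun_differentiable[of _ j] smooth_fun_partial[of _ j]
      by (auto intro!: prod_span.intros)
  next
    case (add f g)
    then show ?case using partial_add[of j f g] by (auto intro!: prod_span.intros)
  qed
qed (use assms in \<open>auto intro: prod_span.prod\<close>)

lemma smooth_fun_cmult: "smooth_fun f \<Longrightarrow> smooth_fun (\<lambda>x. c * f x)"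
  by (intro smooth_fun_mult smooth_fun_const)

lemma iter_partial_add:
  assumes "smooth_fun f" "smooth_fun g"
  shows "iter_partial js (\<lambda>x. f x + g x) = (\<lambda>x. iter_partial js f x + iter_partial js g x)"
  using assms
  by (induction js) (auto simp: partial_add smooth_fun_differentiable smooth_fun_iter_partial)

lemma iter_partial_cmult:
  assumes "smooth_fun f"
  shows "iter_partial js (\<lambda>x. c * f x) = (\<lambda>x. c * iter_partial js f x)"
  using assms
  by (induction js) (auto simp: partial_cmult smooth_fun_differentiable smooth_fun_iter_partial)

lemma iter_partial_diff:
  assumes "smooth_fun f" "smooth_fun g"
  shows "iter_partial js (\<lambda>x. f x - g x) = (\<lambda>x. iter_partial js f x - iter_partial js g x)"
  using iter_partial_add[OF assms(1) smooth_fun_cmult[OF assms(2), of "-1"]]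
    iter_partial_cmult[OF assms(2), of _ "-1"] by simp

lemma iter_partial_const_zero: "iter_partial js (\<lambda>x. 0) = (\<lambda>x. 0)"
  by (induction js) (auto simp: partial_const)

lemma iter_partial_sum:
  assumes "\<And>i. i \<in> I \<Longrightarrow> smooth_fun (f i)"
  shows "iter_partial js (\<lambda>x. \<Sum>i\<in>I. f i x) = (\<lambda>x. \<Sum>i\<in>I. iter_partial js (f i) x)"
  using assms
  by (induction I rule: infinite_finite_induct)
     (auto simp: iter_partial_const_zero iter_partial_add smooth_fun_sum)

lemma partial_cong_open:
  assumes "open U" "x \<in> U" "\<And>z. z \<in> U \<Longrightarrow> f z = g z"
  shows "partial j f x = partial j g x"
proof -
  have "((\<lambda>t::real. x + t *\<^sub>R axis j 1) \<longlongrightarrow> x + 0 *\<^sub>R axis j 1) (nhds 0)"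
    by (intro tendsto_intros filterlim_ident)
  then have "\<forall>\<^sub>F t in nhds 0. x + t *\<^sub>R axis j 1 \<in> U"
    using assms topological_tendstoD by fastforce
  then have "\<forall>\<^sub>F t in nhds 0. f (x + t *\<^sub>R axis j 1) = g (x + t *\<^sub>R axis j 1)"
    by eventually_elim (use assms in auto)
  then show ?thesis unfolding partial_def
    by (intro vector_derivative_cong_eq) (auto simp: assms)
qed

lemma iter_partial_cong_open:
  assumes "open U" "\<And>z. z \<in> U \<Longrightarrow> f z = g z" "x \<in> U"
  shows "iter_partial js f x = iter_partial js g x"
  using assms(3) by (induction js arbitrary: x) (auto simp: assms intro!: partial_cong_open[OF assms(1)])

lemma smooth_fun_component: "smooth_fun (\<lambda>x::real^'d::finite. of_real (x $ j))"
  "partial i (\<lambda>x::real^'d::finite. of_real (x $ j)) = (\<lambda>x. if i = j then 1 else 0)"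
proof -
  have d: "((\<lambda>t. complex_of_real ((x + t *\<^sub>R axis i 1) $ j)) has_vector_derivative (if i = j then 1 else 0)) (at 0)"
    for x :: "real^'d" and i
  proof -
    have "((\<lambda>t. complex_of_real (x $ j) + t *\<^sub>R (if i = j then 1 else 0)) has_vector_derivative
        (0 + (0 *\<^sub>R 0 + 1 *\<^sub>R (if i = j then 1 else 0)))) (at 0)"
      by (intro derivative_intros)
    moreover have "(\<lambda>t. complex_of_real ((x + t *\<^sub>R axis i 1) $ j)) =
        (\<lambda>t. complex_of_real (x $ j) + t *\<^sub>R (if i = j then 1 else 0))"
      by (simp add: fun_eq_iff axis_def scaleR_conv_of_real[where 'a=complex])
    ultimately show ?thesis by simp
  qed
  show p: "partial i (\<lambda>x::real^'d. of_real (x $ j)) = (\<lambda>x. if i = j then 1 else 0)" for i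
    using partialI(2)[OF d] .
  show "smooth_fun (\<lambda>x::real^'d. of_real (x $ j))"
  proof (rule smooth_fun_coinduct[where X="\<lambda>f. f = (\<lambda>x::real^'d. of_real (x $ j)) \<or> (\<exists>c. f = (\<lambda>x. c))"])
    fix f :: "real^'d \<Rightarrow> complex" and i
    assume "f = (\<lambda>x. of_real (x $ j)) \<or> (\<exists>c. f = (\<lambda>x. c))"
    then show "differentiable_in i f \<and> (partial i f = (\<lambda>x. of_real (x $ j)) \<or> (\<exists>c. partial i f = (\<lambda>x. c)))"
      using partialI(1)[OF d] by (auto simp: p partial_const)
  qed (auto intro!: continuous_intros)
qed

lemma partial_dilation:
  assumes "differentiable_in j f"
  shows "differentiable_in j (\<lambda>x. f (x * y + w))"
    "partial j (\<lambda>x. f (x * y + w)) = (\<lambda>x. of_real (y $ j) * partial j f (x * y + w))"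
proof -
  have "((\<lambda>t. f ((x + t *\<^sub>R axis j 1) * y + w)) has_vector_derivative of_real (y $ j) * partial j f (x * y + w)) (at 0)" for x
  proof -
    have "((\<lambda>t. f ((x * y + w) + t *\<^sub>R axis j 1)) \<circ> (\<lambda>t. t * y $ j) has_vector_derivative
        (y $ j) *\<^sub>R partial j f (x * y + w)) (at 0)"
      by (intro vector_diff_chain_at) (auto intro!: derivative_eq_intros has_partial assms)
    moreover have "(\<lambda>t. f ((x + t *\<^sub>R axis j 1) * y + w)) = (\<lambda>t. f ((x * y + w) + t *\<^sub>R axis j 1)) \<circ> (\<lambda>t. t * y $ j)"
    proof -
      have "(x + t *\<^sub>R axis j 1) * y + w = (x * y + w) + (t * y $ j) *\<^sub>R axis j 1" for t :: real
        by (simp add: vec_eq_iff axis_def algebra_simps)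
      then show ?thesis by (simp only: o_def)
    qed
    ultimately show ?thesis by (simp add: scaleR_conv_of_real[where 'a=complex])
  qed
  from partialI[OF this] show "differentiable_in j (\<lambda>x. f (x * y + w))"
    "partial j (\<lambda>x. f (x * y + w)) = (\<lambda>x. of_real (y $ j) * partial j f (x * y + w))" by auto
qed

lemma smooth_fun_dilation:
  assumes "smooth_fun f" shows "smooth_fun (\<lambda>x. f (x * y + w))"
\<comment> \<open>The scalar \<open>c\<close> absorbs the factors \<open>y $ j\<close> that the
  chain rule produces.\<close>
proof (rule smooth_fun_coinduct[where X="\<lambda>h. \<exists>c f. smooth_fun f \<and> h = (\<lambda>x. c * f (x * y + w))"])
  show "\<exists>c g. smooth_fun g \<and> (\<lambda>x. f (x * y + w)) = (\<lambda>x. c * g (x * y + w))"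
    using assms by (intro exI[of _ 1] exI[of _ f]) auto
next
  fix h :: "real^'a \<Rightarrow> complex"
  assume "\<exists>c f. smooth_fun f \<and> h = (\<lambda>x. c * f (x * y + w))"
  then obtain c f where h: "smooth_fun f" "h = (\<lambda>x. c * f (x * y + w))" by blast
  show "continuous_on UNIV h" unfolding h
    by (intro continuous_intros continuous_on_compose2[OF smooth_fun_continuous[OF h(1), of UNIV]]) auto
  fix j
  have "partial j h = (\<lambda>x. (c * of_real (y $ j)) * partial j f (x * y + w))"
    unfolding h using partial_cmult(2)[OF partial_dilation(1)[OF smooth_fun_differentiable[OF h(1)]]]
    by (simp add: partial_dilation[OF smooth_fun_differentiable[OF h(1)]] mult.assoc)
  then show "differentiable_in j h \<and> (\<exists>c f. smooth_fun f \<and> partial j h = (\<lambda>x. c * f (x * y + w)))"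
    unfolding h(2) using smooth_fun_partial[OF h(1)]
      partial_cmult(1)[OF partial_dilation(1)[OF smooth_fun_differentiable[OF h(1)]]] by blast
qed

lemma iter_partial_dilation:
  assumes "smooth_fun f"
  shows "iter_partial js (\<lambda>x. f (x * y + w)) = (\<lambda>x. of_real (\<Prod>j\<leftarrow>js. y $ j) * iter_partial js f (x * y + w))"
proof (induction js)
  case (Cons j js)
  have "differentiable_in j (iter_partial js f)"
    using assms smooth_fun_differentiable smooth_fun_iter_partial by blast
  then show ?case
    by (simp add: Cons partial_cmult partial_dilation mult_ac)
qed auto

subsection \<open>Test functions\<close>

lemma test_funD: "test_fun f \<Longrightarrow> smooth_fun f" "test_fun f \<Longrightarrow> compact (tsupp f)"
  unfolding test_fun_def by auto

lemma tsupp_superset: "f x \<noteq> 0 \<Longrightarrow> x \<in> tsupp f"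
  unfolding tsupp_def using closure_subset by fastforce

lemma tsupp_subset: "closed K \<Longrightarrow> (\<And>x. f x \<noteq> 0 \<Longrightarrow> x \<in> K) \<Longrightarrow> tsupp f \<subseteq> K"
  unfolding tsupp_def by (rule closure_minimal) auto

lemma test_funI:
  assumes "smooth_fun f" "compact K" "\<And>x. f x \<noteq> 0 \<Longrightarrow> x \<in> K"
  shows "test_fun f" "tsupp f \<subseteq> K"
proof -
  show "tsupp f \<subseteq> K" using assms by (intro tsupp_subset compact_imp_closed) auto
  then show "test_fun f" using assms unfolding test_fun_def
    by (metis closed_closure closed_Int_compact inf.absorb_iff1 tsupp_def)
qed

lemma iter_partial_zero_outside:
  assumes "x \<notin> tsupp f" shows "iter_partial js f x = 0"
proof -
  have "iter_partial js f x = iter_partial js (\<lambda>x. 0) x"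
    by (rule iter_partial_cong_open[of "- tsupp f"]) (use assms tsupp_superset in \<open>auto simp: tsupp_def\<close>)
  then show ?thesis by (simp add: iter_partial_const_zero)
qed

lemma test_fun_iter_partial: "test_fun f \<Longrightarrow> test_fun (iter_partial js f)"
  using test_funI[of "iter_partial js f" "tsupp f"] iter_partial_zero_outside
  by (metis smooth_fun_iter_partial test_funD)

lemma test_fun_partial: "test_fun f \<Longrightarrow> test_fun (partial j f)"
  using test_fun_iter_partial[of f "[j]"] by simp

lemma test_fun_add: assumes "test_fun f" "test_fun g" shows "test_fun (\<lambda>x. f x + g x)"
proof (rule test_funI(1)[of _ "tsupp f \<union> tsupp g"])
  show "x \<in> tsupp f \<union> tsupp g" if "f x + g x \<noteq> 0" for x
    using that tsupp_superset[of f x] tsupp_superset[of g x] by (cases "f x = 0") auto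
qed (use assms in \<open>auto intro: smooth_fun_add test_funD\<close>)

lemma test_fun_mult: assumes "smooth_fun f" "test_fun g" shows "test_fun (\<lambda>x. f x * g x)"
  using assms by (intro test_funI(1)[of _ "tsupp g"] smooth_fun_mult) (auto intro: test_funD tsupp_superset)

lemma test_fun_cmult: "test_fun g \<Longrightarrow> test_fun (\<lambda>x. c * g x)"
  by (rule test_fun_mult[OF smooth_fun_const])

lemma test_fun_diff: "test_fun f \<Longrightarrow> test_fun g \<Longrightarrow> test_fun (\<lambda>x. f x - g x)"
  using test_fun_add[of f "\<lambda>x. (-1) * g x"] test_fun_cmult[of g "-1"] by simp

lemma test_fun_zero: "test_fun (\<lambda>x. 0)"
  by (rule test_funI[of _ "{}"]) (auto simp: smooth_fun_const)

lemma test_fun_sum: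
  assumes "\<And>i. i \<in> I \<Longrightarrow> test_fun (f i)" shows "test_fun (\<lambda>x. \<Sum>i\<in>I. f i x)"
  using assms
  by (induction I rule: infinite_finite_induct) (auto intro: test_fun_add simp: test_fun_zero)

lemma test_fun_bounded: assumes "test_fun f" obtains B where "\<And>x. norm (f x) \<le> B"
proof -
  have "compact (f ` tsupp f)"
    using assms by (intro compact_continuous_image smooth_fun_continuous test_funD)
  then obtain B where B: "\<forall>y\<in>f ` tsupp f. norm y \<le> B" using bounded_iff compact_imp_bounded by metis
  have "norm (f x) \<le> max B 0" for x
    using B tsupp_superset[of f x] by (cases "f x = 0") fastforce+
  then show ?thesis using that by blast
qed

section \<open>Dilations by points with nonzero coordinates, and bounds on derivatives\<close>

definition all_nz :: "real^'d::finite \<Rightarrow> bool" where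
  "all_nz y \<longleftrightarrow> (\<forall>j. y $ j \<noteq> 0)"

definition vinv :: "real^'d::finite \<Rightarrow> real^'d" where
  "vinv y = (\<chi> j. inverse (y $ j))"

lemma vinv_nth [simp]: "vinv y $ j = inverse (y $ j)" by (simp add: vinv_def)

lemma vinv_mult: "all_nz y \<Longrightarrow> x * y * vinv y = x" by (simp add: vec_eq_iff all_nz_def)

lemma all_nz_vinv [simp]: "all_nz (vinv y) = all_nz y" by (simp add: all_nz_def)

lemma all_nz_mult [simp]: "all_nz (x * y) \<longleftrightarrow> all_nz x \<and> all_nz y" by (auto simp: all_nz_def)

text \<open>\<open>T (dil y f)\<close> is the pairing T_xi f(xi y) from the definition of D_H'.
  Composing dilations multiplies the points, so on points with nonzero coordinates this is a group
  action.\<close>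

definition dil :: "real^'d::finite \<Rightarrow> (real^'d \<Rightarrow> complex) \<Rightarrow> real^'d \<Rightarrow> complex" where
  "dil y f = (\<lambda>x. f (x * y))"

lemma smooth_fun_dil: "smooth_fun f \<Longrightarrow> smooth_fun (dil y f)"
  unfolding dil_def using smooth_fun_dilation[of f y 0] by simp

lemma iter_partial_dil:
  "smooth_fun f \<Longrightarrow> iter_partial js (dil y f) x = of_real (\<Prod>j\<leftarrow>js. y $ j) * iter_partial js f (x * y)"
  unfolding dil_def using iter_partial_dilation[of f js y 0] by (simp add: fun_eq_iff)

lemma dil_dil: "dil y (dil z f) = dil (y * z) f"
  by (simp add: dil_def mult.assoc)

lemma test_fun_dil:
  assumes "test_fun f" "all_nz y"
  shows "test_fun (dil y f)" "tsupp (dil y f) \<subseteq> (\<lambda>x. x * vinv y) ` tsupp f"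
proof -
  have c: "compact ((\<lambda>x. x * vinv y) ` tsupp f)"
    using assms by (intro compact_continuous_image continuous_intros test_funD)
  have s: "x \<in> (\<lambda>x. x * vinv y) ` tsupp f" if "dil y f x \<noteq> 0" for x
    using that vinv_mult[OF assms(2), of x] tsupp_superset[of f "x * y"] by (force simp: dil_def)
  from test_funI[OF smooth_fun_dil[OF test_funD(1)[OF assms(1)]] c s]
  show "test_fun (dil y f)" "tsupp (dil y f) \<subseteq> (\<lambda>x. x * vinv y) ` tsupp f" by auto
qed

text \<open>A bound for the C^N norm, kept as a predicate with explicit bound. Derivatives are
  indexed by words, of which only finitely many have length at most \<open>N\<close>.\<close>

definition cbound :: "nat \<Rightarrow> (real^'d::finite \<Rightarrow> complex) \<Rightarrow> real \<Rightarrow> bool" where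
  "cbound N f B \<longleftrightarrow> (\<forall>js x. length js \<le> N \<longrightarrow> norm (iter_partial js f x) \<le> B)"

lemma finite_words: "finite {js::'d::finite list. length js \<le> N}"
  using finite_lists_length_le[of "UNIV::'d set" N] by simp

lemma cbound_exists: assumes "test_fun f" obtains B where "B > 0" "cbound N f B"
proof -
  have "\<forall>js. \<exists>B. \<forall>x. norm (iter_partial js f x) \<le> B"
    using test_fun_bounded[OF test_fun_iter_partial[OF assms]] by metis
  then obtain B where B: "\<And>js x. norm (iter_partial js f x) \<le> B js" by metis
  have "B js \<le> 1 + (\<Sum>js | length js \<le> N. \<bar>B js\<bar>)" if "length js \<le> N" for js
    using member_le_sum[of js "{js. length js \<le> N}" "\<lambda>js. \<bar>B js\<bar>"] that finite_words by fastforce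
  then have "cbound N f (1 + (\<Sum>js | length js \<le> N. \<bar>B js\<bar>))"
    unfolding cbound_def using B order_trans by metis
  moreover have "0 \<le> (\<Sum>js | length js \<le> N. \<bar>B js\<bar>)" by (rule sum_nonneg) auto
  ultimately show ?thesis using that[of "1 + (\<Sum>js | length js \<le> N. \<bar>B js\<bar>)"] by linarith
qed

lemma cbound_mono: "cbound N f B \<Longrightarrow> M \<le> N \<Longrightarrow> B \<le> B' \<Longrightarrow> cbound M f B'"
  unfolding cbound_def by (meson order_trans)

lemma cbound_cmult: "smooth_fun f \<Longrightarrow> cbound N f B \<Longrightarrow> cbound N (\<lambda>x. c * f x) (norm c * B)"
  unfolding cbound_def by (simp add: iter_partial_cmult norm_mult mult_left_mono)

lemma abs_prod_list_le:
  assumes "\<And>j. \<bar>y $ j\<bar> \<le> R" "1 \<le> R" "length js \<le> N"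
  shows "\<bar>\<Prod>j\<leftarrow>js. (y $ j)\<bar> \<le> (R::real) ^ N"
proof -
  have "\<bar>\<Prod>j\<leftarrow>js. (y $ j)\<bar> \<le> R ^ length js"
    by (induction js) (use assms(1,2) in \<open>auto simp: abs_mult intro!: mult_mono\<close>)
  also have "\<dots> \<le> R ^ N" using assms by (intro power_increasing) auto
  finally show ?thesis .
qed

lemma cbound_dil:
  assumes "smooth_fun f" "cbound N f B" "\<And>j. \<bar>y $ j\<bar> \<le> R" "1 \<le> R"
  shows "cbound N (dil y f) (R ^ N * B)"
  unfolding cbound_def
proof (intro allI impI)
  fix js :: "'a list" and x :: "real^'a" assume js: "length js \<le> N"
  have "norm (iter_partial js (dil y f) x) = \<bar>\<Prod>j\<leftarrow>js. (y $ j)\<bar> * norm (iter_partial js f (x * y))"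
    by (simp add: iter_partial_dil assms norm_mult)
  also have "\<dots> \<le> R ^ N * B"
    using abs_prod_list_le[OF assms(3,4) js] assms(2,4) js unfolding cbound_def
    by (intro mult_mono) auto
  finally show "norm (iter_partial js (dil y f) x) \<le> R ^ N * B" .
qed

subsection \<open>Distributions\<close>

text \<open>The algebraic half of \<open>distribution\<close>, kept apart because the passage from
  Euler operators to words of Euler derivatives uses linearity alone.\<close>

definition test_linear :: "((real^'d::finite \<Rightarrow> complex) \<Rightarrow> complex) \<Rightarrow> bool" where
  "test_linear T \<longleftrightarrow> (\<forall>\<phi> \<psi> a. test_fun \<phi> \<and> test_fun \<psi> \<longrightarrow>
        T (\<lambda>x. \<phi> x + \<psi> x) = T \<phi> + T \<psi> \<and> T (\<lambda>x. a * \<phi> x) = a * T \<phi>)"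

lemma test_linearD:
  assumes "test_linear T" "test_fun \<phi>"
  shows "T (\<lambda>x. a * \<phi> x) = a * T \<phi>" "T (\<lambda>x. 0) = 0"
    "test_fun \<psi> \<Longrightarrow> T (\<lambda>x. \<phi> x + \<psi> x) = T \<phi> + T \<psi>"
    "test_fun \<psi> \<Longrightarrow> T (\<lambda>x. \<phi> x - \<psi> x) = T \<phi> - T \<psi>"
proof -
  note L = assms(1)[unfolded test_linear_def, rule_format]
  show *: "T (\<lambda>x. a * \<phi> x) = a * T \<phi>" for a using L assms(2) by blast
  show "T (\<lambda>x. 0) = 0" using *[of 0] by simp
  show "T (\<lambda>x. \<phi> x + \<psi> x) = T \<phi> + T \<psi>" if "test_fun \<psi>" using L assms(2) that by blast
  show "T (\<lambda>x. \<phi> x - \<psi> x) = T \<phi> - T \<psi>" if "test_fun \<psi>"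
  proof -
    have "T (\<lambda>x. \<phi> x + (-1) * \<psi> x) = T \<phi> + T (\<lambda>x. (-1) * \<psi> x)"
      using L assms(2) test_fun_cmult[OF that] by blast
    also have "T (\<lambda>x. (-1) * \<psi> x) = (-1) * T \<psi>" using L that by blast
    finally show ?thesis by simp
  qed
qed

lemma test_linear_sum:
  assumes "test_linear T" "\<And>i. i \<in> I \<Longrightarrow> test_fun (f i)"
  shows "T (\<lambda>x. \<Sum>i\<in>I. f i x) = (\<Sum>i\<in>I. T (f i))"
  using assms(2)
  by (induction I rule: infinite_finite_induct)
     (auto simp: test_linearD(2)[OF assms(1) test_fun_zero] test_linearD(3)[OF assms(1)] test_fun_sum)

definition order_bound :: "(real^'d::finite) set \<Rightarrow> ((real^'d \<Rightarrow> complex) \<Rightarrow> complex) \<Rightarrow> real \<Rightarrow> nat \<Rightarrow> bool" where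
  "order_bound K T C N \<longleftrightarrow> (\<forall>\<phi> B. test_fun \<phi> \<longrightarrow> tsupp \<phi> \<subseteq> K \<longrightarrow> cbound N \<phi> B \<longrightarrow> norm (T \<phi>) \<le> C * B)"

lemma distribution_alt:
  "distribution T \<longleftrightarrow> test_linear T \<and> (\<forall>K. compact K \<longrightarrow> (\<exists>C N. order_bound K T C N))"
  unfolding distribution_def test_linear_def order_bound_def cbound_def
    imp_conjL by (rule refl)

lemma order_bound_mono:
  assumes "order_bound K T C N" "C \<le> C'" "N \<le> N'"
  shows "order_bound K T C' N'"
  unfolding order_bound_def
proof (intro allI impI)
  fix \<phi> B assume a: "test_fun \<phi>" "tsupp \<phi> \<subseteq> K" "cbound N' \<phi> B"
  \<comment> \<open>The empty word shows \<open>B \<ge> 0\<close>, which is what allows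
    \<open>C\<close> to be enlarged.\<close>
  have "norm (\<phi> 0) \<le> B"
    using a(3)[unfolded cbound_def, rule_format, of "[]" 0] by simp
  then have "C * B \<le> C' * B" using assms(2) by (meson mult_right_mono norm_ge_zero order_trans)
  moreover have "norm (T \<phi>) \<le> C * B"
    using assms(1)[unfolded order_bound_def, rule_format, OF a(1,2) cbound_mono[OF a(3) assms(3) order_refl]] .
  ultimately show "norm (T \<phi>) \<le> C' * B" by linarith
qed

lemma DH_distribution: "DH T \<Longrightarrow> distribution T" and DH_linear: "DH T \<Longrightarrow> test_linear T"
  unfolding DH_def distribution_alt by auto

lemma distribution_order:
  assumes "distribution T" "compact K"
  obtains C N where "C > 0" "order_bound K T C N"
proof -
  obtain C N where "order_bound K T C N" using assms unfolding distribution_alt by blast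
  then show ?thesis using that[of "max C 1" N] order_bound_mono[of K T C N "max C 1" N] by auto
qed

subsection \<open>Integrals depending smoothly on parameters\<close>

text \<open>One shape for all averaging constructions: multiplicative convolutions (\<open>u\<close>
  varying, \<open>w = 0\<close>), the quotient by a coordinate (\<open>u = coord_scale j\<close>),
  and integrals along a coordinate line (\<open>w\<close> varying).\<close>

definition param_int :: "'a::euclidean_space \<Rightarrow> 'a \<Rightarrow> ('a \<Rightarrow> complex) \<Rightarrow> ('a \<Rightarrow> real^'d) \<Rightarrow> ('a \<Rightarrow> real^'d) \<Rightarrow>
    (real^'d::finite \<Rightarrow> complex) \<Rightarrow> real^'d \<Rightarrow> complex" where
  "param_int a b h u w f x = integral (cbox a b) (\<lambda>v. h v * f (x * u v + w v))"

lemma continuous_on_param_int: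
  assumes "continuous_on UNIV f" "continuous_on (cbox a b) h" "continuous_on (cbox a b) u" "continuous_on (cbox a b) w"
  shows "continuous_on UNIV (param_int a b h u w f)"
  unfolding param_int_def
proof (rule integral_continuous_on_param, unfold case_prod_unfold, intro continuous_intros
    continuous_on_compose2[OF assms(1)] continuous_on_compose2[OF assms(2)]
    continuous_on_compose2[OF assms(3)] continuous_on_compose2[OF assms(4)])
qed auto

lemma partial_param_int:
  assumes "smooth_fun f" "continuous_on (cbox a b) h" "continuous_on (cbox a b) u" "continuous_on (cbox a b) w"
  shows "differentiable_in j (param_int a b h u w f)"
    "partial j (param_int a b h u w f) = param_int a b (\<lambda>v. h v * of_real (u v $ j)) u w (partial j f)"
proof -
  note d = smooth_fun_differentiable[OF assms(1), of j]
  have "((\<lambda>t. param_int a b h u w f (x + t *\<^sub>R axis j 1)) has_vector_derivative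
      param_int a b (\<lambda>v. h v * of_real (u v $ j)) u w (partial j f) x) (at 0)" for x
  proof -
    have "((\<lambda>t. integral (cbox a b) (\<lambda>v. h v * f ((x + t *\<^sub>R axis j 1) * u v + w v))) has_vector_derivative
      integral (cbox a b) (\<lambda>v. h v * (of_real (u v $ j) * partial j f ((x + 0 *\<^sub>R axis j 1) * u v + w v)))) (at 0 within UNIV)"
    proof (rule leibniz_rule_vector_derivative)
      show "((\<lambda>t. h v * f ((x + t *\<^sub>R axis j 1) * u v + w v)) has_vector_derivative
          h v * (of_real (u v $ j) * partial j f ((x + t *\<^sub>R axis j 1) * u v + w v))) (at t within UNIV)" for t v
        using has_vector_derivative_mult_right[OF has_partial_at[OF partial_dilation(1)[OF d, of "u v" "w v"], of x t UNIV], of "h v"]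
        by (simp only: partial_dilation(2)[OF d])
      show "(\<lambda>v. h v * f ((x + t *\<^sub>R axis j 1) * u v + w v)) integrable_on cbox a b" for t
        by (intro integrable_continuous continuous_intros assms
            continuous_on_compose2[OF smooth_fun_continuous[OF assms(1), of UNIV]]) auto
      show "continuous_on (UNIV \<times> cbox a b)
         (\<lambda>(t, v). h v * (complex_of_real (u v $ j) * partial j f ((x + t *\<^sub>R axis j 1) * u v + w v)))"
        unfolding case_prod_unfold
        by (intro continuous_intros continuous_on_compose2[OF assms(2)]
            continuous_on_compose2[OF assms(3)] continuous_on_compose2[OF assms(4)]
            continuous_on_compose2[OF smooth_fun_continuous[OF smooth_fun_partial[OF assms(1)], of UNIV]]) auto
    qed auto
    then show ?thesis by (simp add: param_int_def mult.assoc)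
  qed
  note * = partialI[where f="param_int a b h u w f", OF this]
  show "differentiable_in j (param_int a b h u w f)"
    "partial j (param_int a b h u w f) = param_int a b (\<lambda>v. h v * of_real (u v $ j)) u w (partial j f)"
    by (fact *)+
qed

text \<open>With \<open>u\<close> and \<open>w\<close> fixed the class is closed under
  \<open>partial\<close>: the chain rule only multiplies the weight \<open>h\<close> by a coordinate
  of \<open>u\<close> and replaces \<open>f\<close> by \<open>partial j f\<close>.\<close>

lemma smooth_fun_param_int:
  fixes f :: "real^'d::finite \<Rightarrow> complex"
  assumes "smooth_fun f" "continuous_on (cbox a b) h" "continuous_on (cbox a b) u" "continuous_on (cbox a b) w"
  shows "smooth_fun (param_int a b h u w f)"
proof (rule smooth_fun_coinduct[where X="\<lambda>g. \<exists>h f. continuous_on (cbox a b) h \<and> smooth_fun f \<and> g = param_int a b h u w f"])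
  fix g :: "real^'d \<Rightarrow> complex"
  assume "\<exists>h f. continuous_on (cbox a b) h \<and> smooth_fun f \<and> g = param_int a b h u w f"
  then obtain h f where g: "continuous_on (cbox a b) h" "smooth_fun f" "g = param_int a b h u w f" by blast
  show "continuous_on UNIV g" unfolding g(3)
    by (intro continuous_on_param_int smooth_fun_continuous assms g)
  fix j
  have "continuous_on (cbox a b) (\<lambda>v. h v * of_real (u v $ j))"
    by (intro continuous_intros g assms)
  then show "differentiable_in j g \<and> (\<exists>h f. continuous_on (cbox a b) h \<and> smooth_fun f \<and> partial j g = param_int a b h u w f)"
    using partial_param_int[OF g(2,1) assms(3,4), of j] smooth_fun_partial[OF g(2), of j] unfolding g(3) by blast
qed (use assms in blast)

lemma iter_partial_param_int:
  assumes "smooth_fun f" "continuous_on (cbox a b) h" "continuous_on (cbox a b) u" "continuous_on (cbox a b) w"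
  shows "iter_partial js (param_int a b h u w f) =
      param_int a b (\<lambda>v. h v * of_real (\<Prod>j\<leftarrow>js. u v $ j)) u w (iter_partial js f)"
proof (induction js)
  case (Cons j js)
  have c: "continuous_on (cbox a b) (\<lambda>v. (\<Prod>j\<leftarrow>js. u v $ j))"
    by (induction js) (auto intro!: continuous_intros assms)
  have "continuous_on (cbox a b) (\<lambda>v. h v * of_real (\<Prod>j\<leftarrow>js. u v $ j))"
    by (intro continuous_intros assms c)
  from partial_param_int(2)[OF smooth_fun_iter_partial[OF assms(1)] this assms(3,4)]
  show ?case by (simp add: Cons mult_ac)
qed simp

text \<open>Only the modulus of continuity at scale \<delta> enters, so one tagged division serves a
  whole family of integrands; below these are all derivatives of order at most \<open>N\<close> at
  all points \<open>x\<close>.\<close>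

lemma riemann_sum_error:
  fixes f :: "'a::euclidean_space \<Rightarrow> complex"
  assumes f: "continuous_on (cbox a b) f" and p: "p tagged_division_of cbox a b" "(\<lambda>v. ball v \<delta>) fine p"
    and d: "\<And>v v'. v \<in> cbox a b \<Longrightarrow> v' \<in> cbox a b \<Longrightarrow> dist v v' < \<delta> \<Longrightarrow> norm (f v - f v') \<le> \<epsilon>"
    and e: "0 \<le> \<epsilon>"
  shows "norm (integral (cbox a b) f - (\<Sum>(v,k)\<in>p. measure lborel k *\<^sub>R f v)) \<le> \<epsilon> * measure lborel (cbox a b)"
proof -
  have "integral (cbox a b) f = (\<Sum>(v,k)\<in>p. integral k f)"
    by (intro integral_combine_tagged_division_topdown integrable_continuous f p)
  then have "integral (cbox a b) f - (\<Sum>(v,k)\<in>p. measure lborel k *\<^sub>R f v) = (\<Sum>(v,k)\<in>p. integral k f - measure lborel k *\<^sub>R f v)"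
    by (simp add: sum_subtractf case_prod_unfold)
  also have "norm \<dots> \<le> (\<Sum>(v,k)\<in>p. \<epsilon> * measure lborel k)"
  proof (rule sum_norm_le)
    fix x assume x: "x \<in> p"
    obtain v k where vk: "x = (v, k)" by (cases x)
    obtain c d where k: "k = cbox c d" using tagged_division_ofD(4)[OF p(1)] x vk by blast
    have sub: "k \<subseteq> cbox a b" "v \<in> k" using tagged_division_ofD(2,3)[OF p(1)] x vk by blast+
    have kb: "k \<subseteq> ball v \<delta>" using p(2) x vk by (auto simp: fine_def)
    have "f integrable_on cbox c d"
      using sub k f by (intro integrable_continuous) (metis continuous_on_subset)
    then have "((\<lambda>z. f z - f v) has_integral integral k f - measure lborel k *\<^sub>R f v) (cbox c d)"
      unfolding k by (intro has_integral_diff integrable_integral has_integral_const)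
    then have "norm (integral k f - measure lborel k *\<^sub>R f v) \<le> \<epsilon> * measure lborel (cbox c d)"
    proof (rule has_integral_bound[OF e])
      fix z assume z: "z \<in> cbox c d"
      then have "dist v z < \<delta>" using kb k by auto
      then show "norm (f z - f v) \<le> \<epsilon>" using d[of v z] z sub k by (auto simp: norm_minus_commute)
    qed
    then show "norm (case x of (v, k) \<Rightarrow> integral k f - measure lborel k *\<^sub>R f v) \<le> (case x of (v, k) \<Rightarrow> \<epsilon> * measure lborel k)"
      using vk k by simp
  qed
  also have "\<dots> = \<epsilon> * measure lborel (cbox a b)"
    using additive_content_tagged_division[OF p(1)]
    by (simp add: case_prod_unfold sum_distrib_left[symmetric])
  finally show ?thesis .
qed

text \<open>The support of \<open>dil (u v) \<psi>\<close> lies in the image of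
  \<open>tsupp \<psi>\<close> under multiplication by \<open>vinv (u v)\<close>, which depends
  continuously on \<open>v\<close> in a compact set. A single \<open>K\<close> means a single order
  estimate for \<open>T\<close>.\<close>

lemma compact_dil_supports:
  assumes "test_fun \<psi>" "continuous_on S u" "compact S" "\<And>v. v \<in> S \<Longrightarrow> all_nz (u v)"
  obtains K where "compact K" "\<And>v. v \<in> S \<Longrightarrow> tsupp (dil (u v) \<psi>) \<subseteq> K"
proof -
  have "continuous_on S (\<lambda>v. vinv (u v))"
    unfolding vinv_def using assms(2,4) by (intro continuous_intros) (auto simp: all_nz_def)
  then have "compact ((\<lambda>(x,v). x * vinv (u v)) ` (tsupp \<psi> \<times> S))"
    unfolding case_prod_unfold
    by (intro compact_continuous_image compact_Times test_funD assms continuous_intros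
        continuous_on_compose2[of S "\<lambda>v. vinv (u v)" _ snd]) auto
  moreover have "tsupp (dil (u v) \<psi>) \<subseteq> (\<lambda>(x,v). x * vinv (u v)) ` (tsupp \<psi> \<times> S)" if "v \<in> S" for v
    using test_fun_dil(2)[OF assms(1) assms(4)[OF that]] that by force
  ultimately show ?thesis using that by blast
qed

text \<open>Riemann sums of the dilates converge to the integral in the C^N norm with supports in
  one compact set, so \<open>T\<close> of them converges to \<open>T\<close> of the integral. At the
  same time \<open>T\<close> of them is a Riemann sum of the scalar integrand, which converges by
  the continuity assumed for \<open>T (dil (u v) \<psi>)\<close>.\<close>

lemma distribution_param_int:
  fixes \<psi> :: "real^'d::finite \<Rightarrow> complex"
  assumes T: "distribution T" and psi: "test_fun \<psi>"
    and h: "continuous_on (cbox a b) h" and u: "continuous_on (cbox a b) u"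
    and nz: "\<And>v. v \<in> cbox a b \<Longrightarrow> all_nz (u v)"
    and cT: "continuous_on (cbox a b) (\<lambda>v. T (dil (u v) \<psi>))"
  shows "test_fun (param_int a b h u (\<lambda>_. 0) \<psi>)"
    "T (param_int a b h u (\<lambda>_. 0) \<psi>) = integral (cbox a b) (\<lambda>v. h v * T (dil (u v) \<psi>))"
proof -
  let ?I = "param_int a b h u (\<lambda>_. 0) \<psi>"
  obtain K where K: "compact K" "\<And>v. v \<in> cbox a b \<Longrightarrow> tsupp (dil (u v) \<psi>) \<subseteq> K"
    using compact_dil_supports[OF psi u compact_cbox nz] by blast
  note sm = test_funD(1)[OF psi]
  have Ieq: "?I x = integral (cbox a b) (\<lambda>v. h v * dil (u v) \<psi> x)" for x
    by (simp add: param_int_def dil_def)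
  have I0: "x \<in> K" if "?I x \<noteq> 0" for x
  proof (rule ccontr)
    assume "x \<notin> K"
    then have "dil (u v) \<psi> x = 0" if "v \<in> cbox a b" for v
      using K(2)[OF that] tsupp_superset by blast
    then have "?I x = integral (cbox a b) (\<lambda>v. 0)"
      unfolding Ieq by (intro integral_cong) auto
    then show False using that by simp
  qed
  have "smooth_fun ?I" by (intro smooth_fun_param_int sm h u continuous_intros)
  from test_funI[OF this K(1) I0]
  have It: "test_fun ?I" and IK: "tsupp ?I \<subseteq> K" by auto
  show "test_fun ?I" by (fact It)
  obtain C N where C: "C > 0" "order_bound K T C N" using distribution_order[OF T K(1)] by blast
  note L = T[unfolded distribution_alt, THEN conjunct1]
  define g where "g js v x = h v * of_real (\<Prod>j\<leftarrow>js. u v $ j) * iter_partial js \<psi> (x * u v)" for js v x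
  have gdil: "g js v x = h v * iter_partial js (dil (u v) \<psi>) x" for js v x
    by (simp add: g_def iter_partial_dil[OF sm])
  have pc: "continuous_on A (\<lambda>y. (\<Prod>j\<leftarrow>js. u y $ j))" if "A \<subseteq> cbox a b" for A js
    by (induction js) (auto intro!: continuous_intros continuous_on_subset[OF u that])
  have cg: "continuous_on (cbox a b \<times> K) (\<lambda>(v,x). g js v x)" for js
    unfolding g_def case_prod_unfold
    by (intro continuous_intros continuous_on_compose2[OF h] continuous_on_compose2[OF u]
          continuous_on_compose2[OF pc[OF order_refl]]
          continuous_on_compose2[OF smooth_fun_continuous[OF smooth_fun_iter_partial[OF sm], of UNIV]]) auto
  have Ig: "iter_partial js ?I x = integral (cbox a b) (\<lambda>v. g js v x)" for js x
    using iter_partial_param_int[OF sm h u, of "\<lambda>_. 0" js] by (simp add: param_int_def g_def)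
  have g0: "g js v x = 0" if "x \<notin> K" "v \<in> cbox a b" for js v x
    using that K(2) iter_partial_zero_outside[of x "dil (u v) \<psi>" js] by (auto simp: gdil)
  let ?G = "\<lambda>v. h v * T (dil (u v) \<psi>)"
  have cG: "continuous_on (cbox a b) ?G" by (intro continuous_intros h cT)
  \<comment> \<open>The multiple of \<open>C\<close> comes from the C^N distance between the
    integral and a Riemann sum, the extra 1 from the scalar Riemann sum.\<close>
  have "norm (T ?I - integral (cbox a b) ?G) \<le> \<epsilon> * (C * measure lborel (cbox a b) + 1)" if e: "\<epsilon> > 0" for \<epsilon>
  proof -
    have "\<exists>d>0. \<forall>v\<in>cbox a b. \<forall>v'\<in>cbox a b. \<forall>x. dist v v' < d \<longrightarrow> norm (g js v x - g js v' x) \<le> \<epsilon>" for js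
    proof -
      have "uniformly_continuous_on (cbox a b \<times> K) (\<lambda>(v,x). g js v x)"
        by (intro compact_uniformly_continuous cg compact_Times compact_cbox K)
      then obtain d where d: "d > 0" "\<And>p p'. p \<in> cbox a b \<times> K \<Longrightarrow> p' \<in> cbox a b \<times> K \<Longrightarrow> dist p' p < d \<Longrightarrow>
          dist (case p' of (v,x) \<Rightarrow> g js v x) (case p of (v,x) \<Rightarrow> g js v x) < \<epsilon>"
        unfolding uniformly_continuous_on_def using e by meson
      have "norm (g js v x - g js v' x) \<le> \<epsilon>" if "v \<in> cbox a b" "v' \<in> cbox a b" "dist v v' < d" for v v' x
      proof (cases "x \<in> K")
        case True
        then show ?thesis using d(2)[of "(v',x)" "(v,x)"] that by (auto simp: dist_Pair_Pair dist_norm)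
      qed (use that e g0 in auto)
      then show ?thesis using d(1) by blast
    qed
    then obtain d where d: "\<And>js. d js > 0" "\<And>js v v' x. v \<in> cbox a b \<Longrightarrow> v' \<in> cbox a b \<Longrightarrow> dist v v' < d js \<Longrightarrow>
        norm (g js v x - g js v' x) \<le> \<epsilon>" by metis
    \<comment> \<open>One scale for all of the finitely many words of length at most
      \<open>N\<close>.\<close>
    define \<delta> where "\<delta> = Min (d ` {js::'d list. length js \<le> N})"
    have ne: "d ` {js::'d list. length js \<le> N} \<noteq> {}" by (auto intro: exI[of _ "[]"])
    have \<delta>: "\<delta> > 0" "\<And>js. length js \<le> N \<Longrightarrow> \<delta> \<le> d js"
      unfolding \<delta>_def using d(1) ne finite_words[where 'd='d, of N] by auto
    have "(?G has_integral integral (cbox a b) ?G) (cbox a b)"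
      by (intro integrable_integral integrable_continuous cG)
    then obtain \<gamma> where \<gamma>: "gauge \<gamma>" "\<And>p. p tagged_division_of (cbox a b) \<Longrightarrow> \<gamma> fine p \<Longrightarrow>
        norm ((\<Sum>(v,k)\<in>p. measure lborel k *\<^sub>R ?G v) - integral (cbox a b) ?G) < \<epsilon>"
      unfolding has_integral using e by meson
    \<comment> \<open>A division fine for both gauges controls the scalar integral and the
      derivatives at once.\<close>
    have "gauge (\<lambda>v. \<gamma> v \<inter> ball v \<delta>)" by (intro gauge_Int \<gamma>(1) gauge_ball \<delta>)
    then obtain p where p: "p tagged_division_of (cbox a b)" "(\<lambda>v. \<gamma> v \<inter> ball v \<delta>) fine p"
      using fine_division_exists by blast
    have p2: "\<gamma> fine p" "(\<lambda>v. ball v \<delta>) fine p" using p(2) by (auto simp: fine_Int)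
    have ptag: "fst z \<in> cbox a b" if "z \<in> p" for z
    proof (cases z)
      case (Pair v k)
      then show ?thesis
        using tagged_division_ofD(2)[OF p(1), of v k] tagged_division_ofD(3)[OF p(1), of v k] that by auto
    qed
    let ?R = "\<lambda>x. \<Sum>z\<in>p. (of_real (measure lborel (snd z)) * h (fst z)) * dil (u (fst z)) \<psi> x"
    have Rt: "test_fun ?R"
      by (intro test_fun_sum test_fun_cmult test_fun_dil psi nz ptag)
    have Rs: "iter_partial js ?R x = (\<Sum>(v,k)\<in>p. measure lborel k *\<^sub>R g js v x)" for js x
    proof -
      have "iter_partial js ?R x = (\<Sum>z\<in>p. iter_partial js (\<lambda>x. (of_real (measure lborel (snd z)) * h (fst z)) * dil (u (fst z)) \<psi> x) x)"
        by (subst iter_partial_sum) (auto intro!: smooth_fun_cmult smooth_fun_dil sm)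
      also have "\<dots> = (\<Sum>(v,k)\<in>p. measure lborel k *\<^sub>R g js v x)"
        unfolding iter_partial_cmult[OF smooth_fun_dil[OF sm]]
        by (simp add: case_prod_unfold gdil scaleR_conv_of_real[where 'a=complex] mult.assoc)
      finally show ?thesis .
    qed
    have RK: "tsupp ?R \<subseteq> K"
    proof (rule tsupp_subset[OF compact_imp_closed[OF K(1)]])
      fix x assume "?R x \<noteq> 0"
      then obtain z where "z \<in> p" "(of_real (measure lborel (snd z)) * h (fst z)) * dil (u (fst z)) \<psi> x \<noteq> 0"
        using sum.neutral by (metis (no_types, lifting))
      then show "x \<in> K" using K(2)[OF ptag[OF \<open>z \<in> p\<close>]] tsupp_superset[of "dil (u (fst z)) \<psi>" x] by auto
    qed
    have TR: "T ?R = (\<Sum>(v,k)\<in>p. measure lborel k *\<^sub>R ?G v)"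
    proof -
      have "T ?R = (\<Sum>z\<in>p. T (\<lambda>x. (of_real (measure lborel (snd z)) * h (fst z)) * dil (u (fst z)) \<psi> x))"
        by (intro test_linear_sum[OF L] test_fun_cmult test_fun_dil psi nz ptag)
      also have "\<dots> = (\<Sum>(v,k)\<in>p. measure lborel k *\<^sub>R ?G v)"
        unfolding case_prod_unfold
        by (intro sum.cong refl, subst test_linearD(1)[OF L])
           (auto intro!: test_fun_dil psi nz ptag simp: scaleR_conv_of_real[where 'a=complex] mult.assoc)
      finally show ?thesis .
    qed
    have "cbound N (\<lambda>x. ?I x - ?R x) (\<epsilon> * measure lborel (cbox a b))"
      unfolding cbound_def
    proof (intro allI impI)
      fix js :: "'d list" and x assume js: "length js \<le> N"
      have cgx: "continuous_on (cbox a b) (\<lambda>v. g js v x)"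
        unfolding g_def
        by (intro continuous_intros h u pc order_refl
          continuous_on_compose2[OF smooth_fun_continuous[OF smooth_fun_iter_partial[OF sm], of UNIV]]) auto
      have "norm (integral (cbox a b) (\<lambda>v. g js v x) - (\<Sum>(v,k)\<in>p. measure lborel k *\<^sub>R g js v x)) \<le> \<epsilon> * measure lborel (cbox a b)"
        using d(2) \<delta>(2)[OF js] e by (intro riemann_sum_error[OF cgx p(1) p2(2)]) force+
      then show "norm (iter_partial js (\<lambda>x. ?I x - ?R x) x) \<le> \<epsilon> * measure lborel (cbox a b)"
        by (simp only: iter_partial_diff[OF test_funD(1)[OF It] test_funD(1)[OF Rt]] Ig Rs)
    qed
    moreover have "tsupp (\<lambda>x. ?I x - ?R x) \<subseteq> K"
    proof (rule tsupp_subset[OF compact_imp_closed[OF K(1)]])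
      fix x assume "?I x - ?R x \<noteq> 0"
      then have "?I x \<noteq> 0 \<or> ?R x \<noteq> 0" by auto
      then show "x \<in> K" using IK RK tsupp_superset[of ?I x] tsupp_superset[of ?R x] by blast
    qed
    ultimately have "norm (T (\<lambda>x. ?I x - ?R x)) \<le> C * (\<epsilon> * measure lborel (cbox a b))"
      using C(2) test_fun_diff[OF It Rt] unfolding order_bound_def by blast
    then have "norm (T ?I - T ?R) \<le> C * (\<epsilon> * measure lborel (cbox a b))"
      by (simp only: test_linearD(4)[OF L It Rt])
    moreover have "norm (T ?R - integral (cbox a b) ?G) < \<epsilon>" unfolding TR by (intro \<gamma>(2) p(1) p2(1))
    ultimately show ?thesis
      using norm_triangle_ineq[of "T ?I - T ?R" "T ?R - integral (cbox a b) ?G"] by (simp add: algebra_simps)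
  qed
  then have *: "norm (T ?I - integral (cbox a b) ?G) / (C * measure lborel (cbox a b) + 1) \<le> \<epsilon>" if "\<epsilon> > 0" for \<epsilon>
    using that C(1) by (simp add: pos_divide_le_eq add_nonneg_pos)
  have "norm (T ?I - integral (cbox a b) ?G) / (C * measure lborel (cbox a b) + 1) \<le> 0"
    by (rule field_le_epsilon) (use * in auto)
  then show "T ?I = integral (cbox a b) ?G"
    using C(1) by (simp add: divide_le_0_iff add_nonneg_pos not_le order_less_le_trans)
       (smt (verit) content_pos_le mult_nonneg_nonneg norm_ge_zero)
qed

subsection \<open>Uniform boundedness for test functions with support in a compact set\<close>

text \<open>Completeness of the test functions supported in \<open>K\<close>: on each coordinate
  line, the theorem on limits of derivatives identifies the limit for the word \<open>j # js\<close>
  as the derivative of the limit for \<open>js\<close>.\<close>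

lemma test_fun_limit:
  fixes f :: "nat \<Rightarrow> real^'d::finite \<Rightarrow> complex"
  assumes K: "compact K" and f: "\<And>n. test_fun (f n)" "\<And>n. tsupp (f n) \<subseteq> K"
    and lim: "\<And>js. uniform_limit UNIV (\<lambda>n. iter_partial js (f n)) (g js) sequentially"
  shows "test_fun (g [])" "tsupp (g []) \<subseteq> K" "iter_partial js (g []) = g js"
proof -
  have pw: "(\<lambda>n. iter_partial js (f n) x) \<longlonglongrightarrow> g js x" for js x
    using tendsto_uniform_limitI[OF lim] by auto
  have cg: "continuous_on UNIV (g js)" for js
    by (rule uniform_limit_theorem[OF _ lim])
       (auto intro!: always_eventually smooth_fun_continuous smooth_fun_iter_partial test_funD(1)[OF f(1)])
  have d: "((\<lambda>t. g js (x + t *\<^sub>R axis j 1)) has_vector_derivative g (j # js) x) (at 0)" for js j x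
  proof -
    have "\<exists>G. \<forall>t\<in>UNIV. (\<lambda>n. iter_partial js (f n) (x + t *\<^sub>R axis j 1)) \<longlonglongrightarrow> G t \<and>
       (G has_derivative (\<lambda>h. h *\<^sub>R g (j # js) (x + t *\<^sub>R axis j 1))) (at t within UNIV)"
    proof (rule has_derivative_sequence[where ?x0.0=0 and f'="\<lambda>n t h. h *\<^sub>R iter_partial (j # js) (f n) (x + t *\<^sub>R axis j 1)"])
      show "((\<lambda>t. iter_partial js (f n) (x + t *\<^sub>R axis j 1)) has_derivative
          (\<lambda>h. h *\<^sub>R iter_partial (j # js) (f n) (x + t *\<^sub>R axis j 1))) (at t within UNIV)" for n t
        using has_partial_at[OF smooth_fun_differentiable[OF smooth_fun_iter_partial[OF test_funD(1)[OF f(1)]]]]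
        by (simp add: has_vector_derivative_def)
      show "\<forall>\<^sub>F n in sequentially. \<forall>t\<in>UNIV. \<forall>h. norm (h *\<^sub>R iter_partial (j # js) (f n) (x + t *\<^sub>R axis j 1) -
          h *\<^sub>R g (j # js) (x + t *\<^sub>R axis j 1)) \<le> e * norm h" if "e > 0" for e
      proof -
        have "\<forall>\<^sub>F n in sequentially. \<forall>x\<in>UNIV. dist (iter_partial (j # js) (f n) x) (g (j # js) x) < e"
          using lim that unfolding uniform_limit_iff by blast
        then show ?thesis
        proof eventually_elim
          case (elim n)
          show ?case
          proof (intro ballI allI)
            fix t h :: real
            have "norm (iter_partial (j # js) (f n) (x + t *\<^sub>R axis j 1) - g (j # js) (x + t *\<^sub>R axis j 1)) \<le> e"
              using elim unfolding dist_norm by (meson UNIV_I less_imp_le)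
            then show "norm (h *\<^sub>R iter_partial (j # js) (f n) (x + t *\<^sub>R axis j 1) -
              h *\<^sub>R g (j # js) (x + t *\<^sub>R axis j 1)) \<le> e * norm h"
              unfolding scaleR_diff_right[symmetric] norm_scaleR
              using mult_left_mono[OF _ abs_ge_zero[of h]] by (simp add: mult.commute[of e])
          qed
        qed
      qed
    qed (use pw in auto)
    then obtain G where G: "\<And>t. (\<lambda>n. iter_partial js (f n) (x + t *\<^sub>R axis j 1)) \<longlonglongrightarrow> G t"
       "\<And>t. (G has_derivative (\<lambda>h. h *\<^sub>R g (j # js) (x + t *\<^sub>R axis j 1))) (at t)" by auto
    have "G = (\<lambda>t. g js (x + t *\<^sub>R axis j 1))"
      using LIMSEQ_unique[OF G(1) pw] by (simp add: fun_eq_iff)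
    then show ?thesis using G(2)[of 0] by (simp add: has_vector_derivative_def)
  qed
  note p = partialI[OF d]
  show it: "iter_partial js (g []) = g js" for js
    by (induction js) (auto simp: p)
  have "smooth_fun (g [])" unfolding smooth_fun_alt using it cg p by metis
  moreover have "x \<in> K" if "g [] x \<noteq> 0" for x
  proof (rule ccontr)
    assume "x \<notin> K"
    then have "f n x = 0" for n using f(2) tsupp_superset by blast
    then have "(\<lambda>n. 0) \<longlonglongrightarrow> g [] x" using pw[of "[]" x] by simp
    then show False using that by (simp add: LIMSEQ_const_iff)
  qed
  ultimately show "test_fun (g [])" "tsupp (g []) \<subseteq> K" using test_funI[OF _ K, of "g []"] by blast+
qed

text \<open>The order controlled by the \<open>n\<close>-th bound grows with \<open>n\<close>: any
  fixed derivative is dominated from some index on, which gives smoothness, while derivatives up to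
  order \<open>M\<close> are dominated from the start, which gives the geometric sum
  \<open>2 * c\<close>.\<close>

lemma test_fun_series:
  fixes f :: "nat \<Rightarrow> real^'d::finite \<Rightarrow> complex"
  assumes K: "compact K" and f: "\<And>n. test_fun (f n)" "\<And>n. tsupp (f n) \<subseteq> K"
    and b: "\<And>n. cbound (M + n) (f n) (c / 2 ^ n)"
  shows "test_fun (\<lambda>x. \<Sum>n. f n x)" "tsupp (\<lambda>x. \<Sum>n. f n x) \<subseteq> K" "cbound M (\<lambda>x. \<Sum>n. f n x) (2 * c)"
    "\<And>x. summable (\<lambda>n. f n x)"
proof -
  have nb: "norm (iter_partial js (f n) x) \<le> c / 2 ^ n" if "length js \<le> M + n" for js n x
    using b that unfolding cbound_def by blast
  have c: "0 \<le> c" using order_trans[OF norm_ge_zero nb[of "[]" 0]] by simp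
  have geo: "summable (\<lambda>n. c / 2 ^ n)" "(\<Sum>n. c / 2 ^ n) = 2 * c"
    using summable_mult[OF summable_geometric[of "1/2::real"], of c]
      suminf_mult[OF summable_geometric[of "1/2::real"], of c] suminf_geometric[of "1/2::real"]
    by (simp_all add: power_one_over field_simps)
  have ul: "uniform_limit UNIV (\<lambda>n x. \<Sum>i<n. iter_partial js (f i) x) (\<lambda>x. suminf (\<lambda>i. iter_partial js (f i) x)) sequentially" for js
  proof (rule Weierstrass_m_test_ev[OF _ geo(1)])
    show "\<forall>\<^sub>F n in sequentially. \<forall>x\<in>UNIV. norm (iter_partial js (f n) x) \<le> c / 2 ^ n"
      using eventually_ge_at_top[of "length js"] by eventually_elim (auto intro!: nb)
  qed
  have it: "iter_partial js (\<lambda>x. \<Sum>i<n. f i x) = (\<lambda>x. \<Sum>i<n. iter_partial js (f i) x)" for js n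
    by (rule iter_partial_sum) (auto intro: test_funD f)
  have sK: "tsupp (\<lambda>x. \<Sum>i<n. f i x) \<subseteq> K" for n
  proof (rule tsupp_subset[OF compact_imp_closed[OF K]])
    fix x assume "(\<Sum>i<n. f i x) \<noteq> 0"
    then obtain i where "f i x \<noteq> 0" using sum.neutral by metis
    then show "x \<in> K" using f(2)[of i] tsupp_superset[of "f i" x] by blast
  qed
  note lim = test_fun_limit[where f="\<lambda>n x. \<Sum>i<n. f i x" and g="\<lambda>js x. suminf (\<lambda>i. iter_partial js (f i) x)",
      OF K test_fun_sum[OF f(1)] sK, unfolded it, OF ul]
  show "test_fun (\<lambda>x. \<Sum>n. f n x)" "tsupp (\<lambda>x. \<Sum>n. f n x) \<subseteq> K" using lim(1,2) by simp_all
  have sm: "summable (\<lambda>n. norm (iter_partial js (f n) x))" if "length js \<le> M" for js x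
    by (rule summable_comparison_test'[OF geo(1), of 0]) (use that in \<open>auto intro!: nb\<close>)
  show "summable (\<lambda>n. f n x)" for x using summable_norm_cancel[OF sm[of "[]" x]] by simp
  show "cbound M (\<lambda>x. \<Sum>n. f n x) (2 * c)"
    unfolding cbound_def
  proof (intro allI impI)
    fix js :: "'d list" and x assume js: "length js \<le> M"
    have "norm (\<Sum>n. iter_partial js (f n) x) \<le> (\<Sum>n. norm (iter_partial js (f n) x))"
      by (rule summable_norm[OF sm[OF js]])
    also have "\<dots> \<le> (\<Sum>n. c / 2 ^ n)"
      by (rule suminf_le[OF _ sm[OF js] geo(1)]) (use js in \<open>auto intro!: nb\<close>)
    finally show "norm (iter_partial js (\<lambda>x. \<Sum>n. f n x) x) \<le> 2 * c"
      using lim(3)[of js] geo(2) by simp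
  qed
qed

text \<open>A gliding hump argument: otherwise one can sum a rapidly decreasing series of
  test functions on which the family is unbounded.\<close>

lemma uniform_boundedness:
  fixes \<Lambda> :: "'i \<Rightarrow> (real^'d::finite \<Rightarrow> complex) \<Rightarrow> complex"
  assumes K: "compact K"
    and lin: "\<And>i. test_linear (\<Lambda> i)"
    and cont: "\<And>i. \<exists>C N. order_bound K (\<Lambda> i) C N"
    and pw: "\<And>\<phi>. test_fun \<phi> \<Longrightarrow> tsupp \<phi> \<subseteq> K \<Longrightarrow> \<exists>B. \<forall>i. norm (\<Lambda> i \<phi>) \<le> B"
  obtains C N where "C > 0" "\<And>i. order_bound K (\<Lambda> i) C N"
proof -
  have "\<exists>C N. C > 0 \<and> (\<forall>i. order_bound K (\<Lambda> i) C N)"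
  proof (rule ccontr)
    assume neg: "\<not> ?thesis"
    \<comment> \<open>Negation gives a function that violates the order bound with constant
      \<open>A / \<epsilon>\<close>; rescaled to C^N size \<epsilon>, it makes the functional exceed
      \<open>A\<close>.\<close>
    have hump: "\<exists>i \<phi>. test_fun \<phi> \<and> tsupp \<phi> \<subseteq> K \<and> cbound N \<phi> \<epsilon> \<and> norm (\<Lambda> i \<phi>) > A"
      if "\<epsilon> > 0" "A > 0" for N \<epsilon> A
    proof -
      have "A / \<epsilon> > 0" using that by simp
      then obtain i where "\<not> order_bound K (\<Lambda> i) (A / \<epsilon>) N" using neg by blast
      then obtain \<phi> B where p: "test_fun \<phi>" "tsupp \<phi> \<subseteq> K" "cbound N \<phi> B" "norm (\<Lambda> i \<phi>) > A / \<epsilon> * B"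
        unfolding order_bound_def by (meson not_le)
      have B0: "norm (\<phi> x) \<le> B" for x
        using p(3)[unfolded cbound_def, rule_format, of "[]" x] by simp
      have "B > 0"
      proof (rule ccontr)
        assume "\<not> B > 0"
        then have "\<phi> = (\<lambda>x. 0)" "B = 0" using B0 order_trans[OF norm_ge_zero B0] by (fastforce simp: fun_eq_iff)+
        then show False using p(4) test_linearD(2)[OF lin test_fun_zero] by simp
      qed
      let ?c = "complex_of_real (\<epsilon> / B)"
      let ?\<psi> = "\<lambda>x. ?c * \<phi> x"
      have nc: "norm ?c = \<epsilon> / B" using \<open>B > 0\<close> that by (simp add: norm_divide)
      have "cbound N ?\<psi> \<epsilon>"
        using cbound_cmult[OF test_funD(1)[OF p(1)] p(3), of ?c] nc \<open>B > 0\<close> by simp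
      moreover have "norm (\<Lambda> i ?\<psi>) > A"
      proof -
        have "norm (\<Lambda> i ?\<psi>) = \<epsilon> / B * norm (\<Lambda> i \<phi>)"
          by (simp only: test_linearD(1)[OF lin p(1)] norm_mult nc)
        also have "\<dots> > \<epsilon> / B * (A / \<epsilon> * B)"
          using p(4) that \<open>B > 0\<close> by (intro mult_strict_left_mono) auto
        finally show ?thesis using that \<open>B > 0\<close> by simp
      qed
      moreover have "tsupp ?\<psi> \<subseteq> K"
        using p(2) tsupp_superset[of \<phi>] by (intro tsupp_subset compact_imp_closed K) auto
      ultimately show ?thesis using test_fun_cmult[OF p(1)] by blast
    qed
    obtain C N where CN: "\<And>i. C i > 0" "\<And>i. order_bound K (\<Lambda> i) (C i) (N i)"
    proof -
      have "\<exists>C N. C > 0 \<and> order_bound K (\<Lambda> i) C N" for i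
        using cont[of i] order_bound_mono[of K "\<Lambda> i" _ _ "max _ 1"] by (metis max.cobounded1 max.strict_coboundedI2 order_refl zero_less_one)
      then show ?thesis using that by metis
    qed
    define ok where "ok \<phi> \<longleftrightarrow> test_fun \<phi> \<and> tsupp \<phi> \<subseteq> K" for \<phi> :: "real^'d \<Rightarrow> complex"
    obtain Bd where Bd: "\<And>\<phi> i. ok \<phi> \<Longrightarrow> norm (\<Lambda> i \<phi>) \<le> Bd \<phi>"
      using pw unfolding ok_def by metis
    \<comment> \<open>The admissible next humps after the list \<open>l\<close> of those already chosen.\<close>
    define step where "step l p \<longleftrightarrow> ok (snd p) \<and>
        (\<forall>q\<in>set l. cbound (N (fst q) + length l) (snd p) (1 / (C (fst q) * 2 ^ length l))) \<and>
        cbound (length l) (snd p) (1 / 2 ^ length l) \<and>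
        norm (\<Lambda> (fst p) (snd p)) > (\<Sum>q\<leftarrow>l. \<bar>Bd (snd q)\<bar>) + 3 + length l"
      for l :: "('i \<times> (real^'d \<Rightarrow> complex)) list" and p
    have ex: "\<exists>p. step l p" for l
    proof -
      \<comment> \<open>Since \<open>cbound\<close> is monotone, one order and one constant above
        those of all earlier functionals meet every smallness condition at once.\<close>
      define n where "n = (\<Sum>q\<leftarrow>l. N (fst q)) + length l"
      define c where "c = 1 + (\<Sum>q\<leftarrow>l. C (fst q))"
      have "0 \<le> (\<Sum>q\<leftarrow>l. C (fst q))" by (rule sum_list_nonneg) (auto intro: less_imp_le[OF CN(1)])
      then have c: "c > 0" "c \<ge> 1" unfolding c_def by auto
      have mem: "N (fst q) + length l \<le> n" "C (fst q) \<le> c" if "q \<in> set l" for q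
      proof -
        show "N (fst q) + length l \<le> n" unfolding n_def using that by (simp add: member_le_sum_list)
        have "C (fst q) \<le> (\<Sum>q\<leftarrow>l. C (fst q))"
          using that
        proof (induction l)
          case (Cons a l)
          have "0 \<le> (\<Sum>q\<leftarrow>l. C (fst q))" by (rule sum_list_nonneg) (auto intro: less_imp_le[OF CN(1)])
          then show ?case using Cons CN(1)[of "fst a"] by auto
        qed simp
        then show "C (fst q) \<le> c" unfolding c_def by simp
      qed
      have "0 \<le> (\<Sum>q\<leftarrow>l. \<bar>Bd (snd q)\<bar>)" by (rule sum_list_nonneg) auto
      then have A: "(\<Sum>q\<leftarrow>l. \<bar>Bd (snd q)\<bar>) + 3 + length l > 0" by linarith
      have "1 / (c * 2 ^ length l) > 0" using c by simp
      from hump[OF this A, of n] obtain i \<phi> where p: "ok \<phi>" "cbound n \<phi> (1 / (c * 2 ^ length l))"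
          "norm (\<Lambda> i \<phi>) > (\<Sum>q\<leftarrow>l. \<bar>Bd (snd q)\<bar>) + 3 + length l" unfolding ok_def by blast
      have "step l (i, \<phi>)"
        unfolding step_def fst_conv snd_conv
      proof (intro conjI ballI p)
        show "cbound (length l) \<phi> (1 / 2 ^ length l)"
          using c by (intro cbound_mono[OF p(2)]) (auto simp: n_def field_simps)
        show "cbound (N (fst q) + length l) \<phi> (1 / (C (fst q) * 2 ^ length l))" if "q \<in> set l" for q
          using mem[OF that] CN(1)[of "fst q"] by (intro cbound_mono[OF p(2)]) (auto intro!: divide_left_mono)
      qed
      then show ?thesis by blast
    qed
    define L where "L = rec_nat [] (\<lambda>n l. l @ [SOME p. step l p])"
    have L: "L 0 = []" "L (Suc n) = L n @ [SOME p. step (L n) p]" for n by (simp_all add: L_def)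
    have len: "length (L n) = n" for n by (induction n) (auto simp: L)
    define P where "P n = (SOME p. step (L n) p)" for n
    have P: "step (L n) (P n)" for n unfolding P_def by (rule someI_ex[OF ex])
    have LP: "L n = map P [0..<n]" for n by (induction n) (auto simp: L P_def)
    define f where "f n = snd (P n)" for n
    define ix where "ix n = fst (P n)" for n
    have f: "test_fun (f n)" "tsupp (f n) \<subseteq> K" for n using P[of n] unfolding step_def ok_def f_def by auto
    have big: "norm (\<Lambda> (ix n) (f n)) > (\<Sum>k<n. \<bar>Bd (f k)\<bar>) + 3 + n" for n
      using P[of n] unfolding step_def f_def ix_def
      by (simp add: len) (simp add: LP o_def interv_sum_list_conv_sum_set_nat atLeast0LessThan)
    have small: "cbound (N (ix k) + n) (f n) (1 / (C (ix k) * 2 ^ n))" if "k < n" for k n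
    proof -
      have "P k \<in> set (L n)" using that by (auto simp: LP)
      then show ?thesis using P[of n] unfolding step_def f_def ix_def len by blast
    qed
    have small0: "cbound n (f n) (1 / 2 ^ n)" for n using P[of n] unfolding step_def f_def len by blast
    note ser = test_fun_series[where f=f and M=0 and c=1, simplified, OF K f small0]
    let ?\<phi> = "\<lambda>x. \<Sum>n. f n x"
    obtain B where B: "\<And>i. norm (\<Lambda> i ?\<phi>) \<le> B" using pw[OF ser(1,2)] by blast
    \<comment> \<open>On the sum, the functional \<open>ix n\<close> sees three parts: the earlier
      terms, at most the sum of their pointwise bounds; the hump, larger than that sum by more than
      \<open>n + 3\<close>; and the later terms, at most 2 because they were chosen small relative
      to \<open>C (ix n)\<close>.\<close>
    have "real n < B" for n
    proof -
      let ?r = "\<lambda>x. \<Sum>k. f (k + Suc n) x"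
      have b: "cbound (N (ix n) + k) (f (k + Suc n)) ((1 / C (ix n)) / 2 ^ k)" for k
      proof (rule cbound_mono[OF small[of n "k + Suc n"]])
        have "(2::real) ^ k \<le> 2 ^ (k + Suc n)" by (intro power_increasing) auto
        then show "1 / (C (ix n) * 2 ^ (k + Suc n)) \<le> (1 / C (ix n)) / 2 ^ k"
          using CN(1)[of "ix n"] unfolding divide_divide_eq_left
          by (intro divide_left_mono mult_left_mono mult_pos_pos) auto
      qed auto
      note r = test_fun_series[where f="\<lambda>k. f (k + Suc n)", OF K f b]
      have "norm (\<Lambda> (ix n) ?r) \<le> C (ix n) * (2 * (1 / C (ix n)))"
        using CN(2) r(1,2,3) unfolding order_bound_def by blast
      then have r2: "norm (\<Lambda> (ix n) ?r) \<le> 2" using CN(1)[of "ix n"] by simp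
      have "?\<phi> x = (\<Sum>k<n. f k x) + (f n x + ?r x)" for x
        using suminf_split_initial_segment[OF ser(4)[of x], of "Suc n"] by simp
      then have "\<Lambda> (ix n) ?\<phi> = \<Lambda> (ix n) (\<lambda>x. (\<Sum>k<n. f k x) + (f n x + ?r x))" by presburger
      also have "\<dots> = (\<Sum>k<n. \<Lambda> (ix n) (f k)) + (\<Lambda> (ix n) (f n) + \<Lambda> (ix n) ?r)"
        by (simp only: test_linearD(3)[OF lin] test_linear_sum[OF lin] test_fun_sum test_fun_add f r(1))
      finally have eq: "\<Lambda> (ix n) ?\<phi> = (\<Sum>k<n. \<Lambda> (ix n) (f k)) + (\<Lambda> (ix n) (f n) + \<Lambda> (ix n) ?r)" .
      have "norm (\<Sum>k<n. \<Lambda> (ix n) (f k)) \<le> (\<Sum>k<n. \<bar>Bd (f k)\<bar>)"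
        using Bd f unfolding ok_def by (intro sum_norm_le) (metis abs_ge_self order_trans)
      moreover have "norm (\<Lambda> (ix n) (f n)) \<le> norm (\<Lambda> (ix n) ?\<phi>) + norm (\<Sum>k<n. \<Lambda> (ix n) (f k)) + norm (\<Lambda> (ix n) ?r)"
        unfolding eq by (smt (verit) add_diff_cancel_left' add_diff_cancel_right' norm_triangle_ineq4)
      ultimately show ?thesis using big[of n] r2 B[of "ix n"] by linarith
    qed
    then show False using reals_Archimedean2[of B] less_asym by blast
  qed
  then show ?thesis using that by blast
qed

subsection \<open>The multiplier of a Hadamard type distribution\<close>

text \<open>Points with nonzero coordinates are dense: adding 1 / (n+1) to all coordinates
  eventually leaves every hyperplane.\<close>

lemma eq_if_eq_on_all_nz:
  fixes f g :: "real^'d::finite \<Rightarrow> complex"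
  assumes "continuous_on UNIV f" "continuous_on UNIV g" "\<And>y. all_nz y \<Longrightarrow> f y = g y"
  shows "f = g"
proof
  fix x :: "real^'d"
  let ?s = "\<lambda>n. x + inverse (real (Suc n)) *\<^sub>R 1"
  have "(\<lambda>n. inverse (real (Suc n))) \<longlonglongrightarrow> 0" by (rule LIMSEQ_inverse_real_of_nat)
  then have s: "?s \<longlonglongrightarrow> x + 0 *\<^sub>R 1" by (intro tendsto_intros)
  have "\<forall>\<^sub>F n in sequentially. ?s n $ j \<noteq> 0" for j
  proof (cases "x $ j = 0")
    case False
    have "(\<lambda>n. ?s n $ j) \<longlonglongrightarrow> x $ j" using tendsto_vec_nth[OF s] by simp
    then show ?thesis by (rule tendsto_imp_eventually_ne) (use False in auto)
  qed auto
  then have ev: "\<forall>\<^sub>F n in sequentially. all_nz (?s n)"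
    unfolding all_nz_def by (rule eventually_all_finite)
  have "(\<lambda>n. f (?s n)) \<longlonglongrightarrow> f x" "(\<lambda>n. g (?s n)) \<longlonglongrightarrow> g x"
    using continuous_on_tendsto_compose[OF assms(1) s] continuous_on_tendsto_compose[OF assms(2) s] by simp_all
  note lim = this
  have "\<forall>\<^sub>F n in sequentially. f (?s n) = g (?s n)"
    using ev by eventually_elim (rule assms(3))
  from LIMSEQ_unique[OF Lim_transform_eventually[OF lim(1) this] lim(2)] show "f x = g x" .
qed

text \<open>The test function N phi of the overview. It is picked by \<open>SOME\<close>, but
  density determines it, see \<open>multiplier_unique\<close>.\<close>

definition multiplier :: "((real^'d::finite \<Rightarrow> complex) \<Rightarrow> complex) \<Rightarrow> (real^'d \<Rightarrow> complex) \<Rightarrow> real^'d \<Rightarrow> complex" where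
  "multiplier T \<phi> = (SOME \<psi>. test_fun \<psi> \<and> (\<forall>y. all_nz y \<longrightarrow> T (dil y \<phi>) = \<psi> y))"

lemma multiplier:
  assumes "DH T" "test_fun \<phi>"
  shows "test_fun (multiplier T \<phi>)" "all_nz y \<Longrightarrow> multiplier T \<phi> y = T (dil y \<phi>)"
proof -
  have "\<exists>\<psi>. test_fun \<psi> \<and> (\<forall>y. all_nz y \<longrightarrow> T (dil y \<phi>) = \<psi> y)"
    using assms unfolding DH_def all_nz_def dil_def by blast
  from someI_ex[OF this] show "test_fun (multiplier T \<phi>)" "all_nz y \<Longrightarrow> multiplier T \<phi> y = T (dil y \<phi>)"
    unfolding multiplier_def by auto
qed

lemma multiplier_unique:
  assumes "DH T" "test_fun \<phi>" "continuous_on UNIV \<psi>" "\<And>y. all_nz y \<Longrightarrow> T (dil y \<phi>) = \<psi> y"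
  shows "multiplier T \<phi> = \<psi>"
  using multiplier[OF assms(1,2)] assms(3,4)
  by (intro eq_if_eq_on_all_nz) (auto intro: smooth_fun_continuous test_funD)

lemma dil_one [simp]: "dil 1 \<phi> = \<phi>"
  by (simp add: dil_def)

lemma multiplier_one: "DH T \<Longrightarrow> test_fun \<phi> \<Longrightarrow> multiplier T \<phi> 1 = T \<phi>"
  by (simp add: multiplier(2) all_nz_def)

text \<open>Off the hyperplanes the pairing with dilates is the multiplier, which is smooth. This
  supplies the continuity hypothesis of \<open>distribution_param_int\<close>.\<close>

lemma continuous_on_dilates:
  assumes "DH T" "test_fun \<phi>" "continuous_on S u" "\<And>v. v \<in> S \<Longrightarrow> all_nz (u v)"
  shows "continuous_on S (\<lambda>v. T (dil (u v) \<phi>))"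
proof -
  have "continuous_on S (\<lambda>v. multiplier T \<phi> (u v))"
    by (rule continuous_on_compose2[OF smooth_fun_continuous[OF test_funD(1)[OF multiplier(1)[OF assms(1,2)]], of UNIV] assms(3)]) auto
  then show ?thesis
    by (rule continuous_on_eq) (simp add: multiplier(2) assms)
qed

text \<open>Dilation moves \<open>K\<close> to another compact set and multiplies derivatives of
  order at most \<open>N\<close> by at most \<open>R ^ N\<close>. The constants depend on
  \<open>y\<close>; removing this dependence is the task of
  \<open>uniform_boundedness\<close>.\<close>

lemma order_bound_dilate:
  assumes T: "distribution T" and K: "compact K" and y: "all_nz y"
  shows "\<exists>C N. order_bound K (\<lambda>\<phi>. c * T (dil y \<phi>)) C N"
proof -
  have "compact ((\<lambda>x. x * vinv y) ` K)"
    using K by (intro compact_continuous_image continuous_intros)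
  then obtain C N where C: "C > 0" "order_bound ((\<lambda>x. x * vinv y) ` K) T C N"
    using distribution_order[OF T] by blast
  define R where "R = max 1 (Max (range (\<lambda>j. \<bar>y $ j\<bar>)))"
  have R: "\<bar>y $ j\<bar> \<le> R" "1 \<le> R" for j unfolding R_def by (auto simp: le_max_iff_disj)
  have "order_bound K (\<lambda>\<phi>. c * T (dil y \<phi>)) (norm c * (C * R ^ N)) N"
    unfolding order_bound_def
  proof (intro allI impI)
    fix \<phi> :: "real^'a \<Rightarrow> complex" and B
    assume p: "test_fun \<phi>" "tsupp \<phi> \<subseteq> K" "cbound N \<phi> B"
    have "tsupp (dil y \<phi>) \<subseteq> (\<lambda>x. x * vinv y) ` K" using test_fun_dil(2)[OF p(1) y] p(2) by blast
    then have "norm (T (dil y \<phi>)) \<le> C * (R ^ N * B)"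
      using C(2) test_fun_dil(1)[OF p(1) y] cbound_dil[OF test_funD(1)[OF p(1)] p(3), of y, OF R]
      unfolding order_bound_def by blast
    then show "norm (c * T (dil y \<phi>)) \<le> norm c * (C * R ^ N) * B"
      by (simp add: norm_mult mult_left_mono mult.assoc)
  qed
  then show ?thesis by blast
qed

lemma test_linear_dilate:
  assumes "test_linear T" "all_nz y" shows "test_linear (\<lambda>\<phi>. c * T (dil y \<phi>))"
  unfolding test_linear_def
proof (intro allI impI)
  fix \<phi> \<psi> :: "real^'a \<Rightarrow> complex" and a assume "test_fun \<phi> \<and> test_fun \<psi>"
  then have t: "test_fun (dil y \<phi>)" "test_fun (dil y \<psi>)" using test_fun_dil assms by blast+
  have "dil y (\<lambda>x. \<phi> x + \<psi> x) = (\<lambda>x. dil y \<phi> x + dil y \<psi> x)" "dil y (\<lambda>x. a * \<phi> x) = (\<lambda>x. a * dil y \<phi> x)"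
    by (simp_all add: dil_def)
  then show "c * T (dil y (\<lambda>x. \<phi> x + \<psi> x)) = c * T (dil y \<phi>) + c * T (dil y \<psi>) \<and>
      c * T (dil y (\<lambda>x. a * \<phi> x)) = a * (c * T (dil y \<phi>))"
    using test_linearD(1)[OF assms(1) t(1)] test_linearD(3)[OF assms(1) t] by (simp add: algebra_simps)
qed

section \<open>Vanishing near the coordinate hyperplanes\<close>

lemma compact_abs_bound:
  fixes K :: "(real^'d::finite) set"
  assumes "compact K" shows "\<exists>R>0. \<forall>x i. x \<in> K \<longrightarrow> \<bar>x $ i\<bar> < R"
proof -
  obtain R where R: "\<And>x. x \<in> K \<Longrightarrow> norm x \<le> R" using compact_imp_bounded[OF assms] unfolding bounded_iff by blast
  have "\<bar>x $ i\<bar> < max R 0 + 1" if "x \<in> K" for x i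
    using R[OF that] component_le_norm_cart[of x i] by linarith
  then show ?thesis by (intro exI[of _ "max R 0 + 1"]) auto
qed

text \<open>Otherwise there are \<phi>_n with \<open>T \<phi>_n \<noteq> 0\<close>, supported in
  slabs around x_j = 0 that shrink to it. Stretched in x_j and shrunk in the other coordinates they
  fit into one cube, and \<open>T\<close> turns into the functionals sending \<psi> to T(dil (y n)
  \<psi>). On each fixed \<psi> these vanish for large \<open>n\<close>, because (y n)_j = n + 1
  leaves the bounded support of the multiplier. So they stay pointwise bounded under any
  normalisation \<open>a n\<close>, and a suitable one contradicts uniform boundedness.\<close>

lemma DH_vanishes_on_strip:
  fixes T :: "(real^'d::finite \<Rightarrow> complex) \<Rightarrow> complex"
  assumes T: "DH T"
  obtains \<epsilon> where "\<epsilon> > 0" "\<And>j \<phi>. test_fun \<phi> \<Longrightarrow> (\<And>x. \<phi> x \<noteq> 0 \<Longrightarrow> \<bar>x $ j\<bar> \<le> \<epsilon>) \<Longrightarrow> T \<phi> = 0"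
proof -
  have "\<exists>\<epsilon>>0. \<forall>\<phi>. test_fun \<phi> \<longrightarrow> (\<forall>x. \<phi> x \<noteq> 0 \<longrightarrow> \<bar>x $ j\<bar> \<le> \<epsilon>) \<longrightarrow> T \<phi> = 0" for j
  proof (rule ccontr)
    assume neg: "\<not> ?thesis"
    have "\<exists>\<phi>. test_fun \<phi> \<and> (\<forall>x. \<phi> x \<noteq> 0 \<longrightarrow> \<bar>x $ j\<bar> \<le> 1 / Suc n) \<and> T \<phi> \<noteq> 0" for n
    proof -
      have "1 / real (Suc n) > 0" by simp
      then show ?thesis using neg by blast
    qed
    then obtain \<phi> where \<phi>: "\<And>n. test_fun (\<phi> n)" "\<And>n x. \<phi> n x \<noteq> 0 \<Longrightarrow> \<bar>x $ j\<bar> \<le> 1 / Suc n" "\<And>n. T (\<phi> n) \<noteq> 0"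
      by metis
    have "\<exists>R>0. \<forall>x i. x \<in> tsupp (\<phi> n) \<longrightarrow> \<bar>x $ i\<bar> < R" for n
      by (rule compact_abs_bound[OF test_funD(2)[OF \<phi>(1)]])
    then obtain R where R: "\<And>n. R n > 0" "\<And>n x i. x \<in> tsupp (\<phi> n) \<Longrightarrow> \<bar>x $ i\<bar> < R n" by metis
    define y :: "nat \<Rightarrow> real^'d" where "y n = (\<chi> i. if i = j then real (Suc n) else 1 / R n)" for n
    have y: "all_nz (y n)" for n using R(1)[of n] by (auto simp: y_def all_nz_def)
    define \<eta> where "\<eta> n = dil (vinv (y n)) (\<phi> n)" for n
    have \<eta>: "test_fun (\<eta> n)" for n unfolding \<eta>_def using y by (intro test_fun_dil \<phi>) auto
    have \<phi>\<eta>: "dil (y n) (\<eta> n) = \<phi> n" for n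
      unfolding \<eta>_def dil_dil using vinv_mult[OF y, of 1] by simp
    let ?K = "cbox (-1) (1::real^'d)"
    have sup: "tsupp (\<eta> n) \<subseteq> ?K" for n
    proof (rule tsupp_subset[OF closed_cbox])
      fix x assume "\<eta> n x \<noteq> 0"
      then have *: "\<phi> n (x * vinv (y n)) \<noteq> 0" by (simp add: \<eta>_def dil_def)
      have "\<bar>x $ i\<bar> \<le> 1" for i
      proof (cases "i = j")
        case True
        then show ?thesis using \<phi>(2)[OF *] by (simp add: y_def abs_mult divide_simps)
      next
        case False
        then show ?thesis using R(2)[OF tsupp_superset[of "\<phi> n", OF *], of i] R(1)[of n] by (simp add: y_def abs_mult)
      qed
      then show "x \<in> ?K" by (simp add: mem_box_cart abs_le_iff minus_le_iff)
    qed
    have "\<exists>B>0. cbound n (\<eta> n) B" for n using cbound_exists[OF \<eta>] by metis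
    then have "\<exists>B. \<forall>n. B n > 0 \<and> cbound n (\<eta> n) (B n)" by (intro choice allI) blast
    then obtain B where B: "\<And>n. B n > 0" "\<And>n. cbound n (\<eta> n) (B n)" by blast
    \<comment> \<open>Chosen so that the functional \<open>n\<close> takes on \<eta>_n the modulus
      (n+1) B_n, while a uniform order bound gives at most C B_n once n \<ge> N.\<close>
    define a where "a n = complex_of_real (real (Suc n) * B n / norm (T (\<phi> n)))" for n
    have "\<exists>C N. C > 0 \<and> (\<forall>n. order_bound ?K (\<lambda>\<psi>. a n * T (dil (y n) \<psi>)) C N)"
    proof (rule uniform_boundedness[where K="?K" and \<Lambda>="\<lambda>n \<psi>. a n * T (dil (y n) \<psi>)"])
      show "\<exists>B. \<forall>n. norm (a n * T (dil (y n) \<psi>)) \<le> B" if "test_fun \<psi>" for \<psi>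
      proof -
        obtain r where r: "\<And>x i. x \<in> tsupp (multiplier T \<psi>) \<Longrightarrow> \<bar>x $ i\<bar> < r"
          using compact_abs_bound[OF test_funD(2)[OF multiplier(1)[OF T \<open>test_fun \<psi>\<close>]]] by blast
        obtain m where m: "r \<le> real m" using real_arch_simple by blast
        \<comment> \<open>Beyond \<open>m\<close> the coordinate \<open>j\<close> of
          \<open>y n\<close> exceeds the bound \<open>r\<close> on the support of the
          multiplier.\<close>
        have zero: "a n * T (dil (y n) \<psi>) = 0" if "n \<ge> m" for n
        proof -
          have "y n \<notin> tsupp (multiplier T \<psi>)" using r[of "y n" j] m that by (auto simp: y_def)
          then have "multiplier T \<psi> (y n) = 0" using tsupp_superset by blast
          then show ?thesis using multiplier(2)[OF T \<open>test_fun \<psi>\<close> y] by simp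
        qed
        have "norm (a n * T (dil (y n) \<psi>)) \<le> (\<Sum>n<m. norm (a n * T (dil (y n) \<psi>)))" for n
        proof (cases "n < m")
          case True
          then show ?thesis by (intro member_le_sum[of n "{..<m}" "\<lambda>n. norm (a n * T (dil (y n) \<psi>))"]) auto
        next
          case False
          then have "norm (a n * T (dil (y n) \<psi>)) = 0" using zero[of n] by simp
          then show ?thesis by (simp only: sum_nonneg norm_ge_zero)
        qed
        then show ?thesis by blast
      qed
      show "test_linear (\<lambda>\<psi>. a n * T (dil (y n) \<psi>))" for n
        by (intro test_linear_dilate DH_linear T y)
      show "\<exists>C N. order_bound ?K (\<lambda>\<psi>. a n * T (dil (y n) \<psi>)) C N" for n
        by (intro order_bound_dilate DH_distribution T y compact_cbox)
    next
      fix C N assume "C > 0" "\<And>n. order_bound ?K (\<lambda>\<psi>. a n * T (dil (y n) \<psi>)) C N"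
      then show "\<exists>C N. C > 0 \<and> (\<forall>n. order_bound ?K (\<lambda>\<psi>. a n * T (dil (y n) \<psi>)) C N)" by blast
    qed (rule compact_cbox)
    then obtain C N where CN: "C > 0" "\<And>n. order_bound ?K (\<lambda>\<psi>. a n * T (dil (y n) \<psi>)) C N" by blast
    obtain n where n: "N \<le> n" "C < real (Suc n)"
      using reals_Archimedean2[of C] by (metis max.cobounded1 max.cobounded2 le_SucI of_nat_le_iff order_less_le_trans)
    have "norm (a n * T (dil (y n) (\<eta> n))) \<le> C * B n"
      using CN(2) \<eta> sup cbound_mono[OF B(2) n(1) order_refl] unfolding order_bound_def by blast
    moreover have "norm (a n * T (dil (y n) (\<eta> n))) = real (Suc n) * B n"
      unfolding \<phi>\<eta> a_def norm_mult norm_of_real using \<phi>(3)[of n] B(1)[of n] by (simp del: of_nat_Suc)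
    ultimately have "real (Suc n) \<le> C" using B(1)[of n] by simp
    then show False using n(2) by linarith
  qed
  then obtain \<epsilon> where e: "\<And>j. \<epsilon> j > 0"
      "\<And>j \<phi>. test_fun \<phi> \<Longrightarrow> (\<And>x. \<phi> x \<noteq> 0 \<Longrightarrow> \<bar>x $ j\<bar> \<le> \<epsilon> j) \<Longrightarrow> T \<phi> = 0" by metis
  define \<delta> where "\<delta> = Min (range \<epsilon>)"
  have "\<delta> > 0" "\<delta> \<le> \<epsilon> j" for j unfolding \<delta>_def using e(1) by auto
  then show ?thesis using that[of \<delta>] e(2) by (meson order_trans)
qed

section \<open>Multipliers commute with Euler derivatives\<close>

definition theta :: "'d::finite \<Rightarrow> (real^'d \<Rightarrow> complex) \<Rightarrow> real^'d \<Rightarrow> complex" where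
  "theta j f = (\<lambda>x. of_real (x $ j) * partial j f x)"

lemma test_fun_theta: "test_fun f \<Longrightarrow> test_fun (theta j f)"
  unfolding theta_def by (intro test_fun_mult smooth_fun_component test_fun_partial)

lemma has_vector_derivative_line:
  assumes "differentiable_in j f"
  shows "((\<lambda>s. f (x + (s * c) *\<^sub>R axis j 1)) has_vector_derivative c *\<^sub>R partial j f (x + (s * c) *\<^sub>R axis j 1)) (at s within A)"
proof -
  have "((\<lambda>t. f (x + t *\<^sub>R axis j 1)) \<circ> (\<lambda>s. s * c) has_vector_derivative c *\<^sub>R partial j f (x + (s * c) *\<^sub>R axis j 1)) (at s)"
    by (intro vector_diff_chain_at has_partial_at assms) (auto intro!: derivative_eq_intros)
  then show ?thesis by (simp add: o_def has_vector_derivative_at_within)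
qed

lemma times_add_axis: "x * (y + s *\<^sub>R axis j 1) = x * y + (s * x $ j) *\<^sub>R axis j (1::real)"
  by (simp add: vec_eq_iff axis_def algebra_simps)

text \<open>Formally, differentiating T(dil y \<phi>) in y_j gives y_j^(-1) T(dil y (theta j
  \<phi>)). To move the derivative past \<open>T\<close>, the difference of two dilates is written
  as an integral of dilates of \<open>theta j \<phi>\<close> with weight 1 / (y_j + s);
  \<open>T\<close> passes through the integral, and the resulting scalar identity is differentiated
  at 0.\<close>

lemma multiplier_theta:
  assumes T: "DH T" and phi: "test_fun \<phi>"
  shows "multiplier T (theta j \<phi>) = theta j (multiplier T \<phi>)"
proof (rule multiplier_unique[OF T test_fun_theta[OF phi]])
  let ?F = "multiplier T \<phi>"
  note F = multiplier[OF T phi]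
  show "continuous_on UNIV (theta j ?F)"
    by (intro smooth_fun_continuous test_funD test_fun_theta F)
  fix y :: "real^'a" assume y: "all_nz y"
  \<comment> \<open>Half of |y_j|, so that y_j + s keeps away from 0 on [0, r].\<close>
  define r where "r = \<bar>y $ j\<bar> / 2"
  have r: "r > 0" using y by (auto simp: r_def all_nz_def)
  define u where "u s = y + s *\<^sub>R axis j 1" for s
  define h where "h s = complex_of_real (inverse (y $ j + s))" for s
  have nzj: "y $ j + s \<noteq> 0" if "s \<in> {0..r}" for s
    using that y[unfolded all_nz_def, rule_format, of j] by (auto simp: r_def abs_if split: if_splits)
  have nz: "all_nz (u s)" if "s \<in> {0..r}" for s
    using nzj[OF that] y by (auto simp: u_def all_nz_def axis_def)
  have ch: "continuous_on {0..r} h" unfolding h_def using nzj by (intro continuous_intros) auto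
  have cu: "continuous_on A u" for A unfolding u_def by (intro continuous_intros)
  let ?g = "\<lambda>s. h s * T (dil (u s) (theta j \<phi>))"
  have cT: "continuous_on {0..r} (\<lambda>s. T (dil (u s) (theta j \<phi>)))"
    by (intro continuous_on_dilates T test_fun_theta phi cu nz)
  have cg: "continuous_on {0..r} ?g" by (intro continuous_intros ch cT)
  have eq: "?F (u t) = ?F y + integral {0..t} ?g" if t: "t \<in> {0..r}" for t
  proof -
    have sub: "cbox 0 t \<subseteq> {0..r}" using t by auto
    have "T (param_int 0 t h u (\<lambda>_. 0) (theta j \<phi>)) = integral (cbox 0 t) ?g"
      using sub nz
      by (intro distribution_param_int DH_distribution T test_fun_theta phi continuous_on_subset[OF ch]
          continuous_on_subset[OF cT] cu) auto
    moreover have "param_int 0 t h u (\<lambda>_. 0) (theta j \<phi>) = (\<lambda>x. dil (u t) \<phi> x - dil y \<phi> x)"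
    proof
      fix x
      have "((\<lambda>s. (x $ j) *\<^sub>R partial j \<phi> (x * y + (s * x $ j) *\<^sub>R axis j 1)) has_integral
          \<phi> (x * y + (t * x $ j) *\<^sub>R axis j 1) - \<phi> (x * y + (0 * x $ j) *\<^sub>R axis j 1)) {0..t}"
        using t by (intro fundamental_theorem_of_calculus has_vector_derivative_line smooth_fun_differentiable test_funD(1)[OF phi]) auto
      moreover have "(x $ j) *\<^sub>R partial j \<phi> (x * y + (s * x $ j) *\<^sub>R axis j 1) = h s * theta j \<phi> (x * u s + 0)"
        if "s \<in> {0..t}" for s
      proof -
        have "y $ j + s \<noteq> 0" using nzj that t by auto
        then have "inverse (y $ j + s) * (x $ j * (y $ j + s)) = x $ j" by (simp add: divide_simps)
        then have "complex_of_real (inverse (y $ j + s) * (x $ j * (y $ j + s))) = complex_of_real (x $ j)"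
          by (rule arg_cong)
        then have "h s * (complex_of_real (x $ j * (y $ j + s)) * c) = complex_of_real (x $ j) * c" for c
          unfolding h_def by (simp only: mult.assoc[symmetric] of_real_mult[symmetric])
        moreover have "(x * u s) $ j = x $ j * (y $ j + s)" by (simp add: u_def axis_def)
        moreover have "x * u s = x * y + (s * x $ j) *\<^sub>R axis j 1" by (simp only: u_def times_add_axis)
        ultimately show ?thesis
          by (simp only: theta_def add_0_right scaleR_conv_of_real[where 'a=complex])
      qed
      ultimately have "((\<lambda>s. h s * theta j \<phi> (x * u s + 0)) has_integral
          \<phi> (x * y + (t * x $ j) *\<^sub>R axis j 1) - \<phi> (x * y)) {0..t}"
        by (subst has_integral_cong[where g="\<lambda>s. (x $ j) *\<^sub>R partial j \<phi> (x * y + (s * x $ j) *\<^sub>R axis j 1)"]) auto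
      then show "param_int 0 t h u (\<lambda>_. 0) (theta j \<phi>) x = dil (u t) \<phi> x - dil y \<phi> x"
        unfolding param_int_def dil_def by (simp add: integral_unique u_def times_add_axis)
    qed
    ultimately have "T (\<lambda>x. dil (u t) \<phi> x - dil y \<phi> x) = integral {0..t} ?g" by simp
    moreover have "T (\<lambda>x. dil (u t) \<phi> x - dil y \<phi> x) = ?F (u t) - ?F y"
      using F(2)[OF nz[OF t]] F(2)[OF y] test_fun_dil[OF phi] nz[OF t] y
      by (simp add: test_linearD(4)[OF DH_linear[OF T]])
    ultimately show ?thesis by (simp add: algebra_simps)
  qed
  \<comment> \<open>The one-sided derivative at 0 determines \<open>partial j ?F y\<close>, since
    \<open>?F\<close> is known to be differentiable.\<close>
  have "((\<lambda>t. ?F y + integral {0..t} ?g) has_vector_derivative 0 + ?g 0) (at 0 within {0..r})"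
    using r by (intro derivative_intros integral_has_vector_derivative cg) auto
  then have "((\<lambda>t. ?F (y + t *\<^sub>R axis j 1)) has_vector_derivative ?g 0) (at 0 within {0..r})"
    using eq r by (subst has_vector_derivative_cong_ev[where g="\<lambda>t. ?F y + integral {0..t} ?g"]) (auto simp: u_def eventually_at_filter)
  moreover have "((\<lambda>t. ?F (y + t *\<^sub>R axis j 1)) has_vector_derivative partial j ?F (y + 0 *\<^sub>R axis j 1)) (at 0 within {0..r})"
    by (intro has_partial_at smooth_fun_differentiable test_funD F)
  ultimately have "?g 0 = partial j ?F y"
    using vector_derivative_unique_within[of 0 "{0..r}"] r
    by (auto simp: trivial_limit_within islimpt_Icc)
  then show "T (dil y (theta j \<phi>)) = theta j ?F y"
    using y by (simp add: theta_def h_def u_def all_nz_def field_simps)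
qed

subsection \<open>Division by coordinates and decay of the multiplier\<close>

text \<open>Multiplication by it rescales the coordinate \<open>j\<close>: the value 0 projects to
  the hyperplane x_j = 0, -1 reflects in it, and \<open>s\<close> in [0,1] runs along the segment
  from the projection to the point.\<close>

definition coord_scale :: "'d::finite \<Rightarrow> real \<Rightarrow> real^'d" where
  "coord_scale j s = (\<chi> i. if i = j then s else 1)"

lemma coord_scale_nth [simp]: "coord_scale j s $ i = (if i = j then s else 1)"
  by (simp add: coord_scale_def)

lemma continuous_on_coord_scale: "continuous_on A (coord_scale j)"
proof -
  have "continuous_on A (\<lambda>s. if i = j then s else 1)" for i :: 'a
    by (cases "i = j") (auto intro: continuous_intros)
  then show ?thesis unfolding coord_scale_def[abs_def] by (rule continuous_on_vec_lambda)
qed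

lemma times_coord_scale: "x * coord_scale j s = x * coord_scale j 0 + (s * x $ j) *\<^sub>R axis j (1::real)"
  by (simp add: vec_eq_iff axis_def)

lemma times_coord_scale_line:
  assumes "differentiable_in j f"
  shows "((\<lambda>s. f (x * coord_scale j s)) has_vector_derivative (x $ j) *\<^sub>R partial j f (x * coord_scale j s)) (at s within A)"
  using has_vector_derivative_line[OF assms, of "x * coord_scale j 0" "x $ j" s A]
  by (simp only: times_coord_scale[symmetric])

lemma coord_scale_one [simp]: "coord_scale j 1 = 1"
  by (simp add: vec_eq_iff)

text \<open>Hadamard's lemma: the quotient is the average of \<open>partial j f\<close> over the
  segment from the projection of \<open>x\<close> to \<open>x\<close>. Off the hyperplane it
  vanishes where \<open>f\<close> does, on it it equals \<open>partial j f\<close>, so the support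
  does not grow.\<close>

lemma test_fun_divide_coordinate:
  assumes f: "test_fun f" and zero: "\<And>x. x $ j = 0 \<Longrightarrow> f x = 0"
  shows "\<exists>g. test_fun g \<and> f = (\<lambda>x. of_real (x $ j) * g x) \<and> tsupp g \<subseteq> tsupp f"
proof -
  define g where "g = param_int 0 (1::real) (\<lambda>_. 1) (coord_scale j) (\<lambda>_. 0) (partial j f)"
  note sm = test_funD(1)[OF f]
  have g: "smooth_fun g" unfolding g_def
    by (intro smooth_fun_param_int smooth_fun_partial sm continuous_on_coord_scale continuous_on_const)
  have fg: "f x = of_real (x $ j) * g x" for x
  proof -
    have "((\<lambda>s. (x $ j) *\<^sub>R partial j f (x * coord_scale j s)) has_integral
        f (x * coord_scale j 1) - f (x * coord_scale j 0)) {0..1}"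
      by (intro fundamental_theorem_of_calculus times_coord_scale_line smooth_fun_differentiable sm) auto
    moreover have "f (x * coord_scale j 0) = 0" by (intro zero) simp
    ultimately have "integral {0..1} (\<lambda>s. (x $ j) *\<^sub>R partial j f (x * coord_scale j s)) = f x"
      by (intro integral_unique) simp
    then show ?thesis unfolding g_def param_int_def by (simp add: scaleR_conv_of_real[where 'a=complex])
  qed
  have "x \<in> tsupp f" if "g x \<noteq> 0" for x
  proof (cases "x $ j = 0")
    case True
    then have "x * coord_scale j s = x" for s by (simp add: vec_eq_iff)
    then have "g x = partial j f x" unfolding g_def param_int_def by simp
    then show ?thesis using that iter_partial_zero_outside[of x f "[j]"] by fastforce
  next
    case False
    then show ?thesis using that fg[of x] by (intro tsupp_superset) auto
  qed
  from test_funI[OF g test_funD(2)[OF f] this] fg show ?thesis by blast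
qed

text \<open>\<alpha>(x) integrates \<open>w\<close> along the line from x_j = -R. Oddness makes
  \<alpha> even in x_j, so that its vanishing for x_j \<le> -R carries over to x_j \<ge> R and the
  support is bounded.\<close>

lemma test_fun_antiderivative:
  assumes w: "test_fun w" and odd: "\<And>x. w (x * coord_scale j (-1)) = - w x"
  shows "\<exists>\<alpha>. test_fun \<alpha> \<and> partial j \<alpha> = w"
proof -
  note sm = test_funD(1)[OF w]
  obtain R where R: "R > 0" "\<And>x i. x \<in> tsupp w \<Longrightarrow> \<bar>x $ i\<bar> < R"
    using compact_abs_bound[OF test_funD(2)[OF w]] by metis
  have w0: "w x = 0" if "R \<le> \<bar>x $ i\<bar>" for x i
    using R(2)[of x i] that tsupp_superset[of w x] by fastforce
  \<comment> \<open>The line integral is split at x_j = 0: x_j times \<open>I\<close> is the part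
    from the hyperplane to \<open>x\<close>, and \<open>B\<close> the part from -R to the
    hyperplane. Both become parameter integrals over fixed intervals.\<close>
  define I where "I = param_int 0 (1::real) (\<lambda>_. 1) (coord_scale j) (\<lambda>_. 0) w"
  define B where "B = param_int (-R) 0 (\<lambda>_. 1) (\<lambda>_. coord_scale j 0) (\<lambda>s::real. s *\<^sub>R axis j 1) w"
  define \<alpha> where "\<alpha> = (\<lambda>x. of_real (x $ j) * I x + B x)"
  note ctn = continuous_on_coord_scale continuous_on_const continuous_on_scaleR continuous_on_id
  have smI: "smooth_fun I" unfolding I_def by (intro smooth_fun_param_int sm ctn)
  have smB: "smooth_fun B" unfolding B_def by (intro smooth_fun_param_int sm ctn)
  have sma: "smooth_fun \<alpha>" unfolding \<alpha>_def by (intro smooth_fun_add smooth_fun_mult smooth_fun_component smI smB)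
  have dB: "partial j B = (\<lambda>x. 0)"
    unfolding B_def
    by (subst partial_param_int(2)[OF sm]) (auto intro!: ctn simp: param_int_def fun_eq_iff)
  have dI: "partial j I = param_int 0 1 of_real (coord_scale j) (\<lambda>_. 0) (partial j w)"
    unfolding I_def
    by (subst partial_param_int(2)[OF sm]) (auto intro!: ctn simp: param_int_def fun_eq_iff)
  have pa: "partial j \<alpha> = w"
  proof
    fix x
    have "partial j \<alpha> x = of_real (x $ j) * partial j I x + I x"
      unfolding \<alpha>_def partial_add(2)[OF smooth_fun_differentiable[OF smooth_fun_mult[OF smooth_fun_component(1) smI]]
          smooth_fun_differentiable[OF smB]]
        partial_mult(2)[OF smooth_fun_differentiable[OF smooth_fun_component(1)] smooth_fun_differentiable[OF smI]]
      by (simp add: smooth_fun_component(2) dB)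
    also have "\<dots> = integral {0..1} (\<lambda>s. of_real (x $ j) * (of_real s * partial j w (x * coord_scale j s)) + w (x * coord_scale j s))"
      unfolding dI unfolding I_def param_int_def
    proof (subst integral_add)
      have c: "continuous_on {0..1} (\<lambda>s. f (x * coord_scale j s))" if "smooth_fun f" for f :: "real^'a \<Rightarrow> complex"
        by (rule continuous_on_compose2[OF smooth_fun_continuous[OF that, of UNIV]])
           (auto intro!: continuous_on_vec_times ctn)
      show "(\<lambda>s. complex_of_real (x $ j) * (complex_of_real s * partial j w (x * coord_scale j s))) integrable_on {0..1}"
        "(\<lambda>s. w (x * coord_scale j s)) integrable_on {0..1}"
        by (intro integrable_continuous_interval continuous_intros c smooth_fun_partial sm)+
    qed simp
    \<comment> \<open>The integrand is the derivative in \<open>s\<close> of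
      \<open>s * w (x * coord_scale j s)\<close>.\<close>
    also have "\<dots> = w x"
    proof (rule integral_unique)
      have "((\<lambda>s. of_real s * w (x * coord_scale j s)) has_vector_derivative
          of_real s * ((x $ j) *\<^sub>R partial j w (x * coord_scale j s)) + 1 * w (x * coord_scale j s)) (at s within {0..1})" for s
        by (intro has_vector_derivative_mult times_coord_scale_line smooth_fun_differentiable sm)
           (auto intro!: derivative_eq_intros has_vector_derivative_of_real[where 'a=complex] simp: has_vector_derivative_of_real)
      then have "((\<lambda>s. of_real s * ((x $ j) *\<^sub>R partial j w (x * coord_scale j s)) + 1 * w (x * coord_scale j s)) has_integral
          of_real 1 * w (x * coord_scale j 1) - of_real 0 * w (x * coord_scale j 0)) {0..1}"
        by (intro fundamental_theorem_of_calculus) auto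
      then show "((\<lambda>s. of_real (x $ j) * (of_real s * partial j w (x * coord_scale j s)) + w (x * coord_scale j s)) has_integral w x) {0..1}"
        by (simp add: scaleR_conv_of_real[where 'a=complex] mult.left_commute)
    qed
    finally show "partial j \<alpha> x = w x" .
  qed
  have even: "\<alpha> (x * coord_scale j (-1)) = \<alpha> x" for x
  proof -
    have "x * coord_scale j (-1) * coord_scale j s = (x * coord_scale j s) * coord_scale j (-1)" for s
      by (simp add: vec_eq_iff)
    then have "w (x * coord_scale j (-1) * coord_scale j s) = - w (x * coord_scale j s)" for s
      by (simp only: odd)
    then have "I (x * coord_scale j (-1)) = - I x"
      unfolding I_def param_int_def by simp
    moreover have "x * coord_scale j (-1) * coord_scale j 0 = x * coord_scale j 0"
      by (simp add: vec_eq_iff)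
    ultimately show ?thesis by (simp add: \<alpha>_def B_def param_int_def)
  qed
  have neg: "\<alpha> x = 0" if xR: "x $ j \<le> - R" for x
  proof -
    define z where "z = x * coord_scale j 0"
    have z: "x = z + (x $ j) *\<^sub>R axis j 1" "z $ j = 0" by (simp_all add: z_def vec_eq_iff axis_def)
    have ftc: "((\<lambda>s. w (z + s *\<^sub>R axis j 1)) has_integral \<alpha> (z + b *\<^sub>R axis j 1) - \<alpha> (z + a *\<^sub>R axis j 1)) {a..b}"
      if "a \<le> b" for a b
      using has_partial_at[OF smooth_fun_differentiable[OF sma, of j], of z] that
      by (intro fundamental_theorem_of_calculus) (auto simp: pa)
    have "z * coord_scale j 0 = z" by (simp add: z_def vec_eq_iff)
    \<comment> \<open>On the hyperplane \<alpha> reduces to \<open>B\<close>, the integral over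
      [-R, 0]; comparison with the fundamental theorem gives \<alpha> = 0 at x_j = -R.\<close>
    then have "\<alpha> z = integral {-R..0} (\<lambda>s. w (z + s *\<^sub>R axis j 1))"
      by (simp add: \<alpha>_def z(2) B_def param_int_def)
    also have "\<dots> = \<alpha> z - \<alpha> (z + (-R) *\<^sub>R axis j 1)"
      using ftc[of "-R" 0] R(1) by (simp add: integral_unique)
    finally have a: "\<alpha> (z + (-R) *\<^sub>R axis j 1) = 0" by simp
    have "w (z + s *\<^sub>R axis j 1) = 0" if "s \<in> {x $ j..-R}" for s
      using that z(2) by (intro w0[of _ j]) (auto simp: axis_def)
    then have "((\<lambda>s. w (z + s *\<^sub>R axis j 1)) has_integral 0) {x $ j..-R}"
      by (rule has_integral_is_0)
    from has_integral_unique[OF ftc[OF xR] this] show ?thesis using a z(1) by simp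
  qed
  have "x \<in> cbox (\<chi> i. -R) (\<chi> i. R)" if "\<alpha> x \<noteq> 0" for x
  proof -
    have "\<bar>x $ i\<bar> \<le> R" for i
    proof (rule ccontr)
      assume i: "\<not> \<bar>x $ i\<bar> \<le> R"
      show False
      proof (cases "i = j")
        case True
        show False
        proof (cases "x $ j \<le> 0")
          case True
          then show False using i \<open>i = j\<close> that neg[of x] by auto
        next
          case False
          then show False using i \<open>i = j\<close> that neg[of "x * coord_scale j (-1)"] even[of x] by auto
        qed
      next
        case False
        have "w (x * coord_scale j s) = 0" for s
          using i False by (intro w0[of _ i]) auto
        moreover have "w (x * coord_scale j 0 + s *\<^sub>R axis j 1) = 0" for s
          using i False by (intro w0[of _ i]) (auto simp: axis_def)
        ultimately have "\<alpha> x = 0" by (simp add: \<alpha>_def I_def B_def param_int_def)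
        then show False using that by simp
      qed
    qed
    then show ?thesis by (auto simp: mem_box_cart abs_le_iff minus_le_iff)
  qed
  from test_funI(1)[OF sma compact_cbox this] pa show ?thesis by blast
qed

text \<open>While \<phi> need not be \<open>theta j\<close> of a test function, its symmetrisation
  \<open>?e\<close> is. The multiplier of \<open>?e\<close>, being itself of the form
  \<open>theta j\<close>, vanishes at y_j = 0, and there it equals twice the multiplier of \<phi>,
  since the reflection fixes the hyperplane.\<close>

lemma multiplier_zero_on_hyperplane:
  assumes T: "DH T" and phi: "test_fun \<phi>" and zero: "\<And>x. x $ j = 0 \<Longrightarrow> \<phi> x = 0"
    and y: "y $ j = 0"
  shows "multiplier T \<phi> y = 0"
proof -
  define s where "s = coord_scale j (-1)"
  have nz: "all_nz s" by (auto simp: s_def all_nz_def)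
  have ss: "s * s = 1" by (auto simp: s_def vec_eq_iff)
  have sj: "s $ j = -1" by (simp add: s_def)
  have ts: "test_fun (dil s \<phi>)" by (intro test_fun_dil phi nz)
  let ?e = "\<lambda>x. \<phi> x + dil s \<phi> x"
  have e: "test_fun ?e" by (intro test_fun_add phi ts)
  have e0: "?e x = 0" if "x $ j = 0" for x
    using that zero by (auto simp: dil_def)
  obtain w where w: "test_fun w" "?e = (\<lambda>x. of_real (x $ j) * w x)"
    using test_fun_divide_coordinate[OF e, of j] e0 by blast
  have w1: "of_real (x $ j) * w x = \<phi> x + \<phi> (x * s)" for x
    using fun_cong[OF w(2), of x] by (simp add: dil_def)
  have odd: "(\<lambda>x. w (x * s)) = (\<lambda>x. - w x)"
  proof (rule eq_if_eq_on_all_nz)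
    show "continuous_on UNIV (\<lambda>x. w (x * s))"
      using smooth_fun_continuous[OF smooth_fun_dil[OF test_funD(1)[OF w(1)]], of UNIV s] by (simp add: dil_def)
    show "continuous_on UNIV (\<lambda>x. - w x)"
      by (intro continuous_on_minus smooth_fun_continuous test_funD w)
    fix x :: "real^'a" assume "all_nz x"
    then have "x $ j \<noteq> 0" by (simp add: all_nz_def)
    moreover have "of_real (- (x $ j)) * w (x * s) = of_real (x $ j) * w x"
      using w1[of "x * s"] w1[of x] by (simp add: mult.assoc ss sj add.commute)
    ultimately have "of_real (x $ j) * w (x * s) = of_real (x $ j) * (- w x)" "complex_of_real (x $ j) \<noteq> 0"
      by (simp_all add: minus_equation_iff)
    then show "w (x * s) = - w x" by (metis mult_left_cancel)
  qed
  obtain \<alpha> where \<alpha>: "test_fun \<alpha>" "partial j \<alpha> = w"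
    using test_fun_antiderivative[OF w(1), of j] fun_cong[OF odd] unfolding s_def by blast
  have "?e = theta j \<alpha>" unfolding theta_def \<alpha>(2) by (rule w(2))
  then have m: "multiplier T ?e y = 0"
    using y by (simp add: multiplier_theta[OF T \<alpha>(1)]) (simp add: theta_def)
  have "multiplier T ?e = (\<lambda>y. multiplier T \<phi> y + multiplier T \<phi> (y * s))"
  proof (rule multiplier_unique[OF T e])
    show "continuous_on UNIV (\<lambda>y. multiplier T \<phi> y + multiplier T \<phi> (y * s))"
      using smooth_fun_continuous[OF smooth_fun_dil[OF test_funD(1)[OF multiplier(1)[OF T phi]]], of UNIV s]
        smooth_fun_continuous[OF test_funD(1)[OF multiplier(1)[OF T phi]], of UNIV]
      by (intro continuous_on_add) (auto simp: dil_def)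
    fix y :: "real^'a" assume ynz: "all_nz y"
    have "dil y ?e = (\<lambda>x. dil y \<phi> x + dil (y * s) \<phi> x)" by (simp add: dil_def mult.assoc)
    then have "T (dil y ?e) = T (dil y \<phi>) + T (dil (y * s) \<phi>)"
      using test_linearD(3)[OF DH_linear[OF T] test_fun_dil(1)[OF phi ynz] test_fun_dil(1)[OF phi, of "y * s"]] ynz nz
      by simp
    then show "T (dil y ?e) = multiplier T \<phi> y + multiplier T \<phi> (y * s)"
      using ynz nz by (simp add: multiplier(2)[OF T phi])
  qed
  moreover have "y * s = y" using y by (simp add: vec_eq_iff s_def)
  ultimately show ?thesis using m by simp
qed

text \<open>The coordinate factor either survives, bounded by \<open>R\<close>, or is consumed by
  one of the derivatives, which adds at most one term of size \<open>B\<close> per letter. The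
  induction peels the derivative applied first, which is the last letter of the word.\<close>

lemma iter_partial_times_coordinate_bound:
  assumes "smooth_fun f" "\<And>ks. length ks \<le> length js \<Longrightarrow> norm (iter_partial ks f x) \<le> B" "\<bar>x $ j\<bar> \<le> R"
  shows "norm (iter_partial js (\<lambda>x. of_real (x $ j) * f x) x) \<le> (R + length js) * B"
  using assms(1,2)
proof (induction js arbitrary: f rule: rev_induct)
  case Nil
  then show ?case using assms(3) Nil(2)[of "[]"] by (auto simp: norm_mult intro!: mult_mono)
next
  case (snoc i js)
  have d: "differentiable_in i f" by (rule smooth_fun_differentiable[OF snoc(2)])
  have "partial i (\<lambda>x. of_real (x $ j) * f x) =
      (\<lambda>x. of_real (x $ j) * partial i f x + (if i = j then 1 else 0) * f x)"
    by (subst partial_mult(2)[OF smooth_fun_differentiable[OF smooth_fun_component(1)] d])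
       (simp add: smooth_fun_component(2))
  then have "iter_partial (js @ [i]) (\<lambda>x. of_real (x $ j) * f x) x =
      iter_partial js (\<lambda>x. of_real (x $ j) * partial i f x) x + (if i = j then 1 else 0) * iter_partial js f x"
    by (simp only: iter_partial_append iter_partial.simps
        iter_partial_add[OF smooth_fun_mult[OF smooth_fun_component(1) smooth_fun_partial[OF snoc(2)]] smooth_fun_cmult[OF snoc(2)]]
        iter_partial_cmult[OF snoc(2)])
  also have "norm \<dots> \<le> (R + length js) * B + B"
  proof (rule norm_triangle_mono)
    show "norm (iter_partial js (\<lambda>x. of_real (x $ j) * partial i f x) x) \<le> (R + length js) * B"
    proof (rule snoc(1)[OF smooth_fun_partial[OF snoc(2)]])
      show "norm (iter_partial ks (partial i f) x) \<le> B" if "length ks \<le> length js" for ks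
        using snoc(3)[of "ks @ [i]"] that by (simp add: iter_partial_append)
    qed
    show "norm ((if i = j then 1 else 0) * iter_partial js f x) \<le> B"
      using snoc(3)[of js] order_trans[OF norm_ge_zero snoc(3)[of js]] by auto
  qed
  finally show ?case by (simp add: algebra_simps)
qed

text \<open>Since \<xi>_j \<phi>(\<xi> y) = y_j^(-1) (x_j \<phi>)(\<xi> y), the new multiplier on
  \<phi> is that of \<open>T\<close> on x_j \<phi>, divided by y_j. The latter vanishes on y_j = 0,
  so the quotient is again a test function. The induction for decay iterates this closure.\<close>

lemma DH_times_coordinate:
  assumes T: "DH T" shows "DH (\<lambda>\<phi>. T (\<lambda>x. of_real (x $ j) * \<phi> x))"
  unfolding DH_def
proof (intro conjI allI impI)
  let ?m = "\<lambda>\<phi> x. complex_of_real (x $ j) * \<phi> x"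
  have tm: "test_fun (?m \<phi>)" if "test_fun \<phi>" for \<phi>
    by (intro test_fun_mult smooth_fun_component that)
  note L = DH_linear[OF T]
  have "test_linear (\<lambda>\<phi>. T (?m \<phi>))"
    unfolding test_linear_def
  proof (intro allI impI)
    fix \<phi> \<psi> :: "real^'a \<Rightarrow> complex" and a assume "test_fun \<phi> \<and> test_fun \<psi>"
    then have t: "test_fun (?m \<phi>)" "test_fun (?m \<psi>)" using tm by blast+
    have "?m (\<lambda>x. \<phi> x + \<psi> x) = (\<lambda>x. ?m \<phi> x + ?m \<psi> x)" "?m (\<lambda>x. a * \<phi> x) = (\<lambda>x. a * ?m \<phi> x)"
      by (simp_all add: algebra_simps)
    then show "T (?m (\<lambda>x. \<phi> x + \<psi> x)) = T (?m \<phi>) + T (?m \<psi>) \<and> T (?m (\<lambda>x. a * \<phi> x)) = a * T (?m \<phi>)"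
      using test_linearD(1)[OF L t(1)] test_linearD(3)[OF L t] by simp
  qed
  moreover have "\<exists>C N. order_bound K (\<lambda>\<phi>. T (?m \<phi>)) C N" if K: "compact K" for K
  proof -
    obtain C N where C: "C > 0" "order_bound K T C N" using distribution_order[OF DH_distribution[OF T] K] by metis
    obtain R where R: "R > 0" "\<And>x i. x \<in> K \<Longrightarrow> \<bar>x $ i\<bar> < R" using compact_abs_bound[OF K] by metis
    have "order_bound K (\<lambda>\<phi>. T (?m \<phi>)) (C * (R + N)) N"
      unfolding order_bound_def
    proof (intro allI impI)
      fix \<phi> B assume p: "test_fun \<phi>" "tsupp \<phi> \<subseteq> K" "cbound N \<phi> B"
      have B: "0 \<le> B" using order_trans[OF norm_ge_zero p(3)[unfolded cbound_def, rule_format, of "[]" 0]] by simp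
      have "cbound N (?m \<phi>) ((R + N) * B)"
        unfolding cbound_def
      proof (intro allI impI)
        fix js x assume js: "length (js::'a list) \<le> N"
        show "norm (iter_partial js (?m \<phi>) x) \<le> (R + N) * B"
        proof (cases "x \<in> K")
          case True
          have "norm (iter_partial js (?m \<phi>) x) \<le> (R + length js) * B"
            using p(3) js R(2)[OF True, of j] unfolding cbound_def
            by (intro iter_partial_times_coordinate_bound test_funD p) auto
          also have "\<dots> \<le> (R + N) * B" using js B by (intro mult_right_mono) auto
          finally show ?thesis .
        next
          case False
          have "tsupp (?m \<phi>) \<subseteq> K"
            using p(2) tsupp_superset[of \<phi>] by (intro tsupp_subset compact_imp_closed K) auto
          then have "iter_partial js (?m \<phi>) x = 0" using False by (intro iter_partial_zero_outside) blast
          then show ?thesis using B R(1) by simp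
        qed
      qed
      moreover have "tsupp (?m \<phi>) \<subseteq> K"
        using p(2) tsupp_superset[of \<phi>] by (intro tsupp_subset compact_imp_closed K) auto
      ultimately show "norm (T (?m \<phi>)) \<le> C * (R + N) * B"
        using C(2) tm[OF p(1)] unfolding order_bound_def by (simp add: mult.assoc)
    qed
    then show ?thesis by blast
  qed
  ultimately show "distribution (\<lambda>\<phi>. T (?m \<phi>))" unfolding distribution_alt by blast
  fix \<phi> :: "real^'a \<Rightarrow> complex" assume phi: "test_fun \<phi>"
  note F = multiplier[OF T tm[OF phi]]
  obtain \<psi> where \<psi>: "test_fun \<psi>" "multiplier T (?m \<phi>) = (\<lambda>y. of_real (y $ j) * \<psi> y)"
    using test_fun_divide_coordinate[OF F(1), of j] multiplier_zero_on_hyperplane[OF T tm[OF phi], of j] by auto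
  have "T (?m (dil y \<phi>)) = \<psi> y" if y: "all_nz y" for y
  proof -
    have yj: "y $ j \<noteq> 0" using y by (simp add: all_nz_def)
    have "?m (dil y \<phi>) = (\<lambda>x. inverse (of_real (y $ j)) * dil y (?m \<phi>) x)"
      using yj by (simp add: dil_def fun_eq_iff)
    then have "T (?m (dil y \<phi>)) = inverse (of_real (y $ j)) * T (dil y (?m \<phi>))"
      using test_linearD(1)[OF L test_fun_dil(1)[OF tm[OF phi] y]] by presburger
    also have "\<dots> = inverse (of_real (y $ j)) * (of_real (y $ j) * \<psi> y)"
      using F(2)[OF y] \<psi>(2) by simp
    finally show ?thesis using yj by simp
  qed
  then show "\<exists>\<psi>. test_fun \<psi> \<and> (\<forall>y. (\<forall>j. y $ j \<noteq> 0) \<longrightarrow> T (\<lambda>x. complex_of_real (x $ j) * \<phi> (x * y)) = \<psi> y)"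
    using \<psi>(1) unfolding all_nz_def dil_def by blast
qed

text \<open>Writing \<phi> = x_j \<psi> gives T(dil y \<phi>) = y_j (x_j T)(dil y \<psi>), and x_j T
  stays in the class, so each division gains a power of y_j; hence the induction generalises over
  \<open>T\<close>. Support in x_j \<ge> 0 forces \<phi> to vanish on the hyperplane and passes to
  \<psi>.\<close>

lemma dilate_decay:
  assumes "DH T" "test_fun \<phi>" "\<And>x. x \<in> tsupp \<phi> \<Longrightarrow> 0 \<le> x $ j"
  shows "\<exists>C. \<forall>y. all_nz y \<longrightarrow> norm (T (dil y \<phi>)) \<le> C * \<bar>y $ j\<bar> ^ K"
  using assms
proof (induction K arbitrary: T \<phi>)
  case 0
  obtain B where "\<And>x. norm (multiplier T \<phi> x) \<le> B" using test_fun_bounded[OF multiplier(1)[OF 0(1,2)]] by blast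
  then show ?case using multiplier(2)[OF 0(1,2)] by (intro exI[of _ B]) (metis mult.right_neutral power_0)
next
  case (Suc K)
  have "\<phi> x = 0" if "x $ j = 0" for x
  proof -
    \<comment> \<open>The hyperplane is approached from the side x_j < 0, where \<phi> is 0.\<close>
    let ?s = "\<lambda>n. x + inverse (real (Suc n)) *\<^sub>R axis j (-1)"
    have s: "?s \<longlonglongrightarrow> x + 0 *\<^sub>R axis j (-1)" by (intro tendsto_intros LIMSEQ_inverse_real_of_nat)
    have "?s n $ j < 0" for n using that by (simp add: axis_def)
    then have "\<phi> (?s n) = 0" for n using Suc(4) tsupp_superset[of \<phi>] by (meson not_le)
    moreover have "(\<lambda>n. \<phi> (?s n)) \<longlonglongrightarrow> \<phi> (x + 0 *\<^sub>R axis j (-1))"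
      using continuous_on_tendsto_compose[OF smooth_fun_continuous[OF test_funD(1)[OF Suc(3)], of UNIV] s] by simp
    ultimately show ?thesis by (simp add: LIMSEQ_const_iff)
  qed
  then obtain \<psi> where \<psi>: "test_fun \<psi>" "\<phi> = (\<lambda>x. of_real (x $ j) * \<psi> x)" "tsupp \<psi> \<subseteq> tsupp \<phi>"
    using test_fun_divide_coordinate[OF Suc(3), of j] by blast
  let ?T = "\<lambda>\<phi>. T (\<lambda>x. of_real (x $ j) * \<phi> x)"
  obtain C where C: "\<And>y. all_nz y \<Longrightarrow> norm (?T (dil y \<psi>)) \<le> C * \<bar>y $ j\<bar> ^ K"
    using Suc(1)[OF DH_times_coordinate[OF Suc(2)] \<psi>(1)] Suc(4) \<psi>(3) by blast
  have "norm (T (dil y \<phi>)) \<le> C * \<bar>y $ j\<bar> ^ Suc K" if y: "all_nz y" for y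
  proof -
    have "dil y \<phi> = (\<lambda>x. of_real (y $ j) * (of_real (x $ j) * dil y \<psi> x))"
      by (simp add: \<psi>(2) dil_def fun_eq_iff)
    then have "T (dil y \<phi>) = of_real (y $ j) * ?T (dil y \<psi>)"
      using test_linearD(1)[OF DH_linear[OF Suc(2)]
        test_fun_mult[OF smooth_fun_component(1) test_fun_dil(1)[OF \<psi>(1) y], of j], of "of_real (y $ j)"] by simp
    then have "norm (T (dil y \<phi>)) = \<bar>y $ j\<bar> * norm (?T (dil y \<psi>))" by (simp add: norm_mult)
    also have "\<dots> \<le> \<bar>y $ j\<bar> * (C * \<bar>y $ j\<bar> ^ K)" by (intro mult_left_mono C y) auto
    finally show ?thesis by (simp add: mult_ac)
  qed
  then show ?case by blast
qed

text \<open>Pointwise decay says that the functionals |y_j|^(-K) T(dil y \<phi>), indexed by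
  \<open>(y, j)\<close>, are bounded on each \<phi> supported in the unit cube; uniform boundedness
  then gives one constant and one order for all of them.\<close>

lemma dilate_decay_uniform:
  assumes T: "DH T"
  shows "\<exists>C M. C > 0 \<and> (\<forall>\<phi> B y j. test_fun \<phi> \<longrightarrow> tsupp \<phi> \<subseteq> cbox 0 1 \<longrightarrow> cbound M \<phi> B \<longrightarrow> all_nz y \<longrightarrow>
      norm (T (dil y \<phi>)) \<le> C * B * \<bar>y $ j\<bar> ^ K)"
proof -
  \<comment> \<open>Pairs whose \<open>y\<close> has a zero coordinate get the zero functional, so
    that the index set is a full type.\<close>
  define \<Lambda> where "\<Lambda> p \<phi> = (if all_nz (fst p) then of_real (inverse (\<bar>fst p $ snd p\<bar> ^ K)) * T (dil (fst p) \<phi>) else 0)"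
    for p :: "(real^'a) \<times> 'a" and \<phi>
  have \<Lambda>: "\<Lambda> p = (if all_nz (fst p) then (\<lambda>\<phi>. of_real (inverse (\<bar>fst p $ snd p\<bar> ^ K)) * T (dil (fst p) \<phi>)) else (\<lambda>\<phi>. 0))" for p
    by (auto simp: \<Lambda>_def fun_eq_iff)
  have "\<exists>C M. C > 0 \<and> (\<forall>p. order_bound (cbox 0 1) (\<Lambda> p) C M)"
  proof (rule uniform_boundedness[where K="cbox 0 1" and \<Lambda>=\<Lambda>])
    show "test_linear (\<Lambda> p)" for p
    proof (cases "all_nz (fst p)")
      case True
      then show ?thesis unfolding \<Lambda> by (simp add: test_linear_dilate[OF DH_linear[OF T]] del: of_real_inverse)
    qed (simp add: \<Lambda> test_linear_def)
    show "\<exists>C N. order_bound (cbox 0 1) (\<Lambda> p) C N" for p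
    proof (cases "all_nz (fst p)")
      case True
      then show ?thesis unfolding \<Lambda>
        by (simp add: order_bound_dilate[OF DH_distribution[OF T] compact_cbox] del: of_real_inverse)
    next
      case False
      then show ?thesis unfolding \<Lambda> by (intro exI[of _ 0]) (simp add: order_bound_def)
    qed
    show "\<exists>B. \<forall>p. norm (\<Lambda> p \<phi>) \<le> B" if phi: "test_fun \<phi>" "tsupp \<phi> \<subseteq> cbox 0 1" for \<phi>
    proof -
      have "\<exists>C. \<forall>y. all_nz y \<longrightarrow> norm (T (dil y \<phi>)) \<le> C * \<bar>y $ j\<bar> ^ K" for j
        using phi(2) by (intro dilate_decay T phi) (auto simp: mem_box_cart subset_iff)
      then obtain C where C: "\<And>j y. all_nz y \<Longrightarrow> norm (T (dil y \<phi>)) \<le> C j * \<bar>y $ j\<bar> ^ K" by metis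
      have "norm (\<Lambda> p \<phi>) \<le> (\<Sum>j\<in>UNIV. \<bar>C j\<bar>)" for p
      proof (cases "all_nz (fst p)")
        case True
        then have pos: "\<bar>fst p $ snd p\<bar> ^ K > 0" by (auto simp: all_nz_def)
        have "norm (\<Lambda> p \<phi>) = norm (T (dil (fst p) \<phi>)) / \<bar>fst p $ snd p\<bar> ^ K"
          using True by (simp add: \<Lambda> norm_mult norm_inverse norm_power divide_inverse mult.commute)
        also have "\<dots> \<le> C (snd p)" using C[OF True, of "snd p"] pos by (simp add: pos_divide_le_eq)
        also have "\<dots> \<le> \<bar>C (snd p)\<bar>" by simp
        also have "\<dots> \<le> (\<Sum>j\<in>UNIV. \<bar>C j\<bar>)" by (rule member_le_sum) auto
        finally show ?thesis .
      qed (simp add: \<Lambda> sum_nonneg)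
      then show ?thesis by blast
    qed
  next
    fix C N assume "C > 0" "\<And>p. order_bound (cbox 0 1) (\<Lambda> p) C N"
    then show "\<exists>C M. C > 0 \<and> (\<forall>p. order_bound (cbox 0 1) (\<Lambda> p) C M)" by blast
  qed (rule compact_cbox)
  then obtain C M where C: "C > 0" "\<And>p. order_bound (cbox 0 1) (\<Lambda> p) C M" by blast
  have "norm (T (dil y \<phi>)) \<le> C * B * \<bar>y $ j\<bar> ^ K"
    if "test_fun \<phi>" "tsupp \<phi> \<subseteq> cbox 0 1" "cbound M \<phi> B" "all_nz y" for \<phi> B y j
  proof -
    have "norm (\<Lambda> (y, j) \<phi>) \<le> C * B" using C(2) that unfolding order_bound_def by blast
    then have "norm (T (dil y \<phi>)) / \<bar>y $ j\<bar> ^ K \<le> C * B"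
      using that(4) by (simp add: \<Lambda> norm_mult norm_inverse norm_power divide_inverse mult.commute)
    moreover have "\<bar>y $ j\<bar> ^ K > 0" using that(4) by (simp add: all_nz_def)
    ultimately show ?thesis by (simp add: pos_divide_le_eq)
  qed
  then show ?thesis using C(1) by blast
qed

subsection \<open>Smooth functions of one variable\<close>

definition smooth_real :: "(real \<Rightarrow> real) \<Rightarrow> bool" where
  "smooth_real f \<longleftrightarrow> (\<forall>k x. (deriv ^^ k) f field_differentiable at x)"

lemma smooth_real_coinduct:
  assumes "X f" "\<And>f. X f \<Longrightarrow> \<exists>g. X g \<and> (\<forall>x. (f has_real_derivative g x) (at x))"
  shows "smooth_real f"
proof -
  have d: "X f \<Longrightarrow> X (deriv f) \<and> (\<forall>x. f field_differentiable at x)" for f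
  proof -
    assume "X f"
    then obtain g where g: "X g" "\<And>x. (f has_real_derivative g x) (at x)" using assms(2) by blast
    then have "deriv f = g" using DERIV_imp_deriv by blast
    then show ?thesis using g field_differentiable_def by blast
  qed
  have "X ((deriv ^^ k) f)" for k by (induction k) (use assms(1) d in auto)
  then show ?thesis unfolding smooth_real_def using d by blast
qed

lemma smooth_real_has_derivative: "smooth_real f \<Longrightarrow> (f has_real_derivative deriv f x) (at x)"
  unfolding smooth_real_def using DERIV_deriv_iff_field_differentiable funpow_0 by metis

lemma smooth_real_higher_deriv: "smooth_real f \<Longrightarrow> smooth_real ((deriv ^^ k) f)"
  unfolding smooth_real_def by (metis comp_apply funpow_add)

lemma smooth_real_deriv: "smooth_real f \<Longrightarrow> smooth_real (deriv f)"
  using smooth_real_higher_deriv[of f 1] by simp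

lemma smooth_real_continuous: "smooth_real f \<Longrightarrow> continuous_on A f"
  using smooth_real_has_derivative DERIV_isCont continuous_at_imp_continuous_on by blast

lemma smooth_realI:
  assumes "\<And>x. (f has_real_derivative g x) (at x)" "smooth_real g" shows "smooth_real f"
proof (rule smooth_real_coinduct[where X="\<lambda>h. h = f \<or> smooth_real h"])
  show "\<exists>g. (g = f \<or> smooth_real g) \<and> (\<forall>x. (h has_real_derivative g x) (at x))"
    if "h = f \<or> smooth_real h" for h
    using that assms smooth_real_has_derivative smooth_real_deriv by blast
qed simp

lemma smooth_real_const: "smooth_real (\<lambda>x. c)"
  by (rule smooth_real_coinduct[where X="\<lambda>f. \<exists>c. f = (\<lambda>x. c)"]) (auto intro!: derivative_eq_intros)

lemma smooth_real_ident: "smooth_real (\<lambda>x. x)"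
  by (rule smooth_realI[where g="\<lambda>x. 1"]) (auto simp: smooth_real_const)

lemma smooth_real_add:
  assumes "smooth_real f" "smooth_real g" shows "smooth_real (\<lambda>x. f x + g x)"
proof (rule smooth_real_coinduct[where X="\<lambda>h. \<exists>f g. smooth_real f \<and> smooth_real g \<and> h = (\<lambda>x. f x + g x)"])
  fix h assume "\<exists>f g. smooth_real f \<and> smooth_real g \<and> h = (\<lambda>x. f x + g x)"
  then obtain f g where h: "smooth_real f" "smooth_real g" "h = (\<lambda>x. f x + g x)" by blast
  have "(h has_real_derivative deriv f x + deriv g x) (at x)" for x
    unfolding h(3) by (intro DERIV_add smooth_real_has_derivative h)
  then show "\<exists>k. (\<exists>f g. smooth_real f \<and> smooth_real g \<and> k = (\<lambda>x. f x + g x)) \<and> (\<forall>x. (h has_real_derivative k x) (at x))"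
    using smooth_real_deriv h(1,2) by blast
qed (use assms in blast)

inductive real_prod_span :: "(real \<Rightarrow> real) \<Rightarrow> bool" where
  prod: "smooth_real f \<Longrightarrow> smooth_real g \<Longrightarrow> real_prod_span (\<lambda>x. f x * g x)"
| add: "real_prod_span f \<Longrightarrow> real_prod_span g \<Longrightarrow> real_prod_span (\<lambda>x. f x + g x)"

lemma smooth_real_mult:
  assumes "smooth_real f" "smooth_real g" shows "smooth_real (\<lambda>x. f x * g x)"
proof (rule smooth_real_coinduct[where X=real_prod_span])
  show "\<exists>g. real_prod_span g \<and> (\<forall>x. (h has_real_derivative g x) (at x))" if "real_prod_span h" for h
    using that
  proof induction
    case (prod f g)
    then have "real_prod_span (\<lambda>x. deriv f x * g x + deriv g x * f x)"
      by (intro real_prod_span.intros smooth_real_deriv)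
    then show ?case using DERIV_mult[OF smooth_real_has_derivative[OF prod(1)] smooth_real_has_derivative[OF prod(2)]] by blast
  next
    case (add f g)
    then obtain f' g' where "real_prod_span f'" "real_prod_span g'"
      and d: "\<And>x. (f has_real_derivative f' x) (at x)" "\<And>x. (g has_real_derivative g' x) (at x)" by blast
    then show ?case
      by (intro exI[of _ "\<lambda>x. f' x + g' x"] conjI allI DERIV_add d real_prod_span.add)
  qed
qed (use assms in \<open>intro real_prod_span.prod\<close>)

lemma smooth_real_power: "smooth_real f \<Longrightarrow> smooth_real (\<lambda>x. f x ^ k)"
  by (induction k) (auto simp: smooth_real_const intro: smooth_real_mult)

lemma deriv_affine:
  assumes "smooth_real f"
  shows "((\<lambda>x. c * f (a * x + b)) has_real_derivative c * a * deriv f (a * x + b)) (at x)"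
proof -
  have "((\<lambda>x. a * x + b) has_real_derivative a) (at x)" by (auto intro!: derivative_eq_intros)
  from DERIV_cmult[OF DERIV_chain2[where f=f, OF smooth_real_has_derivative[OF assms] this], of c]
  show ?thesis by (simp add: mult_ac)
qed

lemma smooth_real_affine:
  assumes "smooth_real f" shows "smooth_real (\<lambda>x. c * f (a * x + b))"
proof (rule smooth_real_coinduct[where X="\<lambda>h. \<exists>c f. smooth_real f \<and> h = (\<lambda>x. c * f (a * x + b))"])
  fix h assume "\<exists>c f. smooth_real f \<and> h = (\<lambda>x. c * f (a * x + b))"
  then obtain c f where h: "smooth_real f" "h = (\<lambda>x. c * f (a * x + b))" by blast
  then show "\<exists>g. (\<exists>c f. smooth_real f \<and> g = (\<lambda>x. c * f (a * x + b))) \<and> (\<forall>x. (h has_real_derivative g x) (at x))"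
    using deriv_affine[OF h(1), of c a b] smooth_real_deriv[OF h(1)]
    by (intro exI[of _ "\<lambda>x. (c * a) * deriv f (a * x + b)"]) auto
qed (use assms in blast)

lemma higher_deriv_affine:
  assumes "smooth_real f"
  shows "(deriv ^^ k) (\<lambda>x. c * f (a * x + b)) = (\<lambda>x. c * a ^ k * (deriv ^^ k) f (a * x + b))"
proof (induction k)
  case (Suc k)
  have "deriv (\<lambda>x. c * a ^ k * (deriv ^^ k) f (a * x + b)) = (\<lambda>x. c * a ^ k * a * deriv ((deriv ^^ k) f) (a * x + b))"
    using DERIV_imp_deriv[OF deriv_affine[OF smooth_real_higher_deriv[OF assms]]] by blast
  then show ?case unfolding funpow.simps comp_def Suc by (simp add: mult_ac)
qed simp

lemma higher_deriv_cong_open: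
  assumes "open U" "x \<in> U" "\<And>z. z \<in> U \<Longrightarrow> f z = (g z :: real)"
  shows "(deriv ^^ k) f x = (deriv ^^ k) g x"
  using assms(2)
proof (induction k arbitrary: x)
  case (Suc k)
  have "\<forall>\<^sub>F z in nhds x. (deriv ^^ k) f z = (deriv ^^ k) g z"
    using eventually_nhds_in_open[OF assms(1) Suc(2)] by eventually_elim (rule Suc(1))
  then show ?case by (auto intro: deriv_cong_ev)
qed (use assms in auto)

text \<open>Division by zero gives 0, so near a zero of \<open>d\<close> the quotient is the zero
  function; elsewhere the quotient rule applies. Letting the exponent vary makes the class closed
  under derivatives: the new numerator again vanishes near the zeros of \<open>d\<close>, and
  \<open>k\<close> becomes \<open>Suc k\<close>.\<close>

lemma smooth_real_divide:
  assumes "smooth_real a" "smooth_real d" "\<And>x. d x = 0 \<Longrightarrow> \<exists>U. open U \<and> x \<in> U \<and> (\<forall>z\<in>U. a z = 0)"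
  shows "smooth_real (\<lambda>x. a x / d x ^ k)"
    "((\<lambda>x. a x / d x ^ k) has_real_derivative (deriv a x * d x - k * (a x * deriv d x)) / d x ^ Suc k) (at x)"
proof -
  let ?Z = "\<lambda>a. \<forall>x. d x = 0 \<longrightarrow> (\<exists>U. open U \<and> x \<in> U \<and> (\<forall>z\<in>U. a z = (0::real)))"
  let ?D = "\<lambda>a k x. deriv a x * d x - real k * (a x * deriv d x)"
  have D: "((\<lambda>x. a x / d x ^ k) has_real_derivative ?D a k x / d x ^ Suc k) (at x)"
    if a: "smooth_real a" "?Z a" for a k x
  proof (cases "d x = 0")
    case False
    note das = smooth_real_has_derivative[OF a(1)] smooth_real_has_derivative[OF assms(2)]
    have "((\<lambda>x. a x / d x ^ k) has_real_derivative
        (deriv a x * d x ^ k - a x * (real k * (d x ^ (k - Suc 0) * deriv d x))) / (d x ^ k * d x ^ k)) (at x)"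
      using False by (auto intro!: derivative_eq_intros das)
    moreover have "(deriv a x * d x ^ k - a x * (real k * (d x ^ (k - Suc 0) * deriv d x))) / (d x ^ k * d x ^ k)
        = ?D a k x / d x ^ Suc k"
      using False by (cases k) (auto simp: field_simps)
    ultimately show ?thesis by simp
  next
    case True
    then obtain U where U: "open U" "x \<in> U" "\<forall>z\<in>U. a z = 0" using a(2) by blast
    have "((\<lambda>x. 0) has_real_derivative 0) (at x)" by simp
    then have "((\<lambda>x. a x / d x ^ k) has_real_derivative 0) (at x)"
      by (rule has_field_derivative_transform_within_open[OF _ U(1,2)]) (use U(3) in auto)
    then show ?thesis using True by simp
  qed
  have Z: "?Z (?D a k)" if a: "?Z a" for a k
  proof (intro allI impI)
    fix x assume "d x = 0"
    then obtain U where U: "open U" "x \<in> U" "\<forall>z\<in>U. a z = 0" using a by blast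
    have "deriv a z = 0" if "z \<in> U" for z
      using higher_deriv_cong_open[OF U(1) that, of a "\<lambda>_. 0" 1] U(3) by simp
    then show "\<exists>U. open U \<and> x \<in> U \<and> (\<forall>z\<in>U. ?D a k z = 0)" using U by auto
  qed
  have za: "?Z a" using assms(3) by blast
  show "((\<lambda>x. a x / d x ^ k) has_real_derivative ?D a k x / d x ^ Suc k) (at x)" by (rule D[OF assms(1) za])
  have sD: "smooth_real (?D a k)" if "smooth_real a" for a k
  proof -
    have "smooth_real (\<lambda>x. deriv a x * d x + (- real k) * (a x * deriv d x))"
      by (intro smooth_real_add smooth_real_mult smooth_real_const smooth_real_deriv that assms)
    then show ?thesis by simp
  qed
  show "smooth_real (\<lambda>x. a x / d x ^ k)"
  proof (rule smooth_real_coinduct[where X="\<lambda>f. \<exists>a k. smooth_real a \<and> ?Z a \<and> f = (\<lambda>x. a x / d x ^ k)"])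
    fix f assume "\<exists>a k. smooth_real a \<and> ?Z a \<and> f = (\<lambda>x. a x / d x ^ k)"
    then obtain a k where f: "smooth_real a" "?Z a" "f = (\<lambda>x. a x / d x ^ k)" by blast
    show "\<exists>g. (\<exists>a k. smooth_real a \<and> ?Z a \<and> g = (\<lambda>x. a x / d x ^ k)) \<and> (\<forall>x. (f has_real_derivative g x) (at x))"
    proof (rule exI, rule conjI)
      show "\<forall>x. (f has_real_derivative ?D a k x / d x ^ Suc k) (at x)" unfolding f(3) by (rule allI, rule D[OF f(1,2)])
      show "\<exists>a' k'. smooth_real a' \<and> ?Z a' \<and> (\<lambda>x. ?D a k x / d x ^ Suc k) = (\<lambda>x. a' x / d x ^ k')"
        by (rule exI[of _ "?D a k"], rule exI[of _ "Suc k"], intro conjI sD f Z[OF f(2)] refl)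
    qed
  qed (use assms(1) za in blast)
qed

text \<open>For \<open>p = 1\<close> the classical flat function exp(-1/x). The polynomial in 1/x is
  there because differentiation stays within this family, sending \<open>p\<close> to X^2 (p -
  p').\<close>

definition exp_poly :: "real poly \<Rightarrow> real \<Rightarrow> real" where
  "exp_poly p x = (if x > 0 then poly p (1 / x) * exp (- (1 / x)) else 0)"

lemma poly_exp_tendsto_0: "((\<lambda>x::real. poly p x * exp (- x)) \<longlongrightarrow> 0) at_top"
proof -
  have "((\<lambda>x::real. \<Sum>i\<le>degree p. coeff p i * (x ^ i / exp x)) \<longlongrightarrow> (\<Sum>i\<le>degree p. coeff p i * 0)) at_top"
    by (intro tendsto_intros tendsto_power_div_exp_0)
  moreover have "(\<Sum>i\<le>degree p. coeff p i * (x ^ i / exp x)) = poly p x * exp (- x)" for x :: real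
    by (simp add: poly_altdef sum_distrib_right exp_minus divide_inverse mult.assoc)
  ultimately show ?thesis by simp
qed

lemma exp_poly_tendsto_0: "(exp_poly p \<longlongrightarrow> 0) (at 0)"
proof (rule filterlim_split_at)
  have "((\<lambda>x. 0) \<longlongrightarrow> 0) (at_left (0::real))" by simp
  then show "(exp_poly p \<longlongrightarrow> 0) (at_left 0)"
    by (rule tendsto_cong[THEN iffD1, rotated])
       (auto simp: exp_poly_def eventually_at_filter)
  have "((\<lambda>x. poly p (inverse x) * exp (- inverse x)) \<longlongrightarrow> 0) (at_right 0)"
    by (rule filterlim_compose[OF poly_exp_tendsto_0 filterlim_inverse_at_top_right])
  then show "(exp_poly p \<longlongrightarrow> 0) (at_right 0)"
    by (rule tendsto_cong[THEN iffD1, rotated])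
       (auto simp: exp_poly_def eventually_at_filter inverse_eq_divide)
qed

lemma exp_poly_has_derivative:
  "(exp_poly p has_real_derivative exp_poly (monom 1 2 * (p - pderiv p)) x) (at x)"
proof -
  consider "x < 0" | "x = 0" | "x > 0" by linarith
  then show ?thesis
  proof cases
    case 1
    have "((\<lambda>x. 0) has_real_derivative 0) (at x)" by simp
    then have "(exp_poly p has_real_derivative 0) (at x)"
      by (rule has_field_derivative_transform_within_open[where S="{..<0}"]) (use 1 in \<open>auto simp: exp_poly_def\<close>)
    then show ?thesis using 1 by (simp add: exp_poly_def)
  next
    case 2
    \<comment> \<open>The difference quotient at 0 is the member of the family with polynomial X p,
      so its limit is 0.\<close>
    have "(exp_poly (monom 1 1 * p) \<longlongrightarrow> 0) (at 0)" by (rule exp_poly_tendsto_0)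
    then have "((\<lambda>h. (exp_poly p (0 + h) - exp_poly p 0) / h) \<longlongrightarrow> 0) (at 0)"
      by (rule tendsto_cong[THEN iffD1, rotated]) (auto simp: exp_poly_def eventually_at_filter poly_monom)
    then show ?thesis using 2 unfolding DERIV_def by (simp add: exp_poly_def)
  next
    case 3
    have "((\<lambda>x. poly p (1 / x) * exp (- (1 / x))) has_real_derivative
        poly (pderiv p) (1 / x) * (- 1 / (x * x)) * exp (- (1 / x)) + poly p (1 / x) * (exp (- (1 / x)) * (1 / (x * x)))) (at x)"
    proof -
      have i: "((\<lambda>x. 1 / x) has_real_derivative - 1 / (x * x)) (at x)"
        using 3 by (auto intro!: derivative_eq_intros)
      have "((\<lambda>x. exp (- (1 / x))) has_real_derivative exp (- (1 / x)) * (1 / (x * x))) (at x)"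
        using 3 by (auto intro!: derivative_eq_intros)
      from DERIV_mult[OF DERIV_chain2[OF poly_DERIV i] this] show ?thesis by (simp add: algebra_simps)
    qed
    then have "(exp_poly p has_real_derivative
        poly (pderiv p) (1 / x) * (- 1 / (x * x)) * exp (- (1 / x)) + poly p (1 / x) * (exp (- (1 / x)) * (1 / (x * x)))) (at x)"
      by (rule has_field_derivative_transform_within_open[where S="{0<..}"]) (use 3 in \<open>auto simp: exp_poly_def\<close>)
    moreover have "poly (pderiv p) (1 / x) * (- 1 / (x * x)) * exp (- (1 / x)) + poly p (1 / x) * (exp (- (1 / x)) * (1 / (x * x)))
        = exp_poly (monom 1 2 * (p - pderiv p)) x"
      using 3 by (simp add: exp_poly_def poly_monom power2_eq_square field_simps)
    ultimately show ?thesis by simp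
  qed
qed

lemma smooth_real_exp_poly: "smooth_real (exp_poly p)"
  by (rule smooth_real_coinduct[where X="\<lambda>f. \<exists>p. f = exp_poly p"]) (use exp_poly_has_derivative in blast)+

text \<open>The transition takes place on [1, 2], so that for N > 0 the function
  \<open>smooth_step (N * x)\<close> vanishes for x \<le> 1/N and equals 1 from 2/N on.\<close>

definition smooth_step :: "real \<Rightarrow> real" where
  "smooth_step x = exp_poly 1 (x - 1) / (exp_poly 1 (x - 1) + exp_poly 1 (2 - x))"

lemma exp_poly_one: "0 \<le> exp_poly 1 x" "x > 0 \<Longrightarrow> 0 < exp_poly 1 x" "x \<le> 0 \<Longrightarrow> exp_poly 1 x = 0"
  by (auto simp: exp_poly_def)

lemma smooth_step_denominator: "0 < exp_poly 1 (x - 1) + exp_poly 1 (2 - x)"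
  using exp_poly_one[of "x - 1"] exp_poly_one[of "2 - x"] by (cases "x > 1") (auto intro: add_pos_nonneg add_nonneg_pos)

lemma smooth_step:
  "smooth_real smooth_step" "x \<le> 1 \<Longrightarrow> smooth_step x = 0" "x \<ge> 2 \<Longrightarrow> smooth_step x = 1"
  "0 \<le> smooth_step x" "smooth_step x \<le> 1"
proof -
  have 1: "smooth_real (\<lambda>x. exp_poly 1 (x - 1))" "smooth_real (\<lambda>x. exp_poly 1 (2 - x))"
    using smooth_real_affine[OF smooth_real_exp_poly[of 1], of 1 1 "-1"] smooth_real_affine[OF smooth_real_exp_poly[of 1], of 1 "-1" 2]
    by simp_all
  have "smooth_real (\<lambda>x. exp_poly 1 (x - 1) / (exp_poly 1 (x - 1) + exp_poly 1 (2 - x)) ^ 1)"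
    by (intro smooth_real_divide(1) smooth_real_add 1) (use smooth_step_denominator in \<open>metis less_irrefl\<close>)
  then show "smooth_real smooth_step" by (simp add: smooth_step_def[abs_def])
  show "x \<le> 1 \<Longrightarrow> smooth_step x = 0" by (simp add: smooth_step_def exp_poly_one(3))
  show "x \<ge> 2 \<Longrightarrow> smooth_step x = 1"
    using smooth_step_denominator[of x] exp_poly_one(3)[of "2 - x"] by (simp add: smooth_step_def)
  show "0 \<le> smooth_step x" "smooth_step x \<le> 1"
    using smooth_step_denominator[of x] exp_poly_one(1)[of "x - 1"] exp_poly_one(1)[of "2 - x"]
    by (auto simp: smooth_step_def divide_le_eq_1)
qed

subsection \<open>Products of functions of one variable\<close>

text \<open>Tensor products, complex-valued to match test functions. The kernels, weights and
  cutoffs below have this form, which reduces their calculus to one variable.\<close>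

definition prod_fun :: "('d::finite \<Rightarrow> real \<Rightarrow> real) \<Rightarrow> real^'d \<Rightarrow> complex" where
  "prod_fun g x = of_real (\<Prod>j\<in>UNIV. g j (x $ j))"

lemma partial_prod_fun:
  assumes "\<And>j. smooth_real (g j)"
  shows "differentiable_in i (prod_fun g)" "partial i (prod_fun g) = prod_fun (g(i := deriv (g i)))"
proof -
  have split: "(\<Prod>j\<in>UNIV. h j (y $ j)) = h i (y $ i) * (\<Prod>j\<in>UNIV - {i}. h j (y $ j))" for h :: "'a \<Rightarrow> real \<Rightarrow> real" and y
    by (rule prod.remove) auto
  have "((\<lambda>t. prod_fun g (x + t *\<^sub>R axis i 1)) has_vector_derivative prod_fun (g(i := deriv (g i))) x) (at 0)" for x
  proof -
    let ?P = "\<Prod>j\<in>UNIV - {i}. g j (x $ j)"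
    have "((\<lambda>t. ?P * g i (1 * t + x $ i)) has_real_derivative ?P * 1 * deriv (g i) (1 * 0 + x $ i)) (at 0)"
      by (rule deriv_affine[OF assms])
    then have "((\<lambda>t. ?P * g i (t + x $ i)) has_real_derivative ?P * deriv (g i) (x $ i)) (at 0)" by simp
    then have "((\<lambda>t. complex_of_real (?P * g i (t + x $ i))) has_vector_derivative of_real (?P * deriv (g i) (x $ i))) (at 0)"
      by (rule has_vector_derivative_of_real)
    moreover have "prod_fun g (x + t *\<^sub>R axis i 1) = of_real (?P * g i (t + x $ i))" for t
    proof -
      have "(\<Prod>j\<in>UNIV - {i}. g j ((x + t *\<^sub>R axis i 1) $ j)) = ?P"
        by (intro prod.cong) (auto simp: axis_def)
      then show ?thesis unfolding prod_fun_def split by (simp add: axis_def add.commute mult.commute)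
    qed
    moreover have "prod_fun (g(i := deriv (g i))) x = of_real (?P * deriv (g i) (x $ i))"
    proof -
      have "(\<Prod>j\<in>UNIV - {i}. (g(i := deriv (g i))) j (x $ j)) = ?P"
        by (intro prod.cong) auto
      then show ?thesis unfolding prod_fun_def split by (simp add: mult.commute)
    qed
    ultimately show ?thesis by simp
  qed
  note * = partialI[where f="prod_fun g", OF this]
  show "differentiable_in i (prod_fun g)" "partial i (prod_fun g) = prod_fun (g(i := deriv (g i)))"
    by (fact *)+
qed

lemma smooth_fun_prod_fun:
  assumes "\<And>j. smooth_real (g j)" shows "smooth_fun (prod_fun g)"
proof (rule smooth_fun_coinduct[where X="\<lambda>f. \<exists>g. (\<forall>j. smooth_real (g j)) \<and> f = prod_fun g"])
  fix f :: "real^'a \<Rightarrow> complex" assume "\<exists>g. (\<forall>j. smooth_real (g j)) \<and> f = prod_fun g"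
  then obtain g where g: "\<And>j. smooth_real (g j)" "f = prod_fun g" by blast
  show "continuous_on UNIV f" unfolding g(2) prod_fun_def
    by (intro continuous_on_of_real continuous_on_prod continuous_on_compose2[OF smooth_real_continuous[OF g(1), where A=UNIV]]
        continuous_on_component continuous_on_id) auto
  show "differentiable_in i f \<and> (\<exists>g. (\<forall>j. smooth_real (g j)) \<and> partial i f = prod_fun g)" for i
    using partial_prod_fun[OF g(1)] g smooth_real_deriv by (auto intro!: exI[of _ "g(i := deriv (g i))"])
qed (use assms in blast)

lemma iter_partial_prod_fun:
  assumes "\<And>j. smooth_real (g j)"
  shows "iter_partial js (prod_fun g) = prod_fun (\<lambda>j. (deriv ^^ count_list js j) (g j))"
proof (induction js)
  case (Cons i js)
  have "(\<lambda>j. (deriv ^^ count_list js j) (g j))(i := deriv ((deriv ^^ count_list js i) (g i))) =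
      (\<lambda>j. (deriv ^^ count_list (i # js) j) (g j))" by auto
  then show ?case
    using partial_prod_fun(2)[of "\<lambda>j. (deriv ^^ count_list js j) (g j)" i] smooth_real_higher_deriv[OF assms]
    by (simp add: Cons)
qed simp

lemma theta_prod_fun:
  assumes "\<And>j. smooth_real (g j)"
  shows "theta i (prod_fun g) = prod_fun (g(i := (\<lambda>v. v * deriv (g i) v)))"
proof -
  have split: "(\<Prod>j\<in>UNIV. h j (y $ j)) = h i (y $ i) * (\<Prod>j\<in>UNIV - {i}. h j (y $ j))" for h :: "'a \<Rightarrow> real \<Rightarrow> real" and y
    by (rule prod.remove) auto
  show ?thesis unfolding theta_def partial_prod_fun(2)[OF assms] prod_fun_def split
    by (auto simp: fun_eq_iff mult.assoc intro!: prod.cong)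
qed

subsection \<open>Smooth approximations of a truncated polynomial\<close>

text \<open>Boundedness of the limit is included because uniform convergence of products relies on
  it.\<close>

definition bdd_ulim :: "'a set \<Rightarrow> (nat \<Rightarrow> 'a \<Rightarrow> real) \<Rightarrow> bool" where
  "bdd_ulim S f \<longleftrightarrow> (\<exists>L. bounded (L ` S) \<and> uniform_limit S f L sequentially)"

lemma bdd_ulim_add:
  assumes "bdd_ulim S f" "bdd_ulim S g" shows "bdd_ulim S (\<lambda>n x. f n x + g n x)"
proof -
  obtain L M where "bounded (L ` S)" "uniform_limit S f L sequentially" "bounded (M ` S)" "uniform_limit S g M sequentially"
    using assms unfolding bdd_ulim_def by blast
  then show ?thesis unfolding bdd_ulim_def
    by (intro exI[of _ "\<lambda>x. L x + M x"] conjI bounded_plus_comp uniform_limit_add)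
qed

lemma bdd_ulim_mult:
  assumes "bdd_ulim S f" "bdd_ulim S g" shows "bdd_ulim S (\<lambda>n x. f n x * g n x)"
proof -
  obtain L M where LM: "bounded (L ` S)" "uniform_limit S f L sequentially" "bounded (M ` S)" "uniform_limit S g M sequentially"
    using assms unfolding bdd_ulim_def by blast
  obtain B C where BC: "\<And>x. x \<in> S \<Longrightarrow> norm (L x) \<le> B" "\<And>x. x \<in> S \<Longrightarrow> norm (M x) \<le> C"
    using LM(1,3) unfolding bounded_iff by auto
  have "bounded ((\<lambda>x. L x * M x) ` S)"
    unfolding bounded_iff
  proof (intro exI ballI)
    fix z assume "z \<in> (\<lambda>x. L x * M x) ` S"
    then obtain x where "x \<in> S" "z = L x * M x" by blast
    then show "norm z \<le> B * C"
      using BC[of x] order_trans[OF norm_ge_zero BC(1)[of x]] unfolding \<open>z = _\<close> norm_mult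
      by (intro mult_mono) auto
  qed
  then show ?thesis unfolding bdd_ulim_def
    using uniform_lim_mult[OF LM(2,4,1,3)] by blast
qed

lemma bdd_ulim_const: "bdd_ulim S (\<lambda>n x. c)"
  unfolding bdd_ulim_def by (intro exI[of _ "\<lambda>x. c"]) (auto simp: uniform_limit_iff image_constant_conv)

lemma bdd_ulim_prod:
  assumes "\<And>i. i \<in> I \<Longrightarrow> bdd_ulim S (f i)" shows "bdd_ulim S (\<lambda>n x. \<Prod>i\<in>I. f i n x)"
  using assms by (induction I rule: infinite_finite_induct) (auto simp: bdd_ulim_const intro: bdd_ulim_mult)

lemma bdd_ulim_compose:
  assumes "bdd_ulim A f" "h \<in> B \<rightarrow> A" shows "bdd_ulim B (\<lambda>n x. f n (h x))"
proof -
  obtain L where L: "bounded (L ` A)" "uniform_limit A f L sequentially" using assms unfolding bdd_ulim_def by blast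
  have "bounded ((\<lambda>x. L (h x)) ` B)" by (rule bounded_subset[OF L(1)]) (use assms(2) in auto)
  then show ?thesis unfolding bdd_ulim_def using uniform_limit_compose'[OF L(2) assms(2)] by blast
qed

text \<open>Recursion through the first derivative lets products be treated by one use of the
  Leibniz rule per step; \<open>derivs_ulim_iff\<close> recovers the plain meaning.\<close>

fun derivs_ulim :: "nat \<Rightarrow> (nat \<Rightarrow> real \<Rightarrow> real) \<Rightarrow> bool" where
  "derivs_ulim 0 f = bdd_ulim {0..1} f"
| "derivs_ulim (Suc M) f = (bdd_ulim {0..1} f \<and> derivs_ulim M (\<lambda>n. deriv (f n)))"

lemma derivs_ulim_iff: "derivs_ulim M f \<longleftrightarrow> (\<forall>k\<le>M. bdd_ulim {0..1} (\<lambda>n. (deriv ^^ k) (f n)))"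
proof (induction M arbitrary: f)
  case (Suc M)
  have "(\<forall>k\<le>Suc M. bdd_ulim {0..1} (\<lambda>n. (deriv ^^ k) (f n))) \<longleftrightarrow>
      bdd_ulim {0..1} f \<and> (\<forall>k\<le>M. bdd_ulim {0..1} (\<lambda>n. (deriv ^^ Suc k) (f n)))"
    unfolding less_Suc_eq_le[symmetric] All_less_Suc2[of "Suc M"] by simp
  then show ?case by (simp add: Suc funpow_Suc_right del: funpow.simps)
qed simp

lemma derivs_ulim_add:
  assumes "\<And>n. smooth_real (f n)" "\<And>n. smooth_real (g n)" "derivs_ulim M f" "derivs_ulim M g"
  shows "derivs_ulim M (\<lambda>n x. f n x + g n x)"
  using assms
proof (induction M arbitrary: f g)
  case (Suc M)
  have "deriv (\<lambda>x. f n x + g n x) = (\<lambda>x. deriv (f n) x + deriv (g n) x)" for n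
    using DERIV_imp_deriv[OF DERIV_add[OF smooth_real_has_derivative[OF Suc(2)] smooth_real_has_derivative[OF Suc(3)]]] by blast
  moreover have "derivs_ulim M (\<lambda>n x. deriv (f n) x + deriv (g n) x)"
    using Suc(4,5) by (intro Suc(1) smooth_real_deriv Suc(2,3)) auto
  ultimately show ?case using Suc(4,5) by (auto intro: bdd_ulim_add)
qed (simp add: bdd_ulim_add)

lemma derivs_ulim_Suc_D: "derivs_ulim (Suc M) f \<Longrightarrow> derivs_ulim M f"
  unfolding derivs_ulim_iff by simp

lemma derivs_ulim_mult:
  assumes "\<And>n. smooth_real (f n)" "\<And>n. smooth_real (g n)" "derivs_ulim M f" "derivs_ulim M g"
  shows "derivs_ulim M (\<lambda>n x. f n x * g n x)"
  using assms
proof (induction M arbitrary: f g)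
  case (Suc M)
  have "deriv (\<lambda>x. f n x * g n x) = (\<lambda>x. deriv (f n) x * g n x + deriv (g n) x * f n x)" for n
    using DERIV_imp_deriv[OF DERIV_mult[OF smooth_real_has_derivative[OF Suc(2)] smooth_real_has_derivative[OF Suc(3)]]] by blast
  moreover have "derivs_ulim M (\<lambda>n x. deriv (f n) x * g n x + deriv (g n) x * f n x)"
    using Suc(4,5) derivs_ulim_Suc_D[OF Suc(4)] derivs_ulim_Suc_D[OF Suc(5)]
    by (intro derivs_ulim_add smooth_real_mult smooth_real_deriv Suc) auto
  ultimately show ?case using Suc(4,5) by (auto intro: bdd_ulim_mult)
qed (simp add: bdd_ulim_mult)

definition cut_power :: "nat \<Rightarrow> real \<Rightarrow> real" where
  "cut_power p x = x ^ p * smooth_step x"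

lemma smooth_real_cut_power: "smooth_real (cut_power p)"
  unfolding cut_power_def[abs_def] by (intro smooth_real_mult smooth_real_power smooth_real_ident smooth_step)

lemma higher_deriv_zero: "(deriv ^^ k) (\<lambda>x. 0) = (\<lambda>x. 0::real)"
  by (induction k) auto

lemma cut_power_outside:
  "x < 1 \<Longrightarrow> (deriv ^^ k) (cut_power p) x = 0"
  "x > 2 \<Longrightarrow> (deriv ^^ k) (cut_power p) x = (deriv ^^ k) (\<lambda>x. x ^ p) x"
proof -
  assume "x < 1"
  then have "(deriv ^^ k) (cut_power p) x = (deriv ^^ k) (\<lambda>x. 0) x"
    by (intro higher_deriv_cong_open[of "{..<1}"]) (auto simp: cut_power_def smooth_step)
  then show "(deriv ^^ k) (cut_power p) x = 0" by (simp add: higher_deriv_zero)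
next
  assume "x > 2"
  then show "(deriv ^^ k) (cut_power p) x = (deriv ^^ k) (\<lambda>x. x ^ p) x"
    by (intro higher_deriv_cong_open[of "{2<..}"]) (auto simp: cut_power_def smooth_step)
qed

text \<open>A smooth version of x_+^p, 0 up to 1/(n+1) and exact from 2/(n+1) on. It is a rescaled
  \<open>cut_power\<close>, which reduces all estimates to one fixed function.\<close>

definition ramp :: "nat \<Rightarrow> nat \<Rightarrow> real \<Rightarrow> real" where
  "ramp p n x = x ^ p * smooth_step (real (Suc n) * x)"

lemma ramp_eq: "ramp p n x = (1 / real (Suc n) ^ p) * cut_power p (real (Suc n) * x + 0)"
  by (simp add: ramp_def cut_power_def power_mult_distrib del: of_nat_Suc)

lemma smooth_real_ramp: "smooth_real (ramp p n)"
  unfolding ramp_eq[abs_def] by (intro smooth_real_affine smooth_real_cut_power)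

lemma smooth_real_pow: "smooth_real (\<lambda>x. x ^ p)"
  by (intro smooth_real_power smooth_real_ident)

lemma bounded_smooth_real:
  assumes "smooth_real f" shows "\<exists>B. \<forall>x\<in>{a..b}. \<bar>f x\<bar> \<le> B"
proof -
  have "compact (f ` {a..b})" by (intro compact_continuous_image smooth_real_continuous assms compact_Icc)
  from compact_imp_bounded[OF this] show ?thesis unfolding bounded_iff by auto
qed

text \<open>With N = n + 1, the k-th derivatives of the ramp and of x_+^p are both N^(k-p) times a
  fixed function at N x. The two fixed functions differ by a bounded amount, so the error is
  O(N^(k-p)), hence O(1/N) because k < p.\<close>

lemma ramp_ulim:
  assumes "k < p"
  shows "bdd_ulim {0..1} (\<lambda>n. (deriv ^^ k) (ramp p n))"
proof -
  let ?P = "(deriv ^^ k) (\<lambda>x::real. x ^ p)"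
  let ?c = "(deriv ^^ k) (cut_power p)"
  define L where "L x = (if x > 0 then ?P x else 0)" for x :: real
  obtain B1 where "\<forall>x\<in>{0..2}. \<bar>?P x\<bar> \<le> B1"
    using bounded_smooth_real[OF smooth_real_higher_deriv[OF smooth_real_pow[of p], of k], of 0 2] by blast
  then have B1: "\<bar>?P x\<bar> \<le> B1" if "0 \<le> x" "x \<le> 2" for x using that by auto
  obtain B2 where "\<forall>x\<in>{0..2}. \<bar>?c x\<bar> \<le> B2"
    using bounded_smooth_real[OF smooth_real_higher_deriv[OF smooth_real_cut_power[of p], of k], of 0 2] by blast
  then have B2: "\<bar>?c x\<bar> \<le> B2" if "0 \<le> x" "x \<le> 2" for x using that by auto
  have B: "\<bar>?c x - L x\<bar> \<le> B1 + B2" for x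
  proof -
    consider "x \<le> 0" | "0 < x" "x \<le> 2" | "2 < x" by linarith
    then show ?thesis
    proof cases
      case 1 then show ?thesis using B1[of 0] B2[of 0] by (simp add: L_def cut_power_outside)
    next
      case 2 then show ?thesis using B1[of x] B2[of x] by (simp add: L_def)
    next
      case 3 then show ?thesis using B1[of 0] B2[of 0] by (simp add: L_def cut_power_outside)
    qed
  qed
  have dr: "(deriv ^^ k) (ramp p n) x = (1 / real (Suc n) ^ p) * real (Suc n) ^ k * ?c (real (Suc n) * x)" for n x
    using fun_cong[OF higher_deriv_affine[OF smooth_real_cut_power, of k "1 / real (Suc n) ^ p" p "real (Suc n)" 0], of x]
    unfolding ramp_eq[symmetric] by (simp del: of_nat_Suc)
  have dP: "?P x = (1 / real (Suc n) ^ p) * real (Suc n) ^ k * ?P (real (Suc n) * x)" for n x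
  proof -
    have "(\<lambda>x. (1 / real (Suc n) ^ p) * (real (Suc n) * x + 0) ^ p) = (\<lambda>x. x ^ p)"
      by (simp add: power_mult_distrib fun_eq_iff del: of_nat_Suc)
    then show ?thesis
      using fun_cong[OF higher_deriv_affine[OF smooth_real_pow[of p], of k "1 / real (Suc n) ^ p" "real (Suc n)" 0], of x]
      by (simp del: of_nat_Suc)
  qed
  have dL: "L x = (1 / real (Suc n) ^ p) * real (Suc n) ^ k * L (real (Suc n) * x)" for n x
    unfolding L_def using dP[of x n] by (simp add: zero_less_mult_iff del: of_nat_Suc)
  have est: "\<bar>(deriv ^^ k) (ramp p n) x - L x\<bar> \<le> (B1 + B2) * inverse (real (Suc n))" for n x
  proof -
    let ?N = "real (Suc n)"
    have "(deriv ^^ k) (ramp p n) x - L x = (1 / ?N ^ p) * ?N ^ k * (?c (?N * x) - L (?N * x))"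
      unfolding dr by (subst dL[of x n]) (simp add: algebra_simps del: of_nat_Suc)
    then have "\<bar>(deriv ^^ k) (ramp p n) x - L x\<bar> = (1 / ?N ^ p) * ?N ^ k * \<bar>?c (?N * x) - L (?N * x)\<bar>"
      by (simp add: abs_mult del: of_nat_Suc)
    also have "\<dots> \<le> inverse ?N * (B1 + B2)"
    proof (intro mult_mono B)
      have "?N ^ k * ?N \<le> ?N ^ p"
        using power_increasing[of "Suc k" p ?N] assms by (simp add: mult.commute del: of_nat_Suc)
      then show "1 / ?N ^ p * ?N ^ k \<le> inverse ?N" by (simp add: field_simps del: of_nat_Suc)
    qed auto
    finally show ?thesis by (simp add: mult.commute)
  qed
  have "(\<lambda>n. (B1 + B2) * inverse (real (Suc n))) \<longlonglongrightarrow> (B1 + B2) * 0"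
    by (intro tendsto_intros LIMSEQ_inverse_real_of_nat)
  then have "(\<lambda>n. (B1 + B2) * inverse (real (Suc n))) \<longlonglongrightarrow> 0" by simp
  have "uniform_limit {0..1} (\<lambda>n. (deriv ^^ k) (ramp p n)) L sequentially"
    unfolding uniform_limit_iff
  proof (intro allI impI)
    fix e :: real assume "e > 0"
    then have "\<forall>\<^sub>F n in sequentially. (B1 + B2) * inverse (real (Suc n)) < e"
      using order_tendstoD(2)[OF \<open>_ \<longlonglongrightarrow> 0\<close>] by blast
    then show "\<forall>\<^sub>F n in sequentially. \<forall>x\<in>{0..1}. dist ((deriv ^^ k) (ramp p n) x) (L x) < e"
      by eventually_elim (use est in \<open>auto simp: dist_real_def intro: order_le_less_trans\<close>)
  qed
  moreover have "bounded (L ` {0..1})"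
    unfolding bounded_iff using B1 order_trans[OF abs_ge_zero B1[of 0]] by (intro exI[of _ B1]) (auto simp: L_def)
  ultimately show ?thesis unfolding bdd_ulim_def by blast
qed

text \<open>A smooth version of x^p (1-x)^p on the unit interval, equal to 0 near both end points
  and outside.\<close>

definition bump :: "nat \<Rightarrow> nat \<Rightarrow> real \<Rightarrow> real" where
  "bump p n x = ramp p n x * ramp p n (1 - x)"

lemma smooth_real_ramp_flip: "smooth_real (\<lambda>x. ramp p n (1 - x))"
  using smooth_real_affine[OF smooth_real_ramp, of 1 p n "-1" 1] by simp

lemma smooth_real_bump: "smooth_real (bump p n)"
  unfolding bump_def[abs_def] by (intro smooth_real_mult smooth_real_ramp smooth_real_ramp_flip)

lemma bump_ulim:
  assumes "k < p" shows "bdd_ulim {0..1} (\<lambda>n. (deriv ^^ k) (bump p n))"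
proof -
  have 1: "derivs_ulim k (\<lambda>n. ramp p n)" unfolding derivs_ulim_iff using ramp_ulim assms by auto
  have "bdd_ulim {0..1} (\<lambda>n. (deriv ^^ l) (\<lambda>x. ramp p n (1 - x)))" if "l \<le> k" for l
  proof -
    have "(deriv ^^ l) (\<lambda>x. ramp p n (1 - x)) = (\<lambda>x. (-1) ^ l * (deriv ^^ l) (ramp p n) (1 - x))" for n
      using higher_deriv_affine[OF smooth_real_ramp, of l 1 p n "-1" 1] by simp
    moreover have "bdd_ulim {0..1} (\<lambda>n x. (-1) ^ l * (deriv ^^ l) (ramp p n) (1 - x))"
      using ramp_ulim[of l p] that assms
      by (intro bdd_ulim_mult bdd_ulim_const bdd_ulim_compose[where A="{0..1}" and h="\<lambda>x. 1 - x"]) auto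
    ultimately show ?thesis by simp
  qed
  then have 2: "derivs_ulim k (\<lambda>n x. ramp p n (1 - x))" unfolding derivs_ulim_iff by blast
  have "derivs_ulim k (\<lambda>n x. ramp p n x * ramp p n (1 - x))"
    by (intro derivs_ulim_mult smooth_real_ramp smooth_real_ramp_flip 1 2)
  then show ?thesis unfolding derivs_ulim_iff bump_def[abs_def] by blast
qed

lemma bump_nonzero:
  assumes "bump p n x \<noteq> 0" shows "inverse (real (Suc n)) < x" "x < 1"
proof -
  have "smooth_step (real (Suc n) * x) \<noteq> 0" "smooth_step (real (Suc n) * (1 - x)) \<noteq> 0"
    using assms unfolding bump_def ramp_def by auto
  then have "1 < real (Suc n) * x" "1 < real (Suc n) * (1 - x)"
    using smooth_step(2) by (meson not_le)+
  moreover have "0 < real (Suc n)" by simp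
  moreover have "0 < real (Suc n) * (1 - x)" using calculation(2) by linarith
  ultimately show "inverse (real (Suc n)) < x" "x < 1"
    by (simp_all add: inverse_eq_divide pos_divide_less_eq mult.commute zero_less_mult_iff del: of_nat_Suc)
qed

lemma bump_bounds:
  shows "0 \<le> bump p n x" "0 < x \<Longrightarrow> x < 1 \<Longrightarrow> bump p n x \<le> x ^ p * (1 - x) ^ p"
proof -
  have 1: "bump p n x = (x ^ p * (1 - x) ^ p) * (smooth_step (real (Suc n) * x) * smooth_step (real (Suc n) * (1 - x)))"
    by (simp add: bump_def ramp_def)
  show 2: "bump p n x \<le> x ^ p * (1 - x) ^ p" if "0 < x" "x < 1"
    unfolding 1 using that smooth_step(4,5) by (intro mult_left_le mult_le_one) auto
  show "0 \<le> bump p n x"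
  proof (cases "bump p n x = 0")
    case False
    then have "0 < x" "x < 1" using bump_nonzero[OF False] by (auto intro: less_trans[OF _ bump_nonzero(1)[OF False]])
    then show ?thesis unfolding 1 using smooth_step(4) by simp
  qed simp
qed

lemma ramp_tendsto: "(\<lambda>n. ramp p n x) \<longlonglongrightarrow> (if x > 0 then x ^ p else 0)"
proof (cases "x > 0")
  case True
  obtain m where m: "2 / x \<le> real m" using real_arch_simple by blast
  have "ramp p n x = x ^ p" if "n \<ge> m" for n
  proof -
    have "2 / x \<le> real (Suc n)" using m that by simp
    then have "2 \<le> real (Suc n) * x" using True by (simp add: field_simps del: of_nat_Suc)
    then show ?thesis by (simp add: ramp_def smooth_step del: of_nat_Suc)
  qed
  then have "\<forall>\<^sub>F n in sequentially. ramp p n x = x ^ p" using eventually_sequentially by blast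
  then show ?thesis using True by (simp add: tendsto_eventually)
next
  case False
  then have "real (Suc n) * x \<le> 1" for n
    by (meson mult_nonneg_nonpos not_le of_nat_0_le_iff order_trans zero_le_one)
  then have "ramp p n x = 0" for n by (simp add: ramp_def smooth_step del: of_nat_Suc)
  then show ?thesis using False by simp
qed

text \<open>The test functions that approximate the truncated polynomial G of the overview.\<close>

definition bump_kernel :: "nat \<Rightarrow> nat \<Rightarrow> real^'d::finite \<Rightarrow> complex" where
  "bump_kernel p n = prod_fun (\<lambda>_. bump p n)"

lemma kernel_nonzero: "bump_kernel p n x \<noteq> 0 \<Longrightarrow> inverse (real (Suc n)) < x $ j \<and> x $ j < 1"
  unfolding bump_kernel_def prod_fun_def using bump_nonzero[of p n "x $ j"] by auto

lemma test_fun_kernel: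
  "test_fun (bump_kernel p n :: real^'d::finite \<Rightarrow> complex)"
  "tsupp (bump_kernel p n :: real^'d::finite \<Rightarrow> complex) \<subseteq> cbox 0 1"
proof -
  have "x \<in> cbox 0 1" if "bump_kernel p n x \<noteq> 0" for x :: "real^'d"
  proof -
    have "0 \<le> x $ j \<and> x $ j \<le> 1" for j
      using kernel_nonzero[OF that, of j] positive_imp_inverse_positive[of "real (Suc n)"] by linarith
    then show ?thesis by (simp add: mem_box_cart)
  qed
  from test_funI[OF smooth_fun_prod_fun[OF smooth_real_bump, of "\<lambda>_. p" "\<lambda>_. n", folded bump_kernel_def] compact_cbox this]
  show "test_fun (bump_kernel p n :: real^'d \<Rightarrow> complex)" "tsupp (bump_kernel p n) \<subseteq> cbox (0::real^'d) 1" by blast+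
qed

text \<open>A mixed derivative of order at most \<open>M\<close> is a product of one-variable
  derivatives of order below \<open>p\<close>, which converge uniformly on [0,1]; off the unit cube
  everything is 0. The Cauchy form speaks of test functions only, whereas the limit G is merely of
  class C^(p-1).\<close>

lemma kernel_Cauchy:
  assumes M: "M < p" and e: "e > 0"
  shows "\<exists>m. \<forall>n\<ge>m. \<forall>l\<ge>m. cbound M (\<lambda>x::real^'d::finite. bump_kernel p n x - bump_kernel p l x) e"
proof -
  have it: "iter_partial js (bump_kernel p n) x = of_real (\<Prod>j\<in>UNIV. (deriv ^^ count_list js j) (bump p n) (x $ j))"
    for js n and x :: "real^'d"
    unfolding bump_kernel_def by (simp add: iter_partial_prod_fun smooth_real_bump) (simp add: prod_fun_def)
  have "\<exists>m. \<forall>n\<ge>m. \<forall>l\<ge>m. \<forall>x::real^'d. norm (iter_partial js (\<lambda>x. bump_kernel p n x - bump_kernel p l x) x) \<le> e"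
    if js: "length js \<le> M" for js :: "'d list"
  proof -
    have "bdd_ulim (cbox 0 1) (\<lambda>n x::real^'d. \<Prod>j\<in>UNIV. (deriv ^^ count_list js j) (bump p n) (x $ j))"
    proof (intro bdd_ulim_prod)
      fix j
      have "count_list js j < p" using count_le_length[of js j] js M by linarith
      then show "bdd_ulim (cbox 0 1) (\<lambda>n x::real^'d. (deriv ^^ count_list js j) (bump p n) (x $ j))"
        by (intro bdd_ulim_compose[where A="{0..1}" and h="\<lambda>x. x $ j"] bump_ulim) (auto simp: mem_box_cart)
    qed
    then obtain L where "uniform_limit (cbox 0 1) (\<lambda>n x::real^'d. \<Prod>j\<in>UNIV. (deriv ^^ count_list js j) (bump p n) (x $ j)) L sequentially"
      unfolding bdd_ulim_def by blast
    then obtain m where m: "\<And>n x. n \<ge> m \<Longrightarrow> x \<in> cbox 0 1 \<Longrightarrow>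
        dist (\<Prod>j\<in>UNIV. (deriv ^^ count_list js j) (bump p n) (x $ j)) (L x) < e / 2"
      unfolding uniform_limit_sequentially_iff using e by (meson half_gt_zero)
    have "norm (iter_partial js (\<lambda>x. bump_kernel p n x - bump_kernel p l x) x) \<le> e" if "n \<ge> m" "l \<ge> m" for n l x
    proof (cases "x \<in> cbox 0 (1::real^'d)")
      case True
      have "dist (\<Prod>j\<in>UNIV. (deriv ^^ count_list js j) (bump p n) (x $ j)) (\<Prod>j\<in>UNIV. (deriv ^^ count_list js j) (bump p l) (x $ j)) < e"
        using m[OF that(1) True] m[OF that(2) True] by (rule dist_triangle_half_l)
      then show ?thesis
        unfolding iter_partial_diff[OF test_funD(1)[OF test_fun_kernel(1)] test_funD(1)[OF test_fun_kernel(1)]] it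
        by (simp only: of_real_diff[symmetric] norm_of_real dist_real_def less_imp_le)
    next
      case False
      then have "iter_partial js (bump_kernel p n) x = 0" for n
        using test_fun_kernel(2) by (intro iter_partial_zero_outside) blast
      then show ?thesis
        unfolding iter_partial_diff[OF test_funD(1)[OF test_fun_kernel(1)] test_funD(1)[OF test_fun_kernel(1)]]
        using e by simp
    qed
    then show ?thesis by blast
  qed
  then obtain m where m: "\<And>js n l x. length js \<le> M \<Longrightarrow> n \<ge> m js \<Longrightarrow> l \<ge> m js \<Longrightarrow>
      norm (iter_partial (js::'d list) (\<lambda>x. bump_kernel p n x - bump_kernel p l x) x) \<le> e" by metis
  define m0 where "m0 = Max (m ` {js::'d list. length js \<le> M})"
  have "m js \<le> m0" if "length js \<le> M" for js
    unfolding m0_def using that finite_words[where 'd='d, of M] by (intro Max_ge) auto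
  then show ?thesis unfolding cbound_def using m by (meson order_trans)
qed

lemma kernel_cbound:
  assumes M: "M < p"
  shows "\<exists>B. \<forall>n. cbound M (bump_kernel p n :: real^'d::finite \<Rightarrow> complex) B"
proof -
  obtain m where m: "\<And>n. n \<ge> m \<Longrightarrow> cbound M (\<lambda>x::real^'d. bump_kernel p n x - bump_kernel p m x) 1"
    using kernel_Cauchy[OF M, of 1] by (metis order_refl zero_less_one)
  have "\<exists>B>0. cbound M (bump_kernel p n :: real^'d \<Rightarrow> complex) B" for n
    using cbound_exists[OF test_fun_kernel(1)] by metis
  then obtain B where B: "\<And>n. B n > 0" "\<And>n. cbound M (bump_kernel p n :: real^'d \<Rightarrow> complex) (B n)" by metis
  define C where "C = 1 + (\<Sum>n\<le>m. B n)"
  have BC: "B n + 1 \<le> C" if "n \<le> m" for n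
  proof -
    have "B n \<le> (\<Sum>n\<le>m. B n)" by (rule member_le_sum) (use that in \<open>auto intro: less_imp_le[OF B(1)]\<close>)
    then show ?thesis unfolding C_def by simp
  qed
  have "cbound M (bump_kernel p n :: real^'d \<Rightarrow> complex) C" for n
  proof (cases "n \<le> m")
    case True
    then show ?thesis using BC[OF True] by (intro cbound_mono[OF B(2)[of n]]) auto
  next
    case False
    show ?thesis unfolding cbound_def
    proof (intro allI impI)
      fix js :: "'d list" and x assume js: "length js \<le> M"
      have "norm (iter_partial js (bump_kernel p n) x - iter_partial js (bump_kernel p m) x) \<le> 1"
        using m[of n] False js unfolding cbound_def
          iter_partial_diff[OF test_funD(1)[OF test_fun_kernel(1)] test_funD(1)[OF test_fun_kernel(1)]] by auto
      moreover have "norm (iter_partial js (bump_kernel p m) x) \<le> B m" using B(2) js unfolding cbound_def by blast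
      ultimately show "norm (iter_partial js (bump_kernel p n) x) \<le> C"
        using BC[of m] norm_triangle_sub[of "iter_partial js (bump_kernel p n) x" "iter_partial js (bump_kernel p m) x"] by auto
    qed
  qed
  then show ?thesis by blast
qed

subsection \<open>Integration by parts\<close>

lemma integrable_continuous_compact_support:
  fixes f :: "'a::euclidean_space \<Rightarrow> 'b::euclidean_space"
  assumes "compact K" "continuous_on K f" "\<And>x. x \<notin> K \<Longrightarrow> f x = 0"
  shows "integrable lborel f"
proof -
  have "integrable lborel (\<lambda>x. indicator K x *\<^sub>R f x)"
    by (rule borel_integrable_compact[OF assms(1,2)])
  moreover have "(\<lambda>x. indicator K x *\<^sub>R f x) = f" using assms(3) by (auto simp: indicator_def fun_eq_iff)
  ultimately show ?thesis by simp
qed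

lemma integrable_test_fun: "test_fun f \<Longrightarrow> integrable lborel f"
  by (rule integrable_continuous_compact_support[of "tsupp f"])
     (auto intro: test_funD smooth_fun_continuous dest: tsupp_superset)

lemma integral_translation:
  fixes f :: "'a::euclidean_space \<Rightarrow> complex"
  shows "integral\<^sup>L lborel (\<lambda>x. f (x + c)) = integral\<^sup>L lborel f"
proof -
  show ?thesis
  proof (cases "f \<in> borel_measurable borel")
    case True
    then have "integral\<^sup>L (distr lborel borel ((+) c)) f = integral\<^sup>L lborel (\<lambda>x. f (c + x))"
      by (intro integral_distr) auto
    then show ?thesis unfolding lborel_distr_plus add.commute[of c] by simp
  next
    case False
    then have "\<not> integrable lborel f" by auto
    moreover have "\<not> integrable lborel (\<lambda>x. f (x + c))"
    proof
      assume "integrable lborel (\<lambda>x. f (x + c))"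
      then have "(\<lambda>x. f (x + c)) \<in> borel_measurable borel" by auto
      then have "(\<lambda>x. f (x + c)) \<circ> (\<lambda>x. x - c) \<in> borel_measurable borel"
        by (intro measurable_comp) auto
      then show False using False by (simp add: o_def)
    qed
    ultimately show ?thesis by (simp add: not_integrable_integral_eq)
  qed
qed

text \<open>The difference quotients in direction \<open>j\<close> have integral 0 by translation
  invariance and converge to the derivative. They are dominated by a bound of the derivative on a
  box enlarged by 1, because the increments are at most 1.\<close>

lemma integral_partial_eq_0:
  assumes f: "test_fun f" shows "integral\<^sup>L lborel (partial j f) = 0"
proof -
  let ?h = "\<lambda>n. inverse (real (Suc n))"
  let ?e = "axis j (1::real)"
  define D where "D n x = of_real (real (Suc n)) * (f (x + ?h n *\<^sub>R ?e) - f x)" for n x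
  note sm = test_funD(1)[OF f]
  have cf: "continuous_on UNIV f" "continuous_on UNIV (partial j f)"
    using sm by (auto intro: smooth_fun_continuous smooth_fun_partial)
  have mf: "f \<in> borel_measurable borel" "partial j f \<in> borel_measurable borel"
    using cf by (auto intro: borel_measurable_continuous_onI)
  obtain B where B: "\<And>x. norm (partial j f x) \<le> B" using test_fun_bounded[OF test_fun_partial[OF f]] by metis
  have B0: "0 \<le> B" using order_trans[OF norm_ge_zero B[of 0]] .
  obtain R where R: "R > 0" "\<And>x i. x \<in> tsupp f \<Longrightarrow> \<bar>x $ i\<bar> < R"
    using compact_abs_bound[OF test_funD(2)[OF f]] by metis
  let ?K = "cbox (\<chi> i. - (R + 1)) (\<chi> i. R + 1) :: (real^'a) set"
  have f0: "f (x + t *\<^sub>R ?e) = 0" if "x \<notin> ?K" "0 \<le> t" "t \<le> 1" for x t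
  proof (rule ccontr)
    assume "f (x + t *\<^sub>R ?e) \<noteq> 0"
    then have *: "\<bar>(x + t *\<^sub>R ?e) $ i\<bar> < R" for i using R(2) tsupp_superset[of f] by blast
    have b: "\<bar>x $ i\<bar> \<le> R + 1" for i using *[of i] that(2,3) by (auto simp: axis_def split: if_splits)
    have "- (R + 1) \<le> x $ i \<and> x $ i \<le> R + 1" for i using b[of i] by linarith
    then show False using that(1) by (simp add: mem_box_cart)
  qed
  have h: "0 < ?h n" "?h n \<le> 1" for n by (auto simp: inverse_le_1_iff)
  have Dn: "integral\<^sup>L lborel (D n) = 0" for n
  proof -
    have "integrable lborel (\<lambda>x. f (x + ?h n *\<^sub>R ?e))"
      using f0 h(1,2)[of n] less_imp_le
      by (intro integrable_continuous_compact_support[of ?K] continuous_on_compose2[OF cf(1)] continuous_intros) auto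
    then have "integral\<^sup>L lborel (D n) = of_real (real (Suc n)) *
        (integral\<^sup>L lborel (\<lambda>x. f (x + ?h n *\<^sub>R ?e)) - integral\<^sup>L lborel f)"
      unfolding D_def using integrable_test_fun[OF f] by simp
    then show ?thesis by (simp only: integral_translation) simp
  qed
  have "(\<lambda>n. integral\<^sup>L lborel (D n)) \<longlonglongrightarrow> integral\<^sup>L lborel (partial j f)"
  proof (rule integral_dominated_convergence[where w="\<lambda>x. indicator ?K x *\<^sub>R B"])
    show "partial j f \<in> borel_measurable lborel" using mf by simp
    show "D n \<in> borel_measurable lborel" for n
      unfolding D_def using borel_measurable_continuous_onI[OF cf(1)]
      by (intro borel_measurable_times borel_measurable_diff borel_measurable_const)
         (auto intro!: borel_measurable_continuous_onI continuous_on_compose2[OF cf(1)] continuous_intros)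
    show "integrable lborel (\<lambda>x. indicator ?K x *\<^sub>R B)"
      by (intro borel_integrable_compact) auto
    show "AE x in lborel. (\<lambda>n. D n x) \<longlonglongrightarrow> partial j f x"
    proof (rule AE_I2)
      fix x
      have "((\<lambda>t. f (x + t *\<^sub>R ?e)) has_vector_derivative partial j f x) (at 0)"
        by (rule has_partial[OF smooth_fun_differentiable[OF sm]])
      then have "((\<lambda>t. norm (f (x + t *\<^sub>R ?e) - f x - t *\<^sub>R partial j f x) / norm t) \<longlongrightarrow> 0) (at 0)"
        by (simp add: has_vector_derivative_def has_derivative_at)
      moreover have "norm (f (x + t *\<^sub>R ?e) - f x - t *\<^sub>R partial j f x) / norm t =
          norm ((f (x + t *\<^sub>R ?e) - f x) /\<^sub>R t - partial j f x)" if "t \<noteq> 0" for t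
      proof -
        have "(f (x + t *\<^sub>R ?e) - f x) /\<^sub>R t - partial j f x = (f (x + t *\<^sub>R ?e) - f x - t *\<^sub>R partial j f x) /\<^sub>R t"
          using that by (simp add: scaleR_diff_right)
        then show ?thesis by (simp add: divide_inverse mult.commute)
      qed
      then have "\<forall>\<^sub>F t in at 0. norm (f (x + t *\<^sub>R ?e) - f x - t *\<^sub>R partial j f x) / norm t =
          norm ((f (x + t *\<^sub>R ?e) - f x) /\<^sub>R t - partial j f x)"
        by (simp add: eventually_at_filter)
      ultimately have "((\<lambda>t. norm ((f (x + t *\<^sub>R ?e) - f x) /\<^sub>R t - partial j f x)) \<longlongrightarrow> 0) (at 0)"
        by (rule Lim_transform_eventually)
      then have "((\<lambda>t. (f (x + t *\<^sub>R ?e) - f x) /\<^sub>R t) \<longlongrightarrow> partial j f x) (at 0)"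
        by (rule LIM_zero_cancel[OF tendsto_norm_zero_cancel])
      moreover have "filterlim ?h (at 0) sequentially"
        using LIMSEQ_inverse_real_of_nat by (simp add: filterlim_at del: of_nat_Suc)
      ultimately have "(\<lambda>n. (f (x + ?h n *\<^sub>R ?e) - f x) /\<^sub>R ?h n) \<longlonglongrightarrow> partial j f x"
        by (rule filterlim_compose)
      then show "(\<lambda>n. D n x) \<longlonglongrightarrow> partial j f x"
        by (simp add: D_def scaleR_conv_of_real[where 'a=complex] del: of_nat_Suc)
    qed
    show "AE x in lborel. norm (D n x) \<le> indicator ?K x *\<^sub>R B" for n
    proof (rule AE_I2)
      fix x
      show "norm (D n x) \<le> indicator ?K x *\<^sub>R B"
      proof (cases "x \<in> ?K")
        case True
        have "((\<lambda>t. partial j f (x + t *\<^sub>R ?e)) has_integral f (x + ?h n *\<^sub>R ?e) - f (x + 0 *\<^sub>R ?e)) {0..?h n}"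
          using h(1)[of n] by (intro fundamental_theorem_of_calculus has_partial_at smooth_fun_differentiable sm) auto
        then have "((\<lambda>t. partial j f (x + t *\<^sub>R ?e)) has_integral f (x + ?h n *\<^sub>R ?e) - f x) (cbox 0 (?h n))" by simp
        then have "norm (f (x + ?h n *\<^sub>R ?e) - f x) \<le> B * measure lborel (cbox 0 (?h n))"
          by (rule has_integral_bound[OF B0]) (rule B)
        also have "\<dots> = B * ?h n" using h(1)[of n] by simp
        finally have "norm (D n x) \<le> real (Suc n) * (B * ?h n)"
          unfolding D_def norm_mult norm_of_real abs_of_nat by (intro mult_left_mono) auto
        moreover have "real (Suc n) * (B * ?h n) = B" by (simp add: divide_simps)
        ultimately show ?thesis using True by (simp del: of_nat_Suc)
      next
        case False
        then show ?thesis using f0[OF False, of "?h n"] f0[OF False, of 0] h[of n] by (simp add: D_def)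
      qed
    qed
  qed
  then show ?thesis unfolding Dn by (simp add: LIMSEQ_const_iff)
qed

text \<open>The transpose of theta_j - a with respect to dx is -(theta_j + a + 1), and this maps
  v^(-a-1) k(v) to -v^(-a) k'(v): one power of v is traded for one derivative of \<open>k\<close>.
  As \<open>k\<close> vanishes below 1, the quotients are smooth also at v = 0.\<close>

lemma integral_prod_fun_theta:
  assumes F: "test_fun F" and g: "\<And>j. smooth_real (g j)"
    and k: "smooth_real k" "\<And>v. v < 1 \<Longrightarrow> k v = 0" "g j = (\<lambda>v. k v / v ^ Suc a)"
  shows "(\<integral>x. prod_fun g x * (theta j F x - of_nat a * F x) \<partial>lborel) =
      - (\<integral>x. prod_fun (g(j := (\<lambda>v. deriv k v / v ^ a))) x * F x \<partial>lborel)"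
proof -
  let ?A = "prod_fun g"
  have sA: "smooth_fun ?A" by (rule smooth_fun_prod_fun[OF g])
  have sF: "smooth_fun F" by (rule test_funD[OF F])
  have AF: "test_fun (\<lambda>x. ?A x * F x)" by (rule test_fun_mult[OF sA F])
  have xAF: "test_fun (\<lambda>x. of_real (x $ j) * (?A x * F x))"
    by (rule test_fun_mult[OF smooth_fun_component(1) AF])
  note ds = smooth_fun_differentiable
  have p: "partial j (\<lambda>x. of_real (x $ j) * (?A x * F x)) =
      (\<lambda>x. ?A x * theta j F x + theta j ?A x * F x + ?A x * F x)"
    unfolding partial_mult(2)[OF ds[OF smooth_fun_component(1)] ds[OF smooth_fun_mult[OF sA sF]]]
      partial_mult(2)[OF ds[OF sA] ds[OF sF]] smooth_fun_component(2) theta_def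
    by (simp add: algebra_simps)
  have A': "theta j ?A x + of_nat (Suc a) * ?A x = prod_fun (g(j := (\<lambda>v. deriv k v / v ^ a))) x" for x
  proof -
    have split: "(\<Prod>i\<in>UNIV. h i (x $ i)) = h j (x $ j) * (\<Prod>i\<in>UNIV - {j}. h i (x $ i))" for h :: "'a \<Rightarrow> real \<Rightarrow> real"
      by (rule prod.remove) auto
    have upd: "prod_fun (g(j := h)) x = of_real (h (x $ j)) * of_real (\<Prod>i\<in>UNIV - {j}. g i (x $ i))" for h
    proof -
      have "(\<Prod>i\<in>UNIV - {j}. (g(j := h)) i (x $ i)) = (\<Prod>i\<in>UNIV - {j}. g i (x $ i))" by (intro prod.cong) auto
      then show ?thesis unfolding prod_fun_def split by simp
    qed
    have z: "\<exists>U. open U \<and> v \<in> U \<and> (\<forall>z\<in>U. k z = 0)" if "v = 0" for v :: real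
      using k(2) that by (intro exI[of _ "{..<1}"]) auto
    have dg: "deriv (g j) v = (deriv k v * v - real (Suc a) * k v) / v ^ Suc (Suc a)" for v
    proof -
      have "deriv (\<lambda>v. v) v = (1::real)" for v by (rule DERIV_imp_deriv) (auto intro!: derivative_eq_intros)
      then show ?thesis unfolding k(3)
        using DERIV_imp_deriv[OF smooth_real_divide(2)[OF k(1) smooth_real_ident z, of "Suc a" v]] by simp
    qed
    have "v * deriv (g j) v + real (Suc a) * g j v = deriv k v / v ^ a" for v
    proof (cases "v = 0")
      case True
      have "deriv k 0 = 0"
        using higher_deriv_cong_open[of "{..<1}" 0 k "\<lambda>_. 0" 1] k(2) by simp
      then show ?thesis using True k(2)[of 0] by (simp add: k(3))
    next
      case False
      then show ?thesis unfolding dg unfolding k(3) by (simp add: field_simps)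
    qed
    then have e: "complex_of_real (x $ j * deriv (g j) (x $ j)) + of_nat (Suc a) * of_real (g j (x $ j)) =
        of_real (deriv k (x $ j) / (x $ j) ^ a)"
      by (metis of_real_add of_real_mult of_real_of_nat_eq)
    have gj: "prod_fun g x = of_real (g j (x $ j)) * of_real (\<Prod>i\<in>UNIV - {j}. g i (x $ i))"
      using upd[of "g j"] by simp
    show ?thesis unfolding theta_prod_fun[OF g] upd gj e[symmetric] by (simp add: algebra_simps)
  qed
  have "?A x * (theta j F x - of_nat a * F x) =
      partial j (\<lambda>x. of_real (x $ j) * (?A x * F x)) x - prod_fun (g(j := (\<lambda>v. deriv k v / v ^ a))) x * F x" for x
    unfolding p A'[symmetric] by (simp add: algebra_simps)
  moreover have "test_fun (\<lambda>x. prod_fun (g(j := (\<lambda>v. deriv k v / v ^ a))) x * F x)"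
  proof -
    have "(\<lambda>x. prod_fun (g(j := (\<lambda>v. deriv k v / v ^ a))) x * F x) =
        (\<lambda>x. (of_real (x $ j) * partial j ?A x + of_nat (Suc a) * ?A x) * F x)"
      unfolding A'[symmetric] theta_def by simp
    then show ?thesis
      using test_fun_mult[OF smooth_fun_add[OF smooth_fun_mult[OF smooth_fun_component(1)[of j] smooth_fun_partial[OF sA, of j]] smooth_fun_cmult[OF sA, of "of_nat (Suc a)"]] F]
      by simp
  qed
  from Bochner_Integration.integral_diff[OF integrable_test_fun[OF test_fun_partial[OF xAF, of j]] integrable_test_fun[OF this]]
  have "(\<integral>x. partial j (\<lambda>x. of_real (x $ j) * (?A x * F x)) x - prod_fun (g(j := (\<lambda>v. deriv k v / v ^ a))) x * F x \<partial>lborel) =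
      - (\<integral>x. prod_fun (g(j := (\<lambda>v. deriv k v / v ^ a))) x * F x \<partial>lborel)"
    by (simp add: integral_partial_eq_0[OF xAF, of j])
  ultimately show ?thesis by simp
qed

text \<open>The pair \<open>(j, a)\<close> stands for the factor theta_j - a; the head of the list
  is applied last.\<close>

fun euler_op :: "('d::finite \<times> nat) list \<Rightarrow> (real^'d \<Rightarrow> complex) \<Rightarrow> real^'d \<Rightarrow> complex" where
  "euler_op [] F = F"
| "euler_op (p # l) F = (\<lambda>x. theta (fst p) (euler_op l F) x - of_nat (snd p) * euler_op l F x)"

lemma euler_op_append: "euler_op (l @ m) F = euler_op l (euler_op m F)"
  by (induction l) auto

lemma test_fun_euler_op: "test_fun F \<Longrightarrow> test_fun (euler_op l F)"
  by (induction l) (auto intro: test_fun_diff test_fun_theta test_fun_cmult)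

text \<open>The factors theta_j - a with p \<le> a < p + m. The list is reversed because the factor
  applied last is the first to be integrated by parts, and it has to match the highest power of
  1/v.\<close>

definition euler_block :: "nat \<Rightarrow> nat \<Rightarrow> 'd \<Rightarrow> ('d \<times> nat) list" where
  "euler_block p m j = map (Pair j) (rev [p..<p + m])"

lemma smooth_real_divide_power:
  assumes "smooth_real k" "\<And>v. v < 1 \<Longrightarrow> k v = 0" shows "smooth_real (\<lambda>v. k v / v ^ a)"
proof (rule smooth_real_divide(1)[OF assms(1) smooth_real_ident])
  show "\<exists>U. open U \<and> v \<in> U \<and> (\<forall>z\<in>U. k z = 0)" if "v = 0" for v :: real
    using assms(2) that by (intro exI[of _ "{..<1}"]) auto
qed

lemma higher_deriv_zero_below:
  assumes "\<And>v. v < 1 \<Longrightarrow> k v = (0::real)" "v < 1" shows "(deriv ^^ m) k v = 0"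
  using higher_deriv_cong_open[of "{..<1}" v k "\<lambda>_. 0" m] assms by (simp add: higher_deriv_zero)

lemma integral_euler_block:
  assumes F: "test_fun F" and g: "\<And>j. smooth_real (g j)"
    and k: "smooth_real k" "\<And>v. v < 1 \<Longrightarrow> k v = 0"
  shows "(\<integral>x. prod_fun (g(j := (\<lambda>v. k v / v ^ (p + m)))) x * euler_op (euler_block p m j) F x \<partial>lborel) =
      (-1) ^ m * (\<integral>x. prod_fun (g(j := (\<lambda>v. (deriv ^^ m) k v / v ^ p))) x * F x \<partial>lborel)"
  using k
proof (induction m arbitrary: k)
  case 0
  then show ?case by (simp add: euler_block_def)
next
  case (Suc m)
  let ?G = "g(j := (\<lambda>v. k v / v ^ (p + Suc m)))"
  let ?E = "euler_op (euler_block p m j) F"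
  have "(\<integral>x. prod_fun ?G x * euler_op (euler_block p (Suc m) j) F x \<partial>lborel) =
      (\<integral>x. prod_fun ?G x * (theta j ?E x - of_nat (p + m) * ?E x) \<partial>lborel)"
    by (simp add: euler_block_def)
  also have "\<dots> = - (\<integral>x. prod_fun (?G(j := (\<lambda>v. deriv k v / v ^ (p + m)))) x * ?E x \<partial>lborel)"
  proof (rule integral_prod_fun_theta[OF test_fun_euler_op[OF F] _ Suc(2,3)])
    show "smooth_real (?G i)" for i
      using g smooth_real_divide_power[OF Suc(2,3), where a="p + Suc m"]
      by (cases "i = j") (simp_all only: fun_upd_same fun_upd_other not_False_eq_True)
  qed auto
  also have "\<dots> = - ((-1) ^ m * (\<integral>x. prod_fun (g(j := (\<lambda>v. (deriv ^^ m) (deriv k) v / v ^ p))) x * F x \<partial>lborel))"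
  proof -
    have "deriv k v = 0" if "v < 1" for v using higher_deriv_zero_below[OF Suc(3) that, where m=1] by simp
    from Suc(1)[OF smooth_real_deriv[OF Suc(2)] this] show ?thesis by (simp only: fun_upd_upd)
  qed
  also have "\<dots> = (-1) ^ Suc m * (\<integral>x. prod_fun (g(j := (\<lambda>v. (deriv ^^ Suc m) k v / v ^ p))) x * F x \<partial>lborel)"
    unfolding funpow_Suc_right o_apply by (simp only: power_Suc mult_minus1 mult.assoc mult_minus_left mult_1_left)
  finally show ?case .
qed

definition euler_total :: "nat \<Rightarrow> nat \<Rightarrow> 'd list \<Rightarrow> ('d \<times> nat) list" where
  "euler_total p m js = concat (map (euler_block p m) js)"

text \<open>Integration by parts treats one coordinate at a time. The mixed weight records the
  state: coordinates outside \<open>js\<close> have already exchanged their \<open>m\<close> powers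
  for derivatives.\<close>

lemma integral_euler_total:
  fixes F :: "real^'d::finite \<Rightarrow> complex"
  assumes F: "test_fun F" and k: "smooth_real k" "\<And>v. v < 1 \<Longrightarrow> k v = 0" and js: "distinct js"
  shows "(\<integral>x. prod_fun (\<lambda>i. if i \<in> set js then (\<lambda>v. k v / v ^ (p + m)) else (\<lambda>v. (deriv ^^ m) k v / v ^ p)) x
        * euler_op (euler_total p m js) F x \<partial>lborel) =
      (-1) ^ (m * length js) * (\<integral>x. prod_fun (\<lambda>_ v. (deriv ^^ m) k v / v ^ p) x * F x \<partial>lborel)"
  using js
proof (induction js)
  case Nil
  then show ?case by (simp add: euler_total_def)
next
  case (Cons j js)
  let ?a = "\<lambda>v. k v / v ^ (p + m)" and ?b = "\<lambda>v. (deriv ^^ m) k v / v ^ p"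
  let ?g = "\<lambda>js i. if i \<in> set js then ?a else ?b"
  have sab: "smooth_real ?a" "smooth_real ?b"
    using k higher_deriv_zero_below[OF k(2)] by (auto intro!: smooth_real_divide_power smooth_real_higher_deriv)
  have "?g (j # js) = (?g js)(j := ?a)" "(?g js)(j := ?b) = ?g js" using Cons(2) by (auto simp: fun_eq_iff)
  moreover have "euler_op (euler_total p m (j # js)) F = euler_op (euler_block p m j) (euler_op (euler_total p m js) F)"
    by (simp add: euler_total_def euler_op_append)
  moreover have "smooth_real (?g js i)" for i using sab by simp
  note integral_euler_block[OF test_fun_euler_op[OF F, of "euler_total p m js"] this k, where j=j and p=p and m=m]
  ultimately show ?case using Cons by (simp add: power_add mult.assoc)
qed

section \<open>Product integrals and the smoothed point mass at 1\<close>

lemma integral_prod_lborel: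
  fixes f :: "real \<Rightarrow> real"
  assumes f: "integrable lborel f"
  shows "(\<integral>x. (\<Prod>j\<in>UNIV. f (x $ j)) \<partial>(lborel :: (real^'d::finite) measure)) = (\<integral>s. f s \<partial>lborel) ^ CARD('d)"
proof -
  interpret product_sigma_finite "\<lambda>_::real^'d. lborel :: real measure" by standard
  let ?S = "\<lambda>g :: real^'d \<Rightarrow> real. \<Sum>b\<in>Basis. g b *\<^sub>R b"
  have m: "f \<in> borel_measurable borel" using f by auto
  have B: "Basis = range (\<lambda>j. axis j (1::real) :: real^'d)" by (auto simp: Basis_vec_def)
  have inj: "inj (\<lambda>j. axis j (1::real) :: real^'d)" by (auto simp: inj_on_def axis_eq_axis)
  have S: "?S g $ j = g (axis j 1)" for g j
  proof -
    have "?S g $ j = (\<Sum>i\<in>UNIV. g (axis i 1) * axis i 1 $ j)"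
      unfolding B by (simp add: sum.reindex[OF inj])
    also have "\<dots> = (\<Sum>i\<in>UNIV. if i = j then g (axis i 1) else 0)"
      by (intro sum.cong) (auto simp: axis_def)
    finally show ?thesis by simp
  qed
  have "(\<integral>x. (\<Prod>j\<in>UNIV. f (x $ j)) \<partial>(lborel :: (real^'d) measure)) =
      (\<integral>g. (\<Prod>j\<in>UNIV. f (?S g $ j)) \<partial>(\<Pi>\<^sub>M b\<in>Basis. lborel))"
    unfolding lborel_eq[where 'a="real^'d"]
  proof (rule integral_distr)
    show "?S \<in> measurable (\<Pi>\<^sub>M b\<in>Basis. lborel) borel" by measurable
    have "(\<lambda>x::real^'d. f (x $ j)) \<in> borel_measurable borel" for j
      by (rule measurable_compose[OF _ m]) (intro borel_measurable_continuous_onI continuous_intros)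
    then show "(\<lambda>x::real^'d. \<Prod>j\<in>UNIV. f (x $ j)) \<in> borel_measurable borel" by (intro borel_measurable_prod)
  qed
  also have "\<dots> = (\<integral>g. (\<Prod>b\<in>Basis. f (g b)) \<partial>(\<Pi>\<^sub>M b\<in>(Basis :: (real^'d) set). lborel))"
    unfolding S unfolding B by (simp add: prod.reindex[OF inj])
  also have "\<dots> = (\<Prod>b\<in>(Basis :: (real^'d) set). \<integral>s. f s \<partial>lborel)"
    by (rule product_integral_prod) (auto intro: f)
  finally show ?thesis by simp
qed

lemma higher_deriv_power_same: "(deriv ^^ p) (\<lambda>x::real. c * x ^ p) = (\<lambda>x. c * fact p)"
proof (induction p arbitrary: c)
  case (Suc p)
  have "deriv (\<lambda>x. c * x ^ Suc p) = (\<lambda>x. (c * real (Suc p)) * x ^ p)"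
    using DERIV_imp_deriv[OF DERIV_cmult[OF DERIV_pow[of "Suc p"]]] by (simp add: mult.assoc fun_eq_iff)
  then show ?case unfolding funpow_Suc_right o_apply by (simp only: Suc) (simp add: mult.assoc)
qed simp

text \<open>\<open>cut_power p\<close> smooths x_+^p, whose (p+1)-st derivative is p! times the
  point mass at 0. Accordingly this function lives on [1, 2] and has integral p!, the total increase
  of the \<open>p\<close>-th derivative.\<close>

definition cut_power_top :: "nat \<Rightarrow> real \<Rightarrow> real" where
  "cut_power_top p = (deriv ^^ Suc p) (cut_power p)"

lemma cut_power_top:
  shows smooth_real_cut_power_top: "smooth_real (cut_power_top p)"
    and cut_power_top_outside: "x < 1 \<or> x > 2 \<Longrightarrow> cut_power_top p x = 0"
    and integrable_cut_power_top: "integrable lborel (cut_power_top p)"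
    and integral_cut_power_top: "(\<integral>x. cut_power_top p x \<partial>lborel) = fact p"
proof -
  show s: "smooth_real (cut_power_top p)" unfolding cut_power_top_def by (intro smooth_real_higher_deriv smooth_real_cut_power)
  have top: "(deriv ^^ p) (\<lambda>x::real. x ^ p) = (\<lambda>x. fact p)" using higher_deriv_power_same[of p 1] by simp
  show o: "cut_power_top p x = 0" if "x < 1 \<or> x > 2" for x
  proof -
    have "deriv (\<lambda>x::real. fact p :: real) x = 0" by simp
    then show ?thesis using that cut_power_outside[of x "Suc p" p] unfolding cut_power_top_def by (auto simp: top)
  qed
  show i: "integrable lborel (cut_power_top p)"
    by (rule integrable_continuous_compact_support[of "{1..2}"]) (auto intro: smooth_real_continuous s o)
  have "(cut_power_top p has_integral (deriv ^^ p) (cut_power p) 3 - (deriv ^^ p) (cut_power p) 0) {0..3}"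
    using smooth_real_has_derivative[OF smooth_real_higher_deriv[OF smooth_real_cut_power, of p p]]
    by (intro fundamental_theorem_of_calculus)
       (auto simp: cut_power_top_def has_real_derivative_iff_has_vector_derivative[symmetric] intro: has_field_derivative_at_within)
  then have "(cut_power_top p has_integral fact p) {0..3}" by (simp add: cut_power_outside top)
  moreover have "(cut_power_top p has_integral integral\<^sup>L lborel (cut_power_top p)) UNIV"
    by (rule has_integral_integral_lborel[OF i])
  then have "(cut_power_top p has_integral integral\<^sup>L lborel (cut_power_top p)) {0..3}"
    by (subst has_integral_restrict_UNIV[symmetric], rule has_integral_eq[rotated]) (use o in auto)
  ultimately show "(\<integral>x. cut_power_top p x \<partial>lborel) = fact p" by (rule has_integral_unique[symmetric])
qed

lemma integral_affine_vec:
  fixes f :: "real^'d::finite \<Rightarrow> complex"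
  assumes f: "f \<in> borel_measurable borel" and c: "c > 0"
  shows "integral\<^sup>L lborel f = c ^ CARD('d) *\<^sub>R (\<integral>s. f (t + c *\<^sub>R s) \<partial>lborel)"
proof -
  have "integral\<^sup>L lborel f = integral\<^sup>L (density (distr lborel borel (\<lambda>x. t + c *\<^sub>R x)) (\<lambda>_. \<bar>c\<bar> ^ DIM(real^'d))) f"
    using lborel_affine[of c t] c by simp
  also have "\<dots> = integral\<^sup>L (distr lborel borel (\<lambda>x. t + c *\<^sub>R x)) (\<lambda>x. (\<bar>c\<bar> ^ DIM(real^'d)) *\<^sub>R f x)"
    using f by (intro integral_density) auto
  also have "\<dots> = (\<integral>s. (\<bar>c\<bar> ^ DIM(real^'d)) *\<^sub>R f (t + c *\<^sub>R s) \<partial>lborel)"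
    using f by (intro integral_distr) auto
  finally show ?thesis using c by simp
qed

text \<open>Scaling with N = n + 1 leaves N^(-p) N^(p+1) = N in front, as for a mollifier
  concentrating at v = 1.\<close>

lemma ramp_shift_deriv:
  "(deriv ^^ Suc p) (\<lambda>v. ramp p n (v - 1)) v = real (Suc n) * cut_power_top p (real (Suc n) * (v - 1))"
proof -
  let ?N = "real (Suc n)"
  have "(\<lambda>v. ramp p n (v - 1)) = (\<lambda>v. (1 / ?N ^ p) * cut_power p (?N * v + (- ?N)))"
    unfolding ramp_eq by (simp add: algebra_simps del: of_nat_Suc)
  then have "(deriv ^^ Suc p) (\<lambda>v. ramp p n (v - 1)) v = (1 / ?N ^ p) * ?N ^ Suc p * cut_power_top p (?N * v + (- ?N))"
    using fun_cong[OF higher_deriv_affine[OF smooth_real_cut_power, of "Suc p" "1 / ?N ^ p" p ?N "- ?N"], of v]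
    by (simp only: cut_power_top_def)
  then show ?thesis by (simp add: algebra_simps del: of_nat_Suc)
qed

lemma ramp_shift:
  "smooth_real (\<lambda>v. ramp p n (v - 1))" "v < 1 \<Longrightarrow> ramp p n (v - 1) = 0"
  "1 \<le> v \<Longrightarrow> 0 \<le> ramp p n (v - 1)" "1 \<le> v \<Longrightarrow> ramp p n (v - 1) \<le> (v - 1) ^ p"
proof -
  show "smooth_real (\<lambda>v. ramp p n (v - 1))" using smooth_real_affine[OF smooth_real_ramp, of 1 p n 1 "-1"] by simp
  have "real (Suc n) * (v - 1) \<le> 1" if "v \<le> 1"
    using mult_nonneg_nonpos[of "real (Suc n)" "v - 1"] that by linarith
  then show "v < 1 \<Longrightarrow> ramp p n (v - 1) = 0"
    by (auto simp: ramp_def smooth_step del: of_nat_Suc)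
  show "1 \<le> v \<Longrightarrow> 0 \<le> ramp p n (v - 1)" by (simp add: ramp_def smooth_step)
  show "1 \<le> v \<Longrightarrow> ramp p n (v - 1) \<le> (v - 1) ^ p"
    unfolding ramp_def by (intro mult_left_le smooth_step) auto
qed

text \<open>With \<open>u = 1 / v\<close> this is \<open>u * (u\<^sup>p (1 - u)\<^sup>p)\<close>, the density of \<open>G\<close> with respect to \<open>dv\<close> in
  \<open>G(u) du / u\<close>.\<close>

definition weight :: "nat \<Rightarrow> real \<Rightarrow> real" where
  "weight p v = (if v > 1 then (v - 1) ^ p / v ^ (p + Suc p) else 0)"

lemma weight_bounds: "0 \<le> weight p v" "weight p v \<le> 1"
proof -
  show "0 \<le> weight p v" by (simp add: weight_def)
  show "weight p v \<le> 1"
  proof (cases "v > 1")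
    case True
    have "(v - 1) ^ p \<le> v ^ p" using True by (intro power_mono) auto
    also have "\<dots> \<le> v ^ (p + Suc p)" using True by (intro power_increasing) auto
    finally show ?thesis using True by (simp add: weight_def divide_le_eq_1 del: power_Suc)
  qed (simp add: weight_def)
qed

section \<open>Limits of weighted integrals and the value at 1\<close>

lemma tendsto_prod_fun:
  assumes "\<And>j. (\<lambda>n. g n j (x $ j)) \<longlonglongrightarrow> h j (x $ j)"
  shows "(\<lambda>n. prod_fun (g n) x) \<longlonglongrightarrow> prod_fun h x"
  unfolding prod_fun_def by (intro tendsto_of_real tendsto_prod assms)

lemma norm_prod_fun_le_1:
  assumes "\<And>j. 0 \<le> g j (x $ j)" "\<And>j. g j (x $ j) \<le> 1" shows "norm (prod_fun g x) \<le> 1"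
proof -
  have "0 \<le> (\<Prod>j\<in>UNIV. g j (x $ j))" "(\<Prod>j\<in>UNIV. g j (x $ j)) \<le> 1"
    using assms by (auto intro!: prod_nonneg prod_le_1)
  then show ?thesis unfolding prod_fun_def norm_of_real by simp
qed

lemma measurable_prod_fun:
  assumes "\<And>j. g j \<in> borel_measurable borel" shows "prod_fun g \<in> borel_measurable borel"
proof -
  have "(\<lambda>x. g j (x $ j)) \<in> borel_measurable borel" for j
    by (rule measurable_compose[OF _ assms]) (intro borel_measurable_continuous_onI continuous_intros)
  then have "(\<lambda>x. \<Prod>j\<in>UNIV. g j (x $ j)) \<in> borel_measurable borel" by (intro borel_measurable_prod)
  then show ?thesis unfolding prod_fun_def[abs_def] by measurable
qed

lemma integral_prod_fun_dominated:
  fixes F :: "real^'d::finite \<Rightarrow> complex"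
  assumes F: "integrable lborel F"
    and m: "\<And>n j. g n j \<in> borel_measurable borel" "\<And>j. h j \<in> borel_measurable borel"
    and lim: "\<And>j v. (\<lambda>n. g n j v) \<longlonglongrightarrow> h j v"
    and b: "\<And>n j v. 0 \<le> g n j v" "\<And>n j v. g n j v \<le> 1"
  shows "(\<lambda>n. \<integral>x. prod_fun (g n) x * F x \<partial>lborel) \<longlonglongrightarrow> (\<integral>x. prod_fun h x * F x \<partial>lborel)"
proof (rule integral_dominated_convergence[where w="\<lambda>x. norm (F x)"])
  have F': "F \<in> borel_measurable borel" using F by auto
  show "(\<lambda>x. prod_fun h x * F x) \<in> borel_measurable lborel"
    using measurable_prod_fun[of h] m F' by simp
  show "(\<lambda>x. prod_fun (g n) x * F x) \<in> borel_measurable lborel" for n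
    using measurable_prod_fun[of "g n"] m F' by simp
  show "integrable lborel (\<lambda>x. norm (F x))" using F by simp
  show "AE x in lborel. (\<lambda>n. prod_fun (g n) x * F x) \<longlonglongrightarrow> prod_fun h x * F x"
    by (intro AE_I2 tendsto_mult tendsto_const tendsto_prod_fun lim)
  show "AE x in lborel. norm (prod_fun (g n) x * F x) \<le> norm (F x)" for n
    using norm_prod_fun_le_1[of "g n"] b by (intro AE_I2) (simp add: norm_mult mult_left_le_one_le)
qed

lemma shifted_ramp_weight_tendsto: "(\<lambda>n. ramp p n (v - 1) / v ^ (p + Suc p)) \<longlonglongrightarrow> weight p v"
proof -
  have "(\<lambda>n. ramp p n (v - 1) / v ^ (p + Suc p)) \<longlonglongrightarrow> (if v - 1 > 0 then (v - 1) ^ p else 0) / v ^ (p + Suc p)"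
    unfolding divide_inverse by (intro tendsto_intros ramp_tendsto)
  moreover have "(if v - 1 > 0 then (v - 1) ^ p else 0) / v ^ (p + Suc p) = weight p v" by (simp add: weight_def)
  ultimately show ?thesis by metis
qed

text \<open>Substituting x = 1 + s/N cancels the factor N^d of the differentiated ramps and moves
  their support to the fixed cube [1,2]^d. There v^(-p) tends to 1 and F to F(1), and the remaining
  integral is (p!)^d.\<close>

lemma approximate_identity:
  fixes F :: "real^'d::finite \<Rightarrow> complex"
  assumes F: "test_fun F"
  shows "(\<lambda>n. \<integral>x. prod_fun (\<lambda>_ v. (deriv ^^ Suc p) (\<lambda>v. ramp p n (v - 1)) v / v ^ p) x * F x \<partial>lborel)
      \<longlonglongrightarrow> of_real (fact p ^ CARD('d)) * F 1"
proof -
  let ?N = "\<lambda>n. real (Suc n)"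
  let ?h = "\<lambda>n. inverse (real (Suc n))"
  let ?G = "\<lambda>n. prod_fun (\<lambda>(_::'d) v. (deriv ^^ Suc p) (\<lambda>v. ramp p n (v - 1)) v / v ^ p)"
  define S where "S n s = prod_fun (\<lambda>_ s. cut_power_top p s / (1 + ?h n * s) ^ p) s * F (1 + ?h n *\<^sub>R s)" for n and s :: "real^'d"
  have cF: "continuous_on UNIV F" by (intro smooth_fun_continuous test_funD F)
  have mm: "cut_power_top p \<in> borel_measurable borel" using integrable_cut_power_top by auto
  have G: "?G n (1 + ?h n *\<^sub>R s) = of_real (?N n ^ CARD('d)) * prod_fun (\<lambda>_ s. cut_power_top p s / (1 + ?h n * s) ^ p) s" for n s
  proof -
    have "(\<Prod>j\<in>UNIV. (deriv ^^ Suc p) (\<lambda>v. ramp p n (v - 1)) ((1 + ?h n *\<^sub>R s) $ j) / ((1 + ?h n *\<^sub>R s) $ j) ^ p) =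
        (\<Prod>j\<in>(UNIV::'d set). ?N n * (cut_power_top p (s $ j) / (1 + ?h n * s $ j) ^ p))"
    proof (intro prod.cong refl)
      fix j :: 'd
      have "(1 + ?h n *\<^sub>R s) $ j = 1 + ?h n * s $ j" by simp
      moreover have "?N n * (1 + ?h n * s $ j - 1) = s $ j" by (simp del: of_nat_Suc)
      ultimately show "(deriv ^^ Suc p) (\<lambda>v. ramp p n (v - 1)) ((1 + ?h n *\<^sub>R s) $ j) / ((1 + ?h n *\<^sub>R s) $ j) ^ p =
          ?N n * (cut_power_top p (s $ j) / (1 + ?h n * s $ j) ^ p)"
        unfolding ramp_shift_deriv by (simp only: times_divide_eq_right)
    qed
    also have "\<dots> = ?N n ^ CARD('d) * (\<Prod>j\<in>UNIV. cut_power_top p (s $ j) / (1 + ?h n * s $ j) ^ p)"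
      by (simp only: prod.distrib prod_constant)
    finally show ?thesis unfolding prod_fun_def by (simp only: of_real_mult)
  qed
  have mG: "(\<lambda>x. ?G n x * F x) \<in> borel_measurable borel" for n
  proof -
    have "(\<lambda>v. (deriv ^^ Suc p) (\<lambda>v. ramp p n (v - 1)) v / v ^ p) \<in> borel_measurable borel"
      unfolding ramp_shift_deriv using mm by measurable
    then show ?thesis using measurable_prod_fun[of "\<lambda>(_::'d) v. (deriv ^^ Suc p) (\<lambda>v. ramp p n (v - 1)) v / v ^ p"]
        borel_measurable_continuous_onI[OF cF] by (intro borel_measurable_times) auto
  qed
  have eq: "(\<integral>x. ?G n x * F x \<partial>lborel) = integral\<^sup>L lborel (S n)" for n
  proof -
    have "(\<integral>x. ?G n x * F x \<partial>lborel) = ?h n ^ CARD('d) *\<^sub>R (\<integral>s. ?G n (1 + ?h n *\<^sub>R s) * F (1 + ?h n *\<^sub>R s) \<partial>lborel)"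
      by (rule integral_affine_vec[OF mG]) (simp only: inverse_positive_iff_positive of_nat_0_less_iff zero_less_Suc)
    also have "\<dots> = (\<integral>s. ?h n ^ CARD('d) *\<^sub>R (?G n (1 + ?h n *\<^sub>R s) * F (1 + ?h n *\<^sub>R s)) \<partial>lborel)"
      by (rule integral_scaleR_right[symmetric])
    also have "\<dots> = integral\<^sup>L lborel (S n)"
    proof (rule Bochner_Integration.integral_cong[OF refl])
      fix s :: "real^'d"
      have "?h n ^ CARD('d) * ?N n ^ CARD('d) = 1" unfolding power_mult_distrib[symmetric] by simp
      then have "complex_of_real (?h n ^ CARD('d)) * of_real (?N n ^ CARD('d)) = 1"
        by (simp only: of_real_mult[symmetric] of_real_1)
      then show "?h n ^ CARD('d) *\<^sub>R (?G n (1 + ?h n *\<^sub>R s) * F (1 + ?h n *\<^sub>R s)) = S n s"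
        unfolding G S_def scaleR_conv_of_real[where 'a=complex] by (simp only: mult.assoc[symmetric] mult_1)
    qed
    finally show ?thesis .
  qed
  obtain B where B: "\<And>x. norm (F x) \<le> B" using test_fun_bounded[OF F] by metis
  have B0: "0 \<le> B" using order_trans[OF norm_ge_zero B[of 0]] .
  obtain D where "\<forall>x\<in>{0..3}. \<bar>cut_power_top p x\<bar> \<le> D" using bounded_smooth_real[OF smooth_real_cut_power_top, of 0 3 p] by blast
  then have D: "\<bar>cut_power_top p x\<bar> \<le> max D 1" for x
    using cut_power_top_outside[of x p] by (cases "x < 1 \<or> x > 2") (auto simp: le_max_iff_disj)
  let ?K = "cbox 1 (2::real^'d)"
  have "(\<lambda>n. integral\<^sup>L lborel (S n)) \<longlonglongrightarrow> (\<integral>s. prod_fun (\<lambda>(_::'d). cut_power_top p) s * F 1 \<partial>lborel)"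
  proof (rule integral_dominated_convergence[where w="\<lambda>s. indicator ?K s *\<^sub>R (max D 1 ^ CARD('d) * B)"])
    show "(\<lambda>s::real^'d. prod_fun (\<lambda>_. cut_power_top p) s * F 1) \<in> borel_measurable lborel"
    proof -
      have "prod_fun (\<lambda>_::'d. cut_power_top p) \<in> borel_measurable lborel"
        using measurable_prod_fun[of "\<lambda>_::'d. cut_power_top p"] mm by simp
      then show ?thesis by (intro borel_measurable_times borel_measurable_const)
    qed
    show "S n \<in> borel_measurable lborel" for n
    proof -
      have "(\<lambda>s. F (1 + ?h n *\<^sub>R s)) \<in> borel_measurable borel"
        by (intro borel_measurable_continuous_onI continuous_on_compose2[OF cF] continuous_intros) auto
      moreover have "(\<lambda>s. cut_power_top p s / (1 + ?h n * s) ^ p) \<in> borel_measurable borel" using mm by measurable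
      ultimately show ?thesis
        unfolding S_def using measurable_prod_fun[of "\<lambda>(_::'d) s. cut_power_top p s / (1 + ?h n * s) ^ p"] by simp
    qed
    show "integrable lborel (\<lambda>s. indicator ?K s *\<^sub>R (max D 1 ^ CARD('d) * B))"
      by (intro borel_integrable_compact) auto
    show "AE s in lborel. (\<lambda>n. S n s) \<longlonglongrightarrow> prod_fun (\<lambda>_. cut_power_top p) s * F 1"
    proof (rule AE_I2)
      fix s :: "real^'d"
      have h0: "?h \<longlonglongrightarrow> 0" by (rule LIMSEQ_inverse_real_of_nat)
      have "(\<lambda>n. cut_power_top p v / (1 + ?h n * v) ^ p) \<longlonglongrightarrow> cut_power_top p v / (1 + 0 * v) ^ p" for v
        by (intro tendsto_intros h0) auto
      then have "(\<lambda>n. prod_fun (\<lambda>_ s. cut_power_top p s / (1 + ?h n * s) ^ p) s) \<longlonglongrightarrow> prod_fun (\<lambda>_. cut_power_top p) s"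
        by (intro tendsto_prod_fun) simp
      moreover have "(\<lambda>n. 1 + ?h n *\<^sub>R s) \<longlonglongrightarrow> 1 + 0 *\<^sub>R s" by (intro tendsto_intros h0)
      then have "(\<lambda>n. F (1 + ?h n *\<^sub>R s)) \<longlonglongrightarrow> F 1"
        using continuous_on_tendsto_compose[OF cF, of "\<lambda>n. 1 + ?h n *\<^sub>R s" "1 + 0 *\<^sub>R s"] by simp
      ultimately show "(\<lambda>n. S n s) \<longlonglongrightarrow> prod_fun (\<lambda>_. cut_power_top p) s * F 1"
        unfolding S_def by (rule tendsto_mult)
    qed
    show "AE s in lborel. norm (S n s) \<le> indicator ?K s *\<^sub>R (max D 1 ^ CARD('d) * B)" for n
    proof (rule AE_I2)
      fix s :: "real^'d"
      show "norm (S n s) \<le> indicator ?K s *\<^sub>R (max D 1 ^ CARD('d) * B)"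
      proof (cases "s \<in> ?K")
        case True
        then have s: "1 \<le> s $ j" for j by (simp add: mem_box_cart)
        have "\<bar>cut_power_top p (s $ j) / (1 + ?h n * s $ j) ^ p\<bar> \<le> max D 1" for j
        proof -
          have "0 \<le> ?h n * s $ j" using s[of j] by (intro mult_nonneg_nonneg) auto
          then have "1 \<le> (1 + ?h n * s $ j) ^ p" by (intro one_le_power) auto
          then have "\<bar>cut_power_top p (s $ j)\<bar> / (1 + ?h n * s $ j) ^ p \<le> \<bar>cut_power_top p (s $ j)\<bar> / 1"
            by (intro divide_left_mono) auto
          then show ?thesis using D[of "s $ j"] \<open>1 \<le> (1 + ?h n * s $ j) ^ p\<close> by (simp add: abs_divide)
        qed
        then have "(\<Prod>j\<in>UNIV. \<bar>cut_power_top p (s $ j) / (1 + ?h n * s $ j) ^ p\<bar>) \<le> (\<Prod>j\<in>(UNIV::'d set). max D 1)"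
          by (intro prod_mono) auto
        then have "norm (prod_fun (\<lambda>_ s. cut_power_top p s / (1 + ?h n * s) ^ p) s) \<le> max D 1 ^ CARD('d)"
          unfolding prod_fun_def norm_of_real abs_prod by simp
        then show ?thesis using True B[of "1 + ?h n *\<^sub>R s"]
          unfolding S_def norm_mult by (auto intro!: mult_mono)
      next
        case False
        then obtain j where "s $ j < 1 \<or> s $ j > 2" by (auto simp: mem_box_cart not_le)
        then have "cut_power_top p (s $ j) = 0" by (rule cut_power_top_outside)
        then have "(\<Prod>j\<in>UNIV. cut_power_top p (s $ j) / (1 + ?h n * s $ j) ^ p) = 0"
          by (intro prod_zero) (auto intro!: bexI[of _ j])
        then show ?thesis using False by (simp add: S_def prod_fun_def del: of_real_prod of_nat_Suc)
      qed
    qed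
  qed
  moreover have "(\<integral>s. prod_fun (\<lambda>(_::'d). cut_power_top p) s * F 1 \<partial>lborel) = of_real (fact p ^ CARD('d)) * F 1"
  proof -
    have "(\<integral>s. prod_fun (\<lambda>(_::'d). cut_power_top p) s \<partial>lborel) = of_real (\<integral>s. (\<Prod>j\<in>UNIV. cut_power_top p (s $ j)) \<partial>(lborel::(real^'d) measure))"
      unfolding prod_fun_def by (rule integral_complex_of_real)
    then show ?thesis unfolding integral_prod_lborel[OF integrable_cut_power_top] integral_cut_power_top by simp
  qed
  ultimately show ?thesis unfolding eq by (simp only:)
qed

text \<open>For smoothed ramps, integrating by parts \<open>Suc p\<close> times in each coordinate
  is exact, and both sides converge. The exponents fit: \<open>p + Suc p\<close> powers of 1/v are
  reduced to \<open>p\<close>, which contribute 1 at v = 1, and \<open>Suc p\<close> derivatives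
  turn (v-1)_+^p into p! times the point mass. This is Taylor's formula in multiplicative
  form.\<close>

lemma value_at_one_representation:
  fixes F :: "real^'d::finite \<Rightarrow> complex"
  assumes F: "test_fun F" and js: "distinct js" "set js = (UNIV::'d set)"
  shows "(\<integral>x. prod_fun (\<lambda>_. weight p) x * euler_op (euler_total p (Suc p) js) F x \<partial>lborel) =
     (-1) ^ (Suc p * length js) * (of_real (fact p ^ CARD('d)) * F 1)"
proof -
  let ?g = "\<lambda>n (_::'d) v. ramp p n (v - 1) / v ^ (p + Suc p)"
  let ?E = "euler_op (euler_total p (Suc p) js) F"
  have 1: "(\<lambda>n. \<integral>x. prod_fun (?g n) x * ?E x \<partial>lborel) \<longlonglongrightarrow> (\<integral>x. prod_fun (\<lambda>_. weight p) x * ?E x \<partial>lborel)"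
  proof (rule integral_prod_fun_dominated)
    show "integrable lborel ?E" by (intro integrable_test_fun test_fun_euler_op F)
    show "?g n j \<in> borel_measurable borel" for n and j :: 'd
      by (intro borel_measurable_divide borel_measurable_continuous_onI smooth_real_continuous ramp_shift smooth_real_pow)
    show "weight p \<in> borel_measurable borel" unfolding weight_def[abs_def] by measurable
    show "(\<lambda>n. ?g n j v) \<longlonglongrightarrow> weight p v" for j :: 'd and v by (rule shifted_ramp_weight_tendsto)
    show "0 \<le> ?g n j v" for n and j :: 'd and v using ramp_shift(2,3)[of v p n] by (cases "v < 1") auto
    show "?g n j v \<le> 1" for n and j :: 'd and v
    proof (cases "v \<le> 1")
      case True
      show ?thesis
      proof (cases "v = 1")
        case True
        then show ?thesis by (simp add: ramp_def smooth_step)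
      qed (use True ramp_shift(2)[of v p n] in auto)
    next
      case False
      then have "?g n j v \<le> weight p v"
        using ramp_shift(4)[of v p n] by (auto simp: weight_def intro!: divide_right_mono)
      then show ?thesis using weight_bounds(2) order_trans by blast
    qed
  qed
  have 2: "(\<integral>x. prod_fun (?g n) x * ?E x \<partial>lborel) = (-1) ^ (Suc p * length js) *
      (\<integral>x. prod_fun (\<lambda>_ v. (deriv ^^ Suc p) (\<lambda>v. ramp p n (v - 1)) v / v ^ p) x * F x \<partial>lborel)" for n
    using integral_euler_total[where p=p and m="Suc p" and k="\<lambda>v. ramp p n (v - 1)", OF F ramp_shift(1) ramp_shift(2) js(1)]
    by (simp only: js(2) UNIV_I if_True)
  have "(\<lambda>n. \<integral>x. prod_fun (?g n) x * ?E x \<partial>lborel) \<longlonglongrightarrow> (-1) ^ (Suc p * length js) * (of_real (fact p ^ CARD('d)) * F 1)"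
    unfolding 2 by (intro tendsto_mult tendsto_const approximate_identity F)
  from LIMSEQ_unique[OF 1 this] show ?thesis .
qed

subsection \<open>Euler operators\<close>

lemma euler_op_cong_open:
  assumes "open U" "\<And>z. z \<in> U \<Longrightarrow> f z = g z" "x \<in> U"
  shows "euler_op l f x = euler_op l g x"
  using assms(3)
proof (induction l arbitrary: x)
  case (Cons p l)
  have "partial (fst p) (euler_op l f) x = partial (fst p) (euler_op l g) x"
    by (rule partial_cong_open[OF assms(1) Cons(2) Cons(1)])
  then show ?case using Cons by (simp add: theta_def)
qed (use assms in simp)

lemma tsupp_euler_op: "tsupp (euler_op l f) \<subseteq> tsupp f"
proof (rule tsupp_subset)
  have z: "euler_op l (\<lambda>x. 0) = (\<lambda>x. 0)" by (induction l) (auto simp: theta_def partial_const)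
  show "x \<in> tsupp f" if "euler_op l f x \<noteq> 0" for x
  proof (rule ccontr)
    assume "x \<notin> tsupp f"
    then have "euler_op l f x = euler_op l (\<lambda>x. 0) x"
      using tsupp_superset by (intro euler_op_cong_open[of "- tsupp f"]) (auto simp: tsupp_def)
    then show False using that z by simp
  qed
qed (simp add: tsupp_def)

lemma multiplier_euler_op:
  assumes T: "DH T" and phi: "test_fun \<phi>"
  shows "multiplier T (euler_op l \<phi>) = euler_op l (multiplier T \<phi>)"
proof (induction l)
  case (Cons p l)
  let ?e = "euler_op l \<phi>" and ?j = "fst p" and ?a = "of_nat (snd p) :: complex"
  have e: "test_fun ?e" by (rule test_fun_euler_op[OF phi])
  note te = test_fun_theta[OF e, of "fst p"]
  show ?case
  proof (rule multiplier_unique[OF T test_fun_euler_op[OF phi]])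
    show "continuous_on UNIV (euler_op (p # l) (multiplier T \<phi>))"
      by (intro smooth_fun_continuous test_funD test_fun_euler_op multiplier(1)[OF T phi])
    fix y :: "real^'a" assume y: "all_nz y"
    have "dil y (euler_op (p # l) \<phi>) = (\<lambda>x. dil y (theta ?j ?e) x - ?a * dil y ?e x)"
      by (simp add: dil_def)
    then have "T (dil y (euler_op (p # l) \<phi>)) = T (dil y (theta ?j ?e)) - ?a * T (dil y ?e)"
      using test_linearD(4)[OF DH_linear[OF T] test_fun_dil(1)[OF te y] test_fun_cmult[OF test_fun_dil(1)[OF e y]]]
        test_linearD(1)[OF DH_linear[OF T] test_fun_dil(1)[OF e y]] by simp
    then show "T (dil y (euler_op (p # l) \<phi>)) = euler_op (p # l) (multiplier T \<phi>) y"
      using multiplier(2)[OF T te y] multiplier(2)[OF T e y] multiplier_theta[OF T e, of ?j] Cons by simp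
  qed
qed simp

lemma test_linear_euler_dist:
  assumes "test_linear S" shows "test_linear (euler_dist j S)"
  unfolding test_linear_def
proof (intro allI impI)
  fix \<phi> \<psi> :: "real^'a \<Rightarrow> complex" and a assume t: "test_fun \<phi> \<and> test_fun \<psi>"
  let ?e = "\<lambda>\<phi> x. \<phi> x + complex_of_real (x $ j) * partial j \<phi> x"
  have "test_fun (?e \<eta>)" if "test_fun \<eta>" for \<eta>
    using test_fun_add[OF that test_fun_theta[OF that, of j]] by (simp only: theta_def)
  then have te: "test_fun (?e \<phi>)" "test_fun (?e \<psi>)" using t by blast+
  have d: "differentiable_in j \<phi>" "differentiable_in j \<psi>"
    using t smooth_fun_differentiable[OF test_funD(1)] by blast+
  have "?e (\<lambda>x. \<phi> x + \<psi> x) = (\<lambda>x. ?e \<phi> x + ?e \<psi> x)" "?e (\<lambda>x. a * \<phi> x) = (\<lambda>x. a * ?e \<phi> x)"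
    by (simp_all add: partial_add[OF d] partial_cmult[OF d(1)] algebra_simps)
  then show "euler_dist j S (\<lambda>x. \<phi> x + \<psi> x) = euler_dist j S \<phi> + euler_dist j S \<psi> \<and>
      euler_dist j S (\<lambda>x. a * \<phi> x) = a * euler_dist j S \<phi>"
    unfolding euler_dist_def using test_linearD(3)[OF assms te] test_linearD(1)[OF assms te(1)] by simp
qed

lemma test_linear_euler_word: "test_linear S \<Longrightarrow> test_linear (euler_word js S)"
  unfolding euler_word_def by (induction js) (auto intro: test_linear_euler_dist)

text \<open>By definition theta_j S is S composed with -(1 + theta_j), so S((theta_j - a) \<phi>) =
  -(theta_j S)(\<phi>) - (a+1) S(\<phi>). \<open>A\<close> and \<open>c\<close> depend on
  \<open>l\<close> alone. Peeling the list from its end makes the new letter the head of the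
  word.\<close>

lemma euler_op_as_words:
  fixes l :: "('d::finite \<times> nat) list"
  shows "\<exists>A c. finite A \<and> (\<forall>S \<phi>. test_linear S \<longrightarrow> test_fun \<phi> \<longrightarrow>
      S (euler_op l \<phi>) = (\<Sum>js\<in>A. c js * euler_word js S \<phi>))"
proof (induction l rule: rev_induct)
  case Nil
  show ?case by (intro exI[of _ "{[]}"] exI[of _ "\<lambda>_. 1"]) (simp add: euler_word_def)
next
  case (snoc p l)
  obtain j a where p: "p = (j, a)" by (cases p)
  obtain A c where A: "finite A" "\<And>S \<phi>. test_linear S \<Longrightarrow> test_fun \<phi> \<Longrightarrow>
      S (euler_op l \<phi>) = (\<Sum>js\<in>A. c js * euler_word js S \<phi>)" using snoc by blast
  let ?A = "A \<union> Cons j ` A"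
  \<comment> \<open>A word may occur both in \<open>A\<close> and as a word of \<open>A\<close>
    prefixed by \<open>j\<close>; \<open>c'\<close> adds the two contributions.\<close>
  define c' where "c' w = (if w \<in> A then - (of_nat (Suc a) * c w) else 0) + (if w \<in> Cons j ` A then - c (tl w) else 0)" for w
  have "S (euler_op (l @ [p]) \<phi>) = (\<Sum>js\<in>?A. c' js * euler_word js S \<phi>)"
    if S: "test_linear S" and phi: "test_fun \<phi>" for S \<phi>
  proof -
    let ?W = "\<lambda>js. euler_word js S"
    have t1: "test_fun (\<lambda>x. \<phi> x + theta j \<phi> x)" by (intro test_fun_add test_fun_theta phi)
    have t2: "test_fun (\<lambda>x. of_nat (Suc a) * \<phi> x)" by (rule test_fun_cmult[OF phi])
    have eq: "(\<lambda>x. theta j \<phi> x - of_nat a * \<phi> x) = (\<lambda>x. (\<phi> x + theta j \<phi> x) - of_nat (Suc a) * \<phi> x)"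
      by (simp add: algebra_simps)
    have W: "?W js (\<lambda>x. theta j \<phi> x - of_nat a * \<phi> x) = - ?W (j # js) \<phi> - of_nat (Suc a) * ?W js \<phi>" for js
    proof -
      note L = test_linear_euler_word[OF S, of js]
      have "?W (j # js) \<phi> = - ?W js (\<lambda>x. \<phi> x + theta j \<phi> x)"
        by (simp add: euler_word_def euler_dist_def theta_def)
      then show ?thesis unfolding eq test_linearD(4)[OF L t1 t2] test_linearD(1)[OF L phi] by simp
    qed
    have "S (euler_op (l @ [p]) \<phi>) = S (euler_op l (\<lambda>x. theta j \<phi> x - of_nat a * \<phi> x))"
      by (simp add: euler_op_append p)
    also have "\<dots> = (\<Sum>js\<in>A. c js * ?W js (\<lambda>x. theta j \<phi> x - of_nat a * \<phi> x))"
      by (intro A(2) S test_fun_diff test_fun_theta test_fun_cmult phi)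
    also have "\<dots> = (\<Sum>js\<in>A. - (of_nat (Suc a) * c js) * ?W js \<phi>) + (\<Sum>js\<in>A. - c js * ?W (j # js) \<phi>)"
      unfolding W sum.distrib[symmetric]
      by (intro sum.cong refl) (simp add: algebra_simps del: of_nat_Suc)
    also have "(\<Sum>js\<in>A. - (of_nat (Suc a) * c js) * ?W js \<phi>) =
        (\<Sum>w\<in>?A. (if w \<in> A then - (of_nat (Suc a) * c w) else 0) * ?W w \<phi>)"
      using A(1) by (intro sum.mono_neutral_cong_left) auto
    also have "(\<Sum>js\<in>A. - c js * ?W (j # js) \<phi>) = (\<Sum>w\<in>Cons j ` A. - c (tl w) * ?W w \<phi>)"
      by (subst sum.reindex) (auto simp: inj_on_def)
    also have "\<dots> = (\<Sum>w\<in>?A. (if w \<in> Cons j ` A then - c (tl w) else 0) * ?W w \<phi>)"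
      using A(1) by (intro sum.mono_neutral_cong_left) auto
    finally show ?thesis unfolding c'_def by (simp only: sum.distrib[symmetric] distrib_right)
  qed
  then show ?case using A(1) by blast
qed

subsection \<open>Truncation away from the coordinate hyperplanes\<close>

lemma smooth_step_scaled: "smooth_real (\<lambda>s. smooth_step (c * s))"
  using smooth_real_affine[OF smooth_step(1), of 1 c 0] by simp

text \<open>Written as a sum of one half for each side of 0: expanding the product over the
  coordinates then splits a function into its orthant pieces.\<close>

definition cutoff :: "real \<Rightarrow> real \<Rightarrow> real" where
  "cutoff \<delta> s = smooth_step (2 / \<delta> * s) + smooth_step ((- 2 / \<delta>) * s)"

lemma smooth_real_cutoff: "smooth_real (cutoff \<delta>)"
  unfolding cutoff_def[abs_def] by (intro smooth_real_add smooth_step_scaled)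

lemma smooth_step_half:
  assumes "\<delta> > 0"
  shows "s \<le> \<delta> / 2 \<Longrightarrow> smooth_step (2 / \<delta> * s) = 0" "\<delta> \<le> s \<Longrightarrow> smooth_step (2 / \<delta> * s) = 1"
  using assms by (auto intro!: smooth_step simp: field_simps)

lemma cutoff:
  assumes "\<delta> > 0"
  shows "\<bar>s\<bar> \<le> \<delta> / 2 \<Longrightarrow> cutoff \<delta> s = 0" "\<delta> \<le> \<bar>s\<bar> \<Longrightarrow> cutoff \<delta> s = 1"
  using smooth_step_half[OF assms, of s] smooth_step_half[OF assms, of "- s"] assms
  by (auto simp: cutoff_def abs_if split: if_splits)

text \<open>Inserting the cutoff of one coordinate changes the function only where |x_j| \<le>
  \<epsilon> for that coordinate, and \<open>T\<close> annihilates such a change.\<close>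

lemma DH_cutoff:
  fixes T :: "(real^'d::finite \<Rightarrow> complex) \<Rightarrow> complex"
  assumes T: "DH T" and e: "\<epsilon> > 0" "\<And>j \<phi>. test_fun \<phi> \<Longrightarrow> (\<And>x. \<phi> x \<noteq> 0 \<Longrightarrow> \<bar>x $ j\<bar> \<le> \<epsilon>) \<Longrightarrow> T \<phi> = 0"
    and phi: "test_fun \<phi>"
  shows "T (\<lambda>x. prod_fun (\<lambda>_. cutoff \<epsilon>) x * \<phi> x) = T \<phi>"
proof -
  let ?g = "\<lambda>J (j::'d). if j \<in> J then cutoff \<epsilon> else (\<lambda>_. 1)"
  have sm: "smooth_real (?g J j)" for J j using smooth_real_cutoff smooth_real_const by simp
  have t: "test_fun (\<lambda>x. prod_fun (?g J) x * \<phi> x)" for J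
    by (intro test_fun_mult smooth_fun_prod_fun sm phi)
  have "T (\<lambda>x. prod_fun (?g J) x * \<phi> x) = T \<phi>" if "finite J" for J
    using that
  proof (induction J)
    case empty
    then show ?case by (simp add: prod_fun_def)
  next
    case (insert j J)
    have split: "(\<Prod>i\<in>UNIV. h i (x $ i)) = h j (x $ j) * (\<Prod>i\<in>UNIV - {j}. h i (x $ i))" for h :: "'d \<Rightarrow> real \<Rightarrow> real" and x :: "real^'d"
      by (rule prod.remove) auto
    have "prod_fun (?g J) x * \<phi> x - prod_fun (?g (insert j J)) x * \<phi> x = 0" if "\<bar>x $ j\<bar> > \<epsilon>" for x
    proof -
      have "(\<Prod>i\<in>UNIV - {j}. ?g J i (x $ i)) = (\<Prod>i\<in>UNIV - {j}. ?g (insert j J) i (x $ i))"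
        by (intro prod.cong) auto
      then have "prod_fun (?g J) x = prod_fun (?g (insert j J)) x"
        unfolding prod_fun_def split[of "?g J" x] split[of "?g (insert j J)" x]
        using insert(2) cutoff(2)[OF e(1), of "x $ j"] that by (simp del: of_real_prod)
      then show ?thesis by simp
    qed
    then have "T (\<lambda>x. prod_fun (?g J) x * \<phi> x - prod_fun (?g (insert j J)) x * \<phi> x) = 0"
      by (intro e(2)[of _ j] test_fun_diff t) (meson not_le)
    then have "T (\<lambda>x. prod_fun (?g J) x * \<phi> x) = T (\<lambda>x. prod_fun (?g (insert j J)) x * \<phi> x)"
      unfolding test_linearD(4)[OF DH_linear[OF T] t t] by simp
    then show ?case using insert by simp
  qed
  from this[of UNIV] show ?thesis by simp
qed

text \<open>\<open>X\<close> is the set of coordinates that are positive on the piece; the pieces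
  come from expanding the product of cutoffs, which is 1 wherever \<psi> is nonzero. Each piece
  lives in a box of points with nonzero coordinates, the kind of domain on which
  \<open>param_int\<close> and the substitution x = \<xi> v operate.\<close>

lemma orthant_decomposition:
  fixes \<psi> :: "real^'d::finite \<Rightarrow> complex"
  assumes psi: "test_fun \<psi>" and d: "\<delta> > 0" "\<And>x j. \<psi> x \<noteq> 0 \<Longrightarrow> \<delta> \<le> \<bar>x $ j\<bar>"
  obtains I :: "'d set set" and f a b where "finite I" "\<psi> = (\<lambda>x. \<Sum>X\<in>I. f X x)"
    "\<And>X. X \<in> I \<Longrightarrow> test_fun (f X)" "\<And>X. X \<in> I \<Longrightarrow> tsupp (f X) \<subseteq> cbox (a X) (b X)"
    "\<And>X x. X \<in> I \<Longrightarrow> x \<in> cbox (a X) (b X) \<Longrightarrow> all_nz x"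
proof -
  obtain R where R: "R > 0" "\<And>x i. x \<in> tsupp \<psi> \<Longrightarrow> \<bar>x $ i\<bar> < R"
    using compact_abs_bound[OF test_funD(2)[OF psi]] by metis
  define g where "g X (j::'d) = (if j \<in> X then (\<lambda>s. smooth_step (2 / \<delta> * s)) else (\<lambda>s. smooth_step ((- 2 / \<delta>) * s)))" for X j
  define f where "f X x = prod_fun (g X) x * \<psi> x" for X x
  define a :: "'d set \<Rightarrow> real^'d" where "a X = (\<chi> j. if j \<in> X then \<delta> / 2 else - R)" for X
  define b :: "'d set \<Rightarrow> real^'d" where "b X = (\<chi> j. if j \<in> X then R else - \<delta> / 2)" for X
  have g: "smooth_real (g X j)" for X j
    by (cases "j \<in> X") (simp_all only: g_def if_True if_False smooth_step_scaled)
  have "test_fun (f X)" for X unfolding f_def[abs_def] by (intro test_fun_mult smooth_fun_prod_fun g psi)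
  moreover have "tsupp (f X) \<subseteq> cbox (a X) (b X)" for X
  proof (rule tsupp_subset[OF closed_cbox])
    fix x assume "f X x \<noteq> 0"
    then have x: "prod_fun (g X) x \<noteq> 0" "\<psi> x \<noteq> 0" by (auto simp: f_def)
    then have gx: "g X j (x $ j) \<noteq> 0" for j unfolding prod_fun_def by auto
    have xR: "\<bar>x $ j\<bar> < R" for j using R(2) tsupp_superset[of \<psi> x] x(2) by blast
    have "a X $ j \<le> x $ j \<and> x $ j \<le> b X $ j" for j
    proof (cases "j \<in> X")
      case True
      then have "\<not> x $ j \<le> \<delta> / 2" using gx[of j] smooth_step_half(1)[OF d(1), of "x $ j"] by (auto simp: g_def)
      then show ?thesis using True xR[of j] by (simp add: a_def b_def)
    next
      case False
      then have "\<not> - x $ j \<le> \<delta> / 2" using gx[of j] smooth_step_half(1)[OF d(1), of "- x $ j"] by (auto simp: g_def)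
      then show ?thesis using False xR[of j] by (simp add: a_def b_def)
    qed
    then show "x \<in> cbox (a X) (b X)" by (simp add: mem_box_cart)
  qed
  moreover have "all_nz x" if "x \<in> cbox (a X) (b X)" for x X
    unfolding all_nz_def
  proof
    fix j
    have "a X $ j \<le> x $ j" "x $ j \<le> b X $ j" using that by (auto simp: mem_box_cart)
    then show "x $ j \<noteq> 0" using d(1) by (auto simp: a_def b_def split: if_splits)
  qed
  moreover have "\<psi> = (\<lambda>x. \<Sum>X\<in>Pow UNIV. f X x)"
  proof
    fix x
    have "(\<Sum>X\<in>Pow UNIV. f X x) = of_real (\<Sum>X\<in>Pow UNIV. \<Prod>j\<in>UNIV. g X j (x $ j)) * \<psi> x"
      unfolding f_def prod_fun_def by (simp add: sum_distrib_right)
    also have "(\<Sum>X\<in>Pow UNIV. \<Prod>j\<in>UNIV. g X j (x $ j)) = (\<Prod>j\<in>UNIV. cutoff \<delta> (x $ j))"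
      unfolding cutoff_def prod_add[OF finite[of UNIV]]
    proof (intro sum.cong refl)
      fix X :: "'d set"
      have "(\<Prod>j\<in>UNIV. g X j (x $ j)) = (\<Prod>j\<in>UNIV - X. g X j (x $ j)) * (\<Prod>j\<in>X. g X j (x $ j))"
        by (rule prod.subset_diff) auto
      then show "(\<Prod>j\<in>UNIV. g X j (x $ j)) =
          (\<Prod>j\<in>X. smooth_step (2 / \<delta> * x $ j)) * (\<Prod>j\<in>UNIV - X. smooth_step (- 2 / \<delta> * x $ j))"
        by (simp add: g_def mult.commute)
    qed
    also have "of_real (\<Prod>j\<in>UNIV. cutoff \<delta> (x $ j)) * \<psi> x = \<psi> x"
    proof (cases "\<psi> x = 0")
      case False
      then have "cutoff \<delta> (x $ j) = 1" for j using cutoff(2)[OF d(1)] d(2) by blast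
      then show ?thesis by simp
    qed simp
    finally show "\<psi> x = (\<Sum>X\<in>Pow UNIV. f X x)" by simp
  qed
  ultimately show ?thesis using that[of "Pow UNIV" f a b] by simp
qed

subsection \<open>The representing function\<close>

text \<open>The smoothed product of the functions \<open>weight p\<close>:
  \<open>bump_kernel\<close> in the variable u = 1/v, with the factor 1/v from du/u = -dv/v.\<close>

definition dual_kernel :: "nat \<Rightarrow> nat \<Rightarrow> real^'d::finite \<Rightarrow> complex" where
  "dual_kernel p n = prod_fun (\<lambda>_ v. bump p n (inverse v) * inverse v)"

text \<open>The convolution t of the overview with the kernel smoothed; 1 / |prod x_j| is the
  density of the invariant measure of the multiplicative group. The value 0 covers points where
  \<open>vinv\<close> is no inverse.\<close>

definition approximant ::
    "((real^'d::finite \<Rightarrow> complex) \<Rightarrow> complex) \<Rightarrow> nat \<Rightarrow> nat \<Rightarrow> real^'d \<Rightarrow> complex" where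
  "approximant T p n x =
    (if all_nz x then T (dil (vinv x) (bump_kernel p n)) / of_real (\<Prod>j\<in>UNIV. \<bar>x $ j\<bar>) else 0)"

text \<open>The absolute values may be inserted because \<open>bump p n (inverse s)\<close> vanishes
  unless s > 0.\<close>

lemma dual_kernel_eq: "dual_kernel p n v = bump_kernel p n (vinv v) / of_real (\<Prod>j\<in>UNIV. \<bar>v $ j\<bar>)"
proof -
  have "bump p n (inverse s) * inverse s = bump p n (inverse s) / \<bar>s\<bar>" for s
  proof (cases "bump p n (inverse s) = 0")
    case False
    have "0 < inverse s"
      using bump_nonzero(1)[OF False] less_trans[of 0 "inverse (real (Suc n))" "inverse s"] by simp
    then show ?thesis by (simp add: divide_inverse)
  qed simp
  then show ?thesis
    unfolding dual_kernel_def bump_kernel_def prod_fun_def by (simp add: prod_dividef)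
qed

lemma dual_kernel_nonzero:
  assumes "dual_kernel p n v \<noteq> 0" shows "v \<in> cbox 1 (\<chi> j. real (Suc n))"
proof -
  have "1 \<le> v $ j \<and> v $ j \<le> real (Suc n)" for j
  proof -
    have "bump p n (inverse (v $ j)) \<noteq> 0" using assms unfolding dual_kernel_def prod_fun_def by auto
    from bump_nonzero[OF this] have *: "inverse (real (Suc n)) < inverse (v $ j)" "inverse (v $ j) < 1" by auto
    have pos: "0 < inverse (v $ j)" using *(1) less_trans[of 0 "inverse (real (Suc n))" "inverse (v $ j)"] by simp
    then have v: "0 < v $ j" by simp
    have "v $ j < real (Suc n)" using *(1) v by (simp add: inverse_less_iff_less del: of_nat_Suc)
    moreover have "1 < v $ j" using *(2) v by (simp add: inverse_less_1_iff)
    ultimately show ?thesis by simp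
  qed
  then show ?thesis by (simp add: mem_box_cart)
qed

lemma continuous_on_dual_kernel: "continuous_on (cbox 1 (\<chi> j. real (Suc n))) (dual_kernel p n :: real^'d::finite \<Rightarrow> complex)"
  unfolding dual_kernel_def prod_fun_def
proof (intro continuous_on_of_real continuous_on_prod continuous_on_mult)
  fix j :: 'd
  have nz: "v $ j \<noteq> 0" if "v \<in> cbox 1 (\<chi> j. real (Suc n))" for v :: "real^'d"
    using that by (auto simp: mem_box_cart dest!: spec[of _ j])
  then show i: "continuous_on (cbox 1 (\<chi> j. real (Suc n))) (\<lambda>v::real^'d. inverse (v $ j))"
    by (intro continuous_intros) auto
  show "continuous_on (cbox 1 (\<chi> j. real (Suc n))) (\<lambda>v::real^'d. bump p n (inverse (v $ j)))"
    by (rule continuous_on_compose2[OF smooth_real_continuous[OF smooth_real_bump, where A=UNIV] i]) auto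
qed

lemma integral_lborel_cbox:
  fixes f :: "'a::euclidean_space \<Rightarrow> complex"
  assumes "continuous_on (cbox a b) f" "\<And>x. x \<notin> cbox a b \<Longrightarrow> f x = 0"
  shows "integrable lborel f" "integral\<^sup>L lborel f = integral (cbox a b) f"
proof -
  show i: "integrable lborel f"
    using assms by (intro integrable_continuous_compact_support[of "cbox a b"]) auto
  have "(\<lambda>x. if x \<in> cbox a b then f x else 0) = f" using assms(2) by auto
  then show "integral\<^sup>L lborel f = integral (cbox a b) f"
    using integral_lborel[OF i] integral_restrict_UNIV[of "cbox a b" f] by simp
qed

lemma continuous_on_vinv: "(\<And>x. x \<in> S \<Longrightarrow> all_nz x) \<Longrightarrow> continuous_on S vinv"
  unfolding vinv_def by (intro continuous_intros) (auto simp: all_nz_def)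

lemma continuous_on_abs_prod: "continuous_on S (\<lambda>x::real^'d::finite. \<Prod>j\<in>UNIV. \<bar>x $ j\<bar>)"
  by (intro continuous_on_prod continuous_on_rabs continuous_intros)

lemma abs_prod_pos: "all_nz x \<Longrightarrow> (\<Prod>j\<in>UNIV. \<bar>x $ j\<bar>) > 0"
  by (intro prod_pos) (auto simp: all_nz_def)

text \<open>Both integrals are \<open>T\<close> applied to the multiplicative convolution of the kernel and \<open>\<psi>\<close>.\<close>

lemma exchange_orthant:
  fixes T :: "(real^'d::finite \<Rightarrow> complex) \<Rightarrow> complex"
  assumes T: "DH T" and psi: "test_fun \<psi>" and box: "tsupp \<psi> \<subseteq> cbox a b" "\<And>x. x \<in> cbox a b \<Longrightarrow> all_nz x"
  shows "integrable lborel (\<lambda>x. approximant T p n x * \<psi> x)"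
    "(\<integral>v. dual_kernel p n v * multiplier T \<psi> v \<partial>lborel) = (\<integral>x. approximant T p n x * \<psi> x \<partial>lborel)"
proof -
  let ?c = "\<chi> j. real (Suc n)" let ?G = "bump_kernel p n :: real^'d \<Rightarrow> complex"
  let ?d = "dual_kernel p n :: real^'d \<Rightarrow> complex" and ?P = "\<lambda>x::real^'d. \<Prod>j\<in>UNIV. \<bar>x $ j\<bar>"
  have psi0: "\<psi> x = 0" if "x \<notin> cbox a b" for x using that box(1) tsupp_superset[of \<psi> x] by blast
  have cpsi: "continuous_on A \<psi>" for A by (intro smooth_fun_continuous test_funD psi)
  have nzc: "all_nz v" if v: "v \<in> cbox 1 ?c" for v :: "real^'d"
    unfolding all_nz_def
  proof
    fix j have "1 \<le> v $ j" using v by (simp add: mem_box_cart)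
    then show "v $ j \<noteq> 0" by simp
  qed
  \<comment> \<open>With the density 1 / |prod x_j| moved to \<psi>, the integrand is
    \<open>h x\<close> times the pairing of \<open>T\<close> with a dilate of the kernel, the form
    that \<open>distribution_param_int\<close> handles.\<close>
  define h where "h x = \<psi> x / of_real (?P x)" for x
  have ch: "continuous_on (cbox a b) h"
    unfolding h_def
  proof (intro continuous_on_divide cpsi continuous_on_of_real continuous_on_abs_prod ballI)
    show "complex_of_real (?P x) \<noteq> 0" if "x \<in> cbox a b" for x
      using abs_prod_pos[OF box(2)[OF that]] by (metis less_irrefl of_real_eq_0_iff)
  qed
  have cv: "continuous_on (cbox a b) vinv" by (rule continuous_on_vinv[OF box(2)])
  have nzv: "all_nz (vinv x)" if "x \<in> cbox a b" for x using box(2)[OF that] by simp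
  have cT: "continuous_on (cbox a b) (\<lambda>x. T (dil (vinv x) ?G))"
    by (intro continuous_on_dilates T test_fun_kernel cv nzv)
  have eq1: "approximant T p n x * \<psi> x = h x * T (dil (vinv x) ?G)" if "x \<in> cbox a b" for x
    using box(2)[OF that] by (simp add: approximant_def h_def)
  have "continuous_on (cbox a b) (\<lambda>x. h x * T (dil (vinv x) ?G))" by (intro continuous_on_mult ch cT)
  then have ca: "continuous_on (cbox a b) (\<lambda>x. approximant T p n x * \<psi> x)"
    by (rule continuous_on_eq) (simp add: eq1)
  note A = integral_lborel_cbox[OF ca]
  show "integrable lborel (\<lambda>x. approximant T p n x * \<psi> x)" by (rule A(1)) (simp add: psi0)
  have R: "(\<integral>x. approximant T p n x * \<psi> x \<partial>lborel) = T (param_int a b h vinv (\<lambda>_. 0) ?G)"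
  proof -
    have "(\<integral>x. approximant T p n x * \<psi> x \<partial>lborel) = integral (cbox a b) (\<lambda>x. approximant T p n x * \<psi> x)"
      by (rule A(2)) (simp add: psi0)
    also have "\<dots> = integral (cbox a b) (\<lambda>x. h x * T (dil (vinv x) ?G))"
      by (intro integral_cong eq1)
    also have "\<dots> = T (param_int a b h vinv (\<lambda>_. 0) ?G)"
      by (rule distribution_param_int(2)[symmetric, OF DH_distribution[OF T] test_fun_kernel(1) ch cv nzv cT])
    finally show ?thesis .
  qed
  have L: "(\<integral>v. ?d v * multiplier T \<psi> v \<partial>lborel) = T (param_int 1 ?c ?d (\<lambda>v. v) (\<lambda>_. 0) \<psi>)"
  proof -
    have "(\<integral>v. ?d v * multiplier T \<psi> v \<partial>lborel) = integral (cbox 1 ?c) (\<lambda>v. ?d v * multiplier T \<psi> v)"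
    proof (rule integral_lborel_cbox(2))
      show "continuous_on (cbox 1 ?c) (\<lambda>v. ?d v * multiplier T \<psi> v)"
        by (intro continuous_on_mult continuous_on_dual_kernel smooth_fun_continuous test_funD multiplier(1)[OF T psi])
      show "?d v * multiplier T \<psi> v = 0" if "v \<notin> cbox 1 ?c" for v
        using that dual_kernel_nonzero[of p n v] by (cases "?d v = 0") auto
    qed
    also have "\<dots> = integral (cbox 1 ?c) (\<lambda>v. ?d v * T (dil v \<psi>))"
      by (intro integral_cong) (simp add: multiplier(2)[OF T psi nzc])
    also have "\<dots> = T (param_int 1 ?c ?d (\<lambda>v. v) (\<lambda>_. 0) \<psi>)"
      by (rule distribution_param_int(2)[symmetric, OF DH_distribution[OF T] psi continuous_on_dual_kernel
            continuous_on_id nzc continuous_on_dilates[OF T psi continuous_on_id nzc]])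
    finally show ?thesis .
  qed
  \<comment> \<open>Once \<open>T\<close> is pulled out of both integrals, two averages at a fixed
    \<xi> remain to be compared; the substitution x = \<xi> v turns one into the other.\<close>
  have "param_int 1 ?c ?d (\<lambda>v. v) (\<lambda>_. 0) \<psi> = param_int a b h vinv (\<lambda>_. 0) ?G"
  proof
    fix \<xi> :: "real^'d"
    show "param_int 1 ?c ?d (\<lambda>v. v) (\<lambda>_. 0) \<psi> \<xi> = param_int a b h vinv (\<lambda>_. 0) ?G \<xi>"
    proof (cases "all_nz \<xi>")
      case False
      \<comment> \<open>If \<xi> has a zero coordinate, neither \<psi>(\<xi> v) nor the kernel can
        be nonzero, so both averages are 0.\<close>
      then obtain j where j: "\<xi> $ j = 0" by (auto simp: all_nz_def)
      have "\<psi> (\<xi> * v) = 0" for v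
      proof (rule psi0, rule notI)
        assume "\<xi> * v \<in> cbox a b"
        then have "all_nz (\<xi> * v)" by (rule box(2))
        then show False using False by simp
      qed
      moreover have "?G (\<xi> * vinv x) = 0" for x
      proof (rule ccontr)
        assume "?G (\<xi> * vinv x) \<noteq> 0"
        from kernel_nonzero[OF this, of j] have "inverse (real (Suc n)) < 0" using j by simp
        then show False by (simp add: not_less del: of_nat_Suc)
      qed
      ultimately show ?thesis by (simp add: param_int_def)
    next
      case True
      let ?f = "\<lambda>x. h x * ?G (\<xi> * vinv x)" and ?g = "\<lambda>v. ?d v * \<psi> (\<xi> * v)"
      let ?S = "(\<lambda>x. \<chi> k. x $ k / \<xi> $ k) ` cbox a b"
      have nP: "complex_of_real (?P \<xi>) \<noteq> 0"
        using abs_prod_pos[OF True] by (metis less_irrefl of_real_eq_0_iff)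
      have "continuous_on (cbox a b) ?f"
        by (intro continuous_on_mult ch continuous_on_compose2[OF smooth_fun_continuous[OF test_funD(1)[OF test_fun_kernel(1)], where A=UNIV]]
            continuous_on_vec_times continuous_on_const cv) auto
      then have "(?f has_integral integral (cbox a b) ?f) (cbox a b)"
        by (intro integrable_integral integrable_continuous)
      from has_integral_stretch_cart[OF this, of "\<lambda>k. \<xi> $ k"] True
      have "((\<lambda>v. ?f (\<chi> k. \<xi> $ k * v $ k)) has_integral integral (cbox a b) ?f /\<^sub>R \<bar>prod (($) \<xi>) UNIV\<bar>) ?S"
        by (simp add: all_nz_def)
      from has_integral_mult_right[OF this, of "of_real (?P \<xi>)"]
      have "((\<lambda>v. of_real (?P \<xi>) * ?f (\<xi> * v)) has_integral
          of_real (?P \<xi>) * (integral (cbox a b) ?f /\<^sub>R ?P \<xi>)) ?S"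
        by (simp only: abs_prod times_vec_def)
      moreover have "of_real (?P \<xi>) * (integral (cbox a b) ?f /\<^sub>R ?P \<xi>) = integral (cbox a b) ?f"
        using nP by (simp add: scaleR_conv_of_real[where 'a=complex] del: of_real_prod)
      moreover have "of_real (?P \<xi>) * ?f (\<xi> * v) = ?g v" for v
      proof -
        have 1: "\<xi> * vinv (\<xi> * v) = vinv v" using True by (simp add: vec_eq_iff all_nz_def)
        have 2: "?P (\<xi> * v) = ?P \<xi> * ?P v" by (simp add: abs_mult prod.distrib)
        show ?thesis
          unfolding h_def 1 2 dual_kernel_eq using nP by (simp del: of_real_prod)
      qed
      ultimately have gS: "(?g has_integral integral (cbox a b) ?f) ?S" by simp
      have g0: "?g v = 0" if "v \<notin> ?S" for v
      proof -
        have "\<xi> * v \<notin> cbox a b"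
        proof
          assume *: "\<xi> * v \<in> cbox a b"
          have "v = (\<chi> k. (\<xi> * v) $ k / \<xi> $ k)" using True by (simp add: vec_eq_iff all_nz_def)
          then show False using that * by blast
        qed
        then show ?thesis by (simp add: psi0)
      qed
      \<comment> \<open>The substitution yields an integral over the image of the box of \<psi>, the
        definition one over the box of the kernel. The integrand is 0 outside either set, so the two
        are compared over the whole space.\<close>
      have gU: "(?g has_integral integral (cbox a b) ?f) UNIV"
        by (rule has_integral_on_superset[OF gS]) (use g0 in auto)
      have "?g v = (if v \<in> cbox 1 ?c then ?g v else 0)" for v
        using dual_kernel_nonzero[of p n v] by (cases "?d v = 0") auto
      then have "((\<lambda>v. if v \<in> cbox 1 ?c then ?g v else 0) has_integral integral (cbox a b) ?f) UNIV"
        by (intro has_integral_eq[OF _ gU])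
      then have "(?g has_integral integral (cbox a b) ?f) (cbox 1 ?c)" by (simp only: has_integral_restrict_UNIV)
      then show ?thesis unfolding param_int_def by (simp add: integral_unique)
    qed
  qed
  then show "(\<integral>v. ?d v * multiplier T \<psi> v \<partial>lborel) = (\<integral>x. approximant T p n x * \<psi> x \<partial>lborel)"
    unfolding L R by simp
qed

text \<open>Both sides are linear in \<psi>, so the claim reduces to the pieces of the orthant
  decomposition, each supported in a box.\<close>

lemma exchange:
  fixes T :: "(real^'d::finite \<Rightarrow> complex) \<Rightarrow> complex"
  assumes T: "DH T" and psi: "test_fun \<psi>" and d: "\<delta> > 0" "\<And>x j. \<psi> x \<noteq> 0 \<Longrightarrow> \<delta> \<le> \<bar>x $ j\<bar>"
  shows "(\<integral>v. dual_kernel p n v * multiplier T \<psi> v \<partial>lborel) = (\<integral>x. approximant T p n x * \<psi> x \<partial>lborel)"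
proof (rule orthant_decomposition[OF psi d])
  fix I :: "'d set set" and f a b assume I: "finite I" "\<psi> = (\<lambda>x. \<Sum>X\<in>I. f X x)"
    and f: "\<And>X. X \<in> I \<Longrightarrow> test_fun (f X)" "\<And>X. X \<in> I \<Longrightarrow> tsupp (f X) \<subseteq> cbox (a X) (b X)"
    and nz: "\<And>X x. X \<in> I \<Longrightarrow> x \<in> cbox (a X) (b X) \<Longrightarrow> all_nz x"
  have m: "multiplier T \<psi> = (\<lambda>y. \<Sum>X\<in>I. multiplier T (f X) y)"
  proof (rule multiplier_unique[OF T psi])
    show "continuous_on UNIV (\<lambda>y. \<Sum>X\<in>I. multiplier T (f X) y)"
      by (intro continuous_on_sum smooth_fun_continuous test_funD multiplier(1)[OF T] f)
    fix y :: "real^'d" assume y: "all_nz y"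
    have "dil y \<psi> = (\<lambda>x. \<Sum>X\<in>I. dil y (f X) x)" by (simp add: I(2) dil_def)
    then have "T (dil y \<psi>) = (\<Sum>X\<in>I. T (dil y (f X)))"
      using test_linear_sum[OF DH_linear[OF T], of I "\<lambda>X. dil y (f X)"] test_fun_dil(1)[OF f(1) y] by simp
    also have "\<dots> = (\<Sum>X\<in>I. multiplier T (f X) y)"
      by (intro sum.cong refl multiplier(2)[symmetric] T f y)
    finally show "T (dil y \<psi>) = (\<Sum>X\<in>I. multiplier T (f X) y)" .
  qed
  have i: "integrable lborel (\<lambda>v. dual_kernel p n v * multiplier T (f X) v)" if X: "X \<in> I" for X
  proof (rule integral_lborel_cbox(1))
    show "continuous_on (cbox 1 (\<chi> j. real (Suc n))) (\<lambda>v. dual_kernel p n v * multiplier T (f X) v)"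
      by (intro continuous_on_mult continuous_on_dual_kernel smooth_fun_continuous test_funD multiplier(1)[OF T f(1)[OF X]])
    show "dual_kernel p n v * multiplier T (f X) v = 0" if "v \<notin> cbox 1 (\<chi> j. real (Suc n))" for v
      using that dual_kernel_nonzero[of p n v] by (cases "dual_kernel p n v = 0") auto
  qed
  have "(\<integral>v. dual_kernel p n v * multiplier T \<psi> v \<partial>lborel) =
      (\<Sum>X\<in>I. \<integral>v. dual_kernel p n v * multiplier T (f X) v \<partial>lborel)"
    unfolding m sum_distrib_left by (rule Bochner_Integration.integral_sum[OF i])
  also have "\<dots> = (\<Sum>X\<in>I. \<integral>x. approximant T p n x * f X x \<partial>lborel)"
    by (intro sum.cong refl exchange_orthant(2)[OF T f nz])
  also have "\<dots> = (\<integral>x. approximant T p n x * \<psi> x \<partial>lborel)"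
    unfolding I(2) sum_distrib_left
    by (rule Bochner_Integration.integral_sum[symmetric]) (intro exchange_orthant(1)[OF T f nz])
  finally show ?thesis .
qed

section \<open>Limits, measurability and support of the approximants\<close>

lemma dual_kernel_integral_tendsto:
  assumes F: "test_fun F"
  shows "(\<lambda>n. \<integral>v. dual_kernel p n v * F v \<partial>lborel) \<longlonglongrightarrow> (\<integral>v. prod_fun (\<lambda>_. weight p) v * F v \<partial>lborel)"
  unfolding dual_kernel_def
proof (rule integral_prod_fun_dominated[OF integrable_test_fun[OF F]])
  fix j :: 'a and n :: nat and v :: real
  have mb: "bump p n \<in> borel_measurable borel" for n
    by (intro borel_measurable_continuous_onI smooth_real_continuous smooth_real_bump)
  show "(\<lambda>v. bump p n (inverse v) * inverse v) \<in> borel_measurable borel"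
    using mb by measurable
  show "weight p \<in> borel_measurable borel" unfolding weight_def[abs_def] by measurable
  have pos: "0 < inverse v" "inverse v < 1" if "bump p n (inverse v) \<noteq> 0" for n
    using bump_nonzero[OF that] less_trans[of 0 "inverse (real (Suc n))" "inverse v"] by auto
  show "0 \<le> bump p n (inverse v) * inverse v"
    using bump_bounds(1)[of p n "inverse v"] pos(1)[of n] by (cases "bump p n (inverse v) = 0") auto
  show "bump p n (inverse v) * inverse v \<le> 1"
  proof (cases "bump p n (inverse v) = 0")
    case False
    note p = pos[OF False]
    have "bump p n (inverse v) \<le> inverse v ^ p * (1 - inverse v) ^ p" by (rule bump_bounds(2)[OF p])
    also have "\<dots> \<le> 1" using p by (intro mult_le_one power_le_one) auto
    finally show ?thesis using p bump_bounds(1)[of p n "inverse v"] by (intro mult_le_one) auto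
  qed simp
  have "(\<lambda>n. ramp p n (inverse v) * ramp p n (1 - inverse v) * inverse v) \<longlonglongrightarrow>
      (if inverse v > 0 then inverse v ^ p else 0) * (if 1 - inverse v > 0 then (1 - inverse v) ^ p else 0) * inverse v"
    by (intro tendsto_intros ramp_tendsto)
  moreover have "(if inverse v > 0 then inverse v ^ p else 0) * (if 1 - inverse v > 0 then (1 - inverse v) ^ p else 0) * inverse v = weight p v"
  proof (cases "v > 1")
    case True
    then have "inverse v > 0" "inverse v < 1" by (auto simp: inverse_less_1_iff)
    moreover have "inverse v ^ p * (1 - inverse v) ^ p * inverse v = (v - 1) ^ p / v ^ (p + Suc p)"
    proof -
      have "1 - inverse v = (v - 1) / v" using True by (simp add: field_simps)
      then show ?thesis using True by (simp add: power_divide power_add divide_inverse power_inverse power_mult_distrib mult_ac)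
    qed
    ultimately show ?thesis using True by (simp add: weight_def)
  next
    case False
    then show ?thesis using one_le_inverse[of v] by (cases "v > 0") (auto simp: weight_def)
  qed
  ultimately show "(\<lambda>n. bump p n (inverse v) * inverse v) \<longlonglongrightarrow> weight p v"
    unfolding bump_def by simp
qed

lemma approximant_measurable:
  assumes T: "DH T" shows "approximant T p n \<in> borel_measurable borel"
proof -
  let ?S = "{x :: real^'a. all_nz x}"
  have eq: "?S = (\<Inter>j\<in>UNIV. {x. x $ j \<noteq> 0})" by (auto simp: all_nz_def)
  have "open ?S" unfolding eq
    by (intro open_INT finite ballI open_Collect_neq continuous_intros)
  then have S: "?S \<in> sets borel" by simp
  have "continuous_on ?S (\<lambda>x. T (dil (vinv x) (bump_kernel p n)) / of_real (\<Prod>j\<in>UNIV. \<bar>x $ j\<bar>))"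
  proof (intro continuous_on_divide continuous_on_of_real continuous_on_abs_prod ballI)
    show "continuous_on ?S (\<lambda>x. T (dil (vinv x) (bump_kernel p n)))"
      by (intro continuous_on_dilates T test_fun_kernel continuous_on_vinv) auto
    show "complex_of_real (\<Prod>j\<in>UNIV. \<bar>x $ j\<bar>) \<noteq> 0" if "x \<in> ?S" for x
      using abs_prod_pos[of x] that by (metis less_irrefl of_real_eq_0_iff mem_Collect_eq)
  qed
  from borel_measurable_continuous_on_indicator[OF S this]
  show ?thesis
    by (rule measurable_cong[THEN iffD1, rotated]) (simp add: approximant_def indicator_def)
qed

text \<open>The kernel is nonzero only at points with all coordinates in (0,1), so its dilate by 1/x
  is nonzero only where |\<xi>_j| < |x_j|. If |x_j| \<le> \<epsilon>, this lies in the strip where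
  \<open>T\<close> vanishes.\<close>

lemma approximant_zero:
  assumes e: "\<And>j \<phi>. test_fun \<phi> \<Longrightarrow> (\<And>x. \<phi> x \<noteq> 0 \<Longrightarrow> \<bar>x $ j\<bar> \<le> \<epsilon>) \<Longrightarrow> T \<phi> = 0"
    and x: "\<bar>x $ j\<bar> \<le> \<epsilon>"
  shows "approximant T p n x = 0"
proof (cases "all_nz x")
  case True
  have "T (dil (vinv x) (bump_kernel p n)) = 0"
  proof (rule e)
    show "test_fun (dil (vinv x) (bump_kernel p n))" using True by (intro test_fun_dil test_fun_kernel) simp
    fix \<xi> :: "real^'a" assume "dil (vinv x) (bump_kernel p n) \<xi> \<noteq> 0"
    then have "bump_kernel p n (\<xi> * vinv x) \<noteq> 0" by (simp add: dil_def)
    from kernel_nonzero[OF this, of j]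
    have "inverse (real (Suc n)) < \<xi> $ j * inverse (x $ j)" "\<xi> $ j * inverse (x $ j) < 1" by auto
    moreover have "0 < inverse (real (Suc n))" by simp
    ultimately have "\<bar>\<xi> $ j * inverse (x $ j)\<bar> < 1" by linarith
    moreover have "x $ j \<noteq> 0" using True by (simp add: all_nz_def)
    ultimately have "\<bar>\<xi> $ j\<bar> < \<bar>x $ j\<bar>" by (simp add: abs_mult field_simps)
    then show "\<bar>\<xi> $ j\<bar> \<le> \<epsilon>" using x by simp
  qed
  then show ?thesis by (simp add: approximant_def)
qed (simp add: approximant_def)

text \<open>For the coordinate of largest modulus, |x| \<le> d |x_j|, and 1 \<le> |x_j| /
  \<epsilon>; these two bounds produce the constant under the root. The purpose is to turn decay in
  each single coordinate into decay in the norm.\<close>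

lemma one_plus_norm_bound:
  fixes x :: "real^'d::finite"
  assumes "\<epsilon> > 0" "\<And>j. \<epsilon> < \<bar>x $ j\<bar>"
  shows "\<exists>j. (1 + norm x ^ 2) powr (real k / 2) \<le> (sqrt (inverse \<epsilon> ^ 2 + real CARD('d) ^ 2) * \<bar>x $ j\<bar>) ^ k"
proof -
  let ?d = "real CARD('d)"
  obtain j where j: "\<And>i. \<bar>x $ i\<bar> \<le> \<bar>x $ j\<bar>"
  proof -
    have "Max (range (\<lambda>i. \<bar>x $ i\<bar>)) \<in> range (\<lambda>i. \<bar>x $ i\<bar>)" by (intro Max_in) auto
    then obtain j where j: "Max (range (\<lambda>i. \<bar>x $ i\<bar>)) = \<bar>x $ j\<bar>" by (rule imageE)
    have "\<bar>x $ i\<bar> \<le> \<bar>x $ j\<bar>" for i unfolding j[symmetric] by (intro Max_ge) auto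
    then show ?thesis by (rule that)
  qed
  have "norm x \<le> (\<Sum>i\<in>UNIV. \<bar>x $ i\<bar>)" by (rule norm_le_l1_cart)
  also have "\<dots> \<le> (\<Sum>i\<in>(UNIV::'d set). \<bar>x $ j\<bar>)" by (intro sum_mono j)
  finally have "norm x \<le> ?d * \<bar>x $ j\<bar>" by simp
  then have "norm x ^ 2 \<le> (?d * \<bar>x $ j\<bar>) ^ 2" by (intro power_mono) auto
  moreover have "1 \<le> (inverse \<epsilon> * \<bar>x $ j\<bar>) ^ 2"
    using assms(1) assms(2)[of j] by (intro one_le_power) (simp add: field_simps)
  ultimately have le: "1 + norm x ^ 2 \<le> (inverse \<epsilon> ^ 2 + ?d ^ 2) * \<bar>x $ j\<bar> ^ 2"
    by (simp add: power_mult_distrib algebra_simps)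
  have "(1 + norm x ^ 2) powr (real k / 2) = ((1 + norm x ^ 2) powr (1 / 2)) powr real k"
    by (simp add: powr_powr)
  also have "\<dots> = sqrt (1 + norm x ^ 2) powr real k" by (simp add: powr_half_sqrt)
  also have "\<dots> = sqrt (1 + norm x ^ 2) ^ k" by (rule powr_realpow) (simp add: add_pos_nonneg)
  also have "\<dots> \<le> sqrt ((inverse \<epsilon> ^ 2 + ?d ^ 2) * \<bar>x $ j\<bar> ^ 2) ^ k"
    by (intro power_mono real_sqrt_le_mono le) simp
  also have "\<dots> = (sqrt (inverse \<epsilon> ^ 2 + ?d ^ 2) * \<bar>x $ j\<bar>) ^ k"
    by (simp add: real_sqrt_mult)
  finally show ?thesis by blast
qed

text \<open>The order of choices is \<open>k\<close>, then the order \<open>M\<close> of the uniform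
  decay estimate, then \<open>p\<close> and with it the operator. The function t is the pointwise
  limit of the approximants and inherits their bounds; a uniform bound lets the limit pass through
  the integrals.\<close>

lemma DH_representation:
  fixes T :: "(real^'d::finite \<Rightarrow> complex) \<Rightarrow> complex"
  assumes T: "DH T"
  shows "\<exists>t l C. t \<in> borel_measurable borel \<and>
      (\<forall>x. (1 + norm x ^ 2) powr (real k / 2) * norm (t x) \<le> C) \<and>
      (\<forall>\<phi>. test_fun \<phi> \<longrightarrow> T \<phi> = (\<integral>x. t x * euler_op l \<phi> x \<partial>lborel))"
proof -
  obtain C M where C: "C > 0" and dec: "\<And>\<phi> B y j. test_fun \<phi> \<Longrightarrow> tsupp \<phi> \<subseteq> cbox 0 1 \<Longrightarrow> cbound M \<phi> B \<Longrightarrow>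
      all_nz y \<Longrightarrow> norm (T (dil y \<phi>)) \<le> C * B * \<bar>y $ j\<bar> ^ k"
    using dilate_decay_uniform[OF T, of k] by metis
  \<comment> \<open>The least value with \<open>M < p\<close>, so that the kernels are bounded and
    Cauchy in the C^M norm.\<close>
  define p where "p = Suc M"
  have Mp: "M < p" by (simp add: p_def)
  have "\<exists>\<epsilon>>0. \<forall>j \<phi>. test_fun \<phi> \<longrightarrow> (\<forall>x. \<phi> x \<noteq> 0 \<longrightarrow> \<bar>x $ j\<bar> \<le> \<epsilon>) \<longrightarrow> T \<phi> = 0"
    by (rule DH_vanishes_on_strip[OF T]) blast
  then obtain \<epsilon> where e: "\<epsilon> > 0" "\<And>j \<phi>. test_fun \<phi> \<Longrightarrow> (\<And>x. \<phi> x \<noteq> 0 \<Longrightarrow> \<bar>x $ j\<bar> \<le> \<epsilon>) \<Longrightarrow> T \<phi> = 0"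
    by blast
  let ?G = "\<lambda>n. bump_kernel p n :: real^'d \<Rightarrow> complex"
  let ?a = "approximant T p"
  have zero: "?a n x = 0" if "\<bar>x $ j\<bar> \<le> \<epsilon>" for n x j
  proof (rule approximant_zero[OF _ that])
    show "T \<phi> = 0" if "test_fun \<phi>" "\<And>x. \<phi> x \<noteq> 0 \<Longrightarrow> \<bar>x $ i\<bar> \<le> \<epsilon>" for \<phi> i
      by (rule e(2)[OF that])
  qed
  obtain B where B: "\<And>n. cbound M (?G n) B" using kernel_cbound[OF Mp] by metis
  have B0: "0 \<le> B" using order_trans[OF norm_ge_zero B[of 0, unfolded cbound_def, rule_format, of "[]" 0]] by simp
  \<comment> \<open>Outside the strips |prod x_j| \<ge> \<epsilon>^d, which accounts for the
    denominator.\<close>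
  define D where "D = C * B / \<epsilon> ^ CARD('d)"
  have D0: "0 \<le> D" unfolding D_def using C B0 e(1) by simp
  have bound: "\<bar>x $ j\<bar> ^ k * norm (?a n x) \<le> D" for n x j
  proof (cases "\<exists>i. \<bar>x $ i\<bar> \<le> \<epsilon>")
    case True
    then have "?a n x = 0" using zero by blast
    then show ?thesis using D0 by simp
  next
    case False
    then have big: "\<epsilon> < \<bar>x $ i\<bar>" for i by (simp add: not_le)
    have nz: "all_nz x" using big e(1) unfolding all_nz_def by (metis abs_zero less_asym)
    have "(\<Prod>i\<in>(UNIV::'d set). \<epsilon>) \<le> (\<Prod>i\<in>UNIV. \<bar>x $ i\<bar>)"
      by (intro prod_mono) (use big e(1) less_imp_le in auto)
    then have P: "\<epsilon> ^ CARD('d) \<le> (\<Prod>i\<in>UNIV. \<bar>x $ i\<bar>)" by simp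
    have "norm (T (dil (vinv x) (?G n))) \<le> C * B * \<bar>vinv x $ j\<bar> ^ k"
      by (intro dec test_fun_kernel B) (simp add: nz)
    then have "\<bar>x $ j\<bar> ^ k * norm (T (dil (vinv x) (?G n))) \<le> \<bar>x $ j\<bar> ^ k * (C * B * \<bar>vinv x $ j\<bar> ^ k)"
      by (intro mult_left_mono) auto
    also have "\<dots> = C * B"
    proof -
      have "\<bar>x $ j\<bar> ^ k * \<bar>vinv x $ j\<bar> ^ k = 1"
        using nz unfolding power_mult_distrib[symmetric] by (simp add: all_nz_def abs_mult[symmetric] abs_inverse)
      then show ?thesis by (simp add: mult_ac)
    qed
    finally have 1: "\<bar>x $ j\<bar> ^ k * norm (T (dil (vinv x) (?G n))) \<le> C * B" .
    have "\<bar>x $ j\<bar> ^ k * norm (?a n x) = (\<bar>x $ j\<bar> ^ k * norm (T (dil (vinv x) (?G n)))) / (\<Prod>i\<in>UNIV. \<bar>x $ i\<bar>)"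
      using nz abs_prod_pos[OF nz] by (simp add: approximant_def norm_divide del: of_real_prod)
    also have "\<dots> \<le> C * B / \<epsilon> ^ CARD('d)"
      using 1 P e(1) C B0 by (intro frac_le) auto
    finally show ?thesis unfolding D_def .
  qed
  have "Cauchy (\<lambda>n. ?a n x)" for x
  proof (cases "all_nz x")
    case False
    then show ?thesis by (simp add: approximant_def convergent_Cauchy convergent_const)
  next
    case True
    \<comment> \<open>At a fixed \<open>x\<close> the decay estimate in any one coordinate serves;
      the choice by \<open>SOME\<close> is arbitrary.\<close>
    define r where "r = C * \<bar>vinv x $ (SOME j. True)\<bar> ^ k / (\<Prod>j\<in>UNIV. \<bar>x $ j\<bar>)"
    have r0: "0 \<le> r" unfolding r_def using C abs_prod_pos[OF True] by (intro divide_nonneg_pos mult_nonneg_nonneg) auto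
    show ?thesis
    proof (rule CauchyI)
      fix s :: real assume s: "s > 0"
      define s' where "s' = s / (r + 1)"
      have s': "s' > 0" using s r0 by (simp add: s'_def)
      obtain m where m: "\<And>n l. n \<ge> m \<Longrightarrow> l \<ge> m \<Longrightarrow> cbound M (\<lambda>x. ?G n x - ?G l x) s'"
        using kernel_Cauchy[OF Mp s'] by metis
      have "norm (?a n x - ?a l x) < s" if "n \<ge> m" "l \<ge> m" for n l
      proof -
        have tG: "test_fun (\<lambda>x. ?G n x - ?G l x)" by (intro test_fun_diff test_fun_kernel)
        have "tsupp (\<lambda>x. ?G n x - ?G l x) \<subseteq> cbox 0 1"
        proof (rule tsupp_subset[OF closed_cbox])
          fix x assume "?G n x - ?G l x \<noteq> 0"
          then have "?G n x \<noteq> 0 \<or> ?G l x \<noteq> 0" by auto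
          then show "x \<in> cbox 0 1" using test_fun_kernel(2) tsupp_superset by blast
        qed
        from dec[OF tG this m[OF that], of "vinv x"] True
        have "norm (T (dil (vinv x) (\<lambda>x. ?G n x - ?G l x))) \<le> C * s' * \<bar>vinv x $ (SOME j. True)\<bar> ^ k" by simp
        moreover have "T (dil (vinv x) (\<lambda>x. ?G n x - ?G l x)) = T (dil (vinv x) (?G n)) - T (dil (vinv x) (?G l))"
        proof -
          have "dil (vinv x) (\<lambda>x. ?G n x - ?G l x) = (\<lambda>z. dil (vinv x) (?G n) z - dil (vinv x) (?G l) z)"
            by (simp add: dil_def)
          then show ?thesis
            using test_linearD(4)[OF DH_linear[OF T] test_fun_dil(1)[OF test_fun_kernel(1)] test_fun_dil(1)[OF test_fun_kernel(1)]] True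
            by simp
        qed
        ultimately have "norm (T (dil (vinv x) (?G n)) - T (dil (vinv x) (?G l))) / (\<Prod>j\<in>UNIV. \<bar>x $ j\<bar>) \<le>
            C * s' * \<bar>vinv x $ (SOME j. True)\<bar> ^ k / (\<Prod>j\<in>UNIV. \<bar>x $ j\<bar>)"
          using abs_prod_pos[OF True] by (intro divide_right_mono) auto
        moreover have "norm (?a n x - ?a l x) =
            norm (T (dil (vinv x) (?G n)) - T (dil (vinv x) (?G l))) / (\<Prod>j\<in>UNIV. \<bar>x $ j\<bar>)"
          using True abs_prod_pos[OF True]
          by (simp add: approximant_def diff_divide_distrib[symmetric] norm_divide del: of_real_prod)
        moreover have "C * s' * \<bar>vinv x $ (SOME j. True)\<bar> ^ k / (\<Prod>j\<in>UNIV. \<bar>x $ j\<bar>) = r * s'"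
          by (simp add: r_def)
        moreover have "r * s' < s"
        proof -
          have "r * s < s * (r + 1)" using s by (simp add: algebra_simps)
          then show ?thesis unfolding s'_def using r0 by (simp add: pos_divide_less_eq)
        qed
        ultimately show ?thesis by linarith
      qed
      then show "\<exists>m. \<forall>n\<ge>m. \<forall>l\<ge>m. norm (?a n x - ?a l x) < s" by blast
    qed
  qed
  then have "\<exists>L. (\<lambda>n. ?a n x) \<longlonglongrightarrow> L" for x by (simp add: Cauchy_convergent_iff convergent_def)
  then obtain t where t: "\<And>x. (\<lambda>n. ?a n x) \<longlonglongrightarrow> t x" by metis
  have tm: "t \<in> borel_measurable borel"
    by (rule borel_measurable_LIMSEQ_metric[OF approximant_measurable[OF T] t])
  have tb: "\<bar>x $ j\<bar> ^ k * norm (t x) \<le> D" for x j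
    by (rule Lim_bounded[OF tendsto_mult[OF tendsto_const tendsto_norm[OF t]], of 0]) (use bound in blast)
  have tz: "t x = 0" if "\<bar>x $ j\<bar> \<le> \<epsilon>" for x j
  proof -
    have "(\<lambda>n. ?a n x) = (\<lambda>n. 0)" using zero[OF that] by auto
    then show ?thesis using t[of x] by (simp add: LIMSEQ_const_iff)
  qed
  let ?c = "sqrt (inverse \<epsilon> ^ 2 + real CARD('d) ^ 2)"
  have c0: "0 \<le> ?c" by simp
  have decay: "(1 + norm x ^ 2) powr (real k / 2) * norm (t x) \<le> ?c ^ k * D" for x
  proof (cases "\<exists>i. \<bar>x $ i\<bar> \<le> \<epsilon>")
    case True
    then have "t x = 0" using tz by blast
    then show ?thesis using D0 by simp
  next
    case False
    then obtain j where "(1 + norm x ^ 2) powr (real k / 2) \<le> (?c * \<bar>x $ j\<bar>) ^ k"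
      using one_plus_norm_bound[OF e(1), of x k] by (meson not_le)
    then have "(1 + norm x ^ 2) powr (real k / 2) * norm (t x) \<le> (?c * \<bar>x $ j\<bar>) ^ k * norm (t x)"
      by (intro mult_right_mono) auto
    also have "\<dots> = ?c ^ k * (\<bar>x $ j\<bar> ^ k * norm (t x))" by (simp add: power_mult_distrib)
    also have "\<dots> \<le> ?c ^ k * D" by (intro mult_left_mono tb zero_le_power c0)
    finally show ?thesis .
  qed
  \<comment> \<open>Inside the strips the approximants vanish, outside them |x_j|^k \<ge>
    \<epsilon>^k. The resulting uniform bound provides the dominating function for the limit of the
    integrals.\<close>
  have abound: "norm (?a n x) \<le> D / \<epsilon> ^ k" for n x
  proof (cases "\<exists>i. \<bar>x $ i\<bar> \<le> \<epsilon>")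
    case True
    then have "?a n x = 0" using zero by blast
    then show ?thesis using D0 e(1) by simp
  next
    case False
    fix j0 :: 'd
    have "\<epsilon> ^ k \<le> \<bar>x $ j0\<bar> ^ k" using False e(1) by (intro power_mono) (auto simp: not_le less_imp_le)
    then have "\<epsilon> ^ k * norm (?a n x) \<le> \<bar>x $ j0\<bar> ^ k * norm (?a n x)" by (intro mult_right_mono) auto
    also have "\<dots> \<le> D" by (rule bound)
    finally show ?thesis using e(1) by (simp add: pos_le_divide_eq mult.commute)
  qed
  obtain js where js: "distinct js" "set js = (UNIV :: 'd set)" using finite_distinct_list[OF finite[of UNIV]] by blast
  define l where "l = euler_total p (Suc p) js"
  \<comment> \<open>The constant of \<open>value_at_one_representation\<close>: one sign for each of
    the \<open>Suc p\<close> integrations by parts in each coordinate, and one factorial per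
    coordinate.\<close>
  define c where "c = (-1) ^ (Suc p * length js) * complex_of_real (fact p ^ CARD('d))"
  have cnz: "c \<noteq> 0" unfolding c_def by simp
  \<comment> \<open>Exchanging \<open>T\<close> with the integrals uses supports away from the
    hyperplanes, so such \<phi> come first. The chain is T \<phi> = (N \<phi>)(1), the weight
    formula, P(theta) N \<phi> = N(P(theta) \<phi>), smoothing of the weight, exchange, and removal
    of the smoothing.\<close>
  have rep_off: "c * T \<phi> = (\<integral>x. t x * euler_op l \<phi> x \<partial>lborel)"
    if phi: "test_fun \<phi>" and d: "\<delta> > 0" "\<And>x j. x \<in> tsupp \<phi> \<Longrightarrow> \<delta> \<le> \<bar>x $ j\<bar>" for \<phi> \<delta>
  proof -
    let ?\<psi> = "euler_op l \<phi>"
    have psi: "test_fun ?\<psi>" by (rule test_fun_euler_op[OF phi])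
    have pd: "\<delta> \<le> \<bar>x $ j\<bar>" if "?\<psi> x \<noteq> 0" for x j
      using d(2) tsupp_superset[of ?\<psi>, OF that] tsupp_euler_op by blast
    have "c * T \<phi> = (-1) ^ (Suc p * length js) * (of_real (fact p ^ CARD('d)) * multiplier T \<phi> 1)"
      unfolding c_def multiplier_one[OF T phi] by (rule mult.assoc)
    also have "\<dots> = (\<integral>v. prod_fun (\<lambda>_. weight p) v * euler_op l (multiplier T \<phi>) v \<partial>lborel)"
      unfolding l_def by (rule value_at_one_representation[symmetric, OF multiplier(1)[OF T phi] js])
    also have "euler_op l (multiplier T \<phi>) = multiplier T ?\<psi>"
      by (rule multiplier_euler_op[symmetric, OF T phi])
    finally have cT: "c * T \<phi> = (\<integral>v. prod_fun (\<lambda>_. weight p) v * multiplier T ?\<psi> v \<partial>lborel)" .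
    have "(\<lambda>n. \<integral>v. dual_kernel p n v * multiplier T ?\<psi> v \<partial>lborel) \<longlonglongrightarrow> c * T \<phi>"
      unfolding cT by (rule dual_kernel_integral_tendsto[OF multiplier(1)[OF T psi]])
    moreover have "(\<integral>v. dual_kernel p n v * multiplier T ?\<psi> v \<partial>lborel) = (\<integral>x. ?a n x * ?\<psi> x \<partial>lborel)" for n
      by (rule exchange[OF T psi d(1) pd])
    ultimately have lim: "(\<lambda>n. \<integral>x. ?a n x * ?\<psi> x \<partial>lborel) \<longlonglongrightarrow> c * T \<phi>" by (simp only:)
    have "(\<lambda>n. \<integral>x. ?a n x * ?\<psi> x \<partial>lborel) \<longlonglongrightarrow> (\<integral>x. t x * ?\<psi> x \<partial>lborel)"
    proof (rule integral_dominated_convergence[where w="\<lambda>x. D / \<epsilon> ^ k * norm (?\<psi> x)"])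
      have pm: "?\<psi> \<in> borel_measurable lborel" using integrable_test_fun[OF psi] by auto
      show "(\<lambda>x. t x * ?\<psi> x) \<in> borel_measurable lborel"
        using tm pm by (intro borel_measurable_times) auto
      show "(\<lambda>x. ?a n x * ?\<psi> x) \<in> borel_measurable lborel" for n
        using approximant_measurable[OF T, of p n] pm by (intro borel_measurable_times) auto
      show "integrable lborel (\<lambda>x. D / \<epsilon> ^ k * norm (?\<psi> x))" using integrable_test_fun[OF psi] by simp
      show "AE x in lborel. (\<lambda>n. ?a n x * ?\<psi> x) \<longlonglongrightarrow> t x * ?\<psi> x"
        by (intro AE_I2 tendsto_mult t tendsto_const)
      show "AE x in lborel. norm (?a n x * ?\<psi> x) \<le> D / \<epsilon> ^ k * norm (?\<psi> x)" for n
        unfolding norm_mult by (intro AE_I2 mult_right_mono abound) auto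
    qed
    from LIMSEQ_unique[OF lim this] show ?thesis .
  qed
  \<comment> \<open>A general \<phi> is cut off near the hyperplanes. \<open>T\<close> does not see
    this, and neither does the integral: where t is nonzero all |x_j| exceed \<epsilon>, and the
    cutoff is 1 on that open set, so the derivatives agree as well.\<close>
  have rep: "c * T \<phi> = (\<integral>x. t x * euler_op l \<phi> x \<partial>lborel)" if phi: "test_fun \<phi>" for \<phi>
  proof -
    let ?\<chi> = "\<lambda>x. prod_fun (\<lambda>_. cutoff \<epsilon>) x * \<phi> x"
    have chi: "test_fun ?\<chi>" by (intro test_fun_mult smooth_fun_prod_fun smooth_real_cutoff phi)
    have "tsupp ?\<chi> \<subseteq> {x. \<forall>j. \<epsilon> / 2 \<le> \<bar>x $ j\<bar>}"
    proof (rule tsupp_subset)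
      have "{x::real^'d. \<forall>j. \<epsilon> / 2 \<le> \<bar>x $ j\<bar>} = (\<Inter>j. {x. \<epsilon> / 2 \<le> \<bar>x $ j\<bar>})" by auto
      then show "closed {x::real^'d. \<forall>j. \<epsilon> / 2 \<le> \<bar>x $ j\<bar>}"
        by (simp only:) (intro closed_INT ballI closed_Collect_le continuous_intros)
      fix x assume "?\<chi> x \<noteq> 0"
      then have "cutoff \<epsilon> (x $ j) \<noteq> 0" for j unfolding prod_fun_def by auto
      then show "x \<in> {x. \<forall>j. \<epsilon> / 2 \<le> \<bar>x $ j\<bar>}" using cutoff(1)[OF e(1)] by (auto intro: leI less_imp_le simp: not_le)
    qed
    then have "c * T ?\<chi> = (\<integral>x. t x * euler_op l ?\<chi> x \<partial>lborel)"
      using e(1) by (intro rep_off[OF chi, of "\<epsilon> / 2"]) auto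
    moreover have "T ?\<chi> = T \<phi>" by (rule DH_cutoff[OF T e phi])
    moreover have "t x * euler_op l ?\<chi> x = t x * euler_op l \<phi> x" for x
    proof (cases "\<exists>j. \<bar>x $ j\<bar> \<le> \<epsilon>")
      case True
      then show ?thesis using tz by auto
    next
      case False
      let ?U = "\<Inter>j. {x::real^'d. \<epsilon> < \<bar>x $ j\<bar>}"
      have "open ?U" by (intro open_INT finite ballI open_Collect_less continuous_intros)
      moreover have "?\<chi> z = \<phi> z" if "z \<in> ?U" for z
      proof -
        have "cutoff \<epsilon> (z $ j) = 1" for j using that by (intro cutoff(2)[OF e(1)]) (auto simp: less_imp_le)
        then show ?thesis by (simp add: prod_fun_def)
      qed
      moreover have "x \<in> ?U" using False by (auto simp: not_le)
      ultimately show ?thesis using euler_op_cong_open[of ?U ?\<chi> \<phi> x l] by simp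
    qed
    ultimately show ?thesis by simp
  qed

  have "(\<lambda>x. inverse c * t x) \<in> borel_measurable borel" using tm by (intro borel_measurable_times) auto
  moreover have "(1 + norm x ^ 2) powr (real k / 2) * norm (inverse c * t x) \<le> norm (inverse c) * (?c ^ k * D)" for x
    using mult_left_mono[OF decay[of x], of "norm (inverse c)"] by (simp add: norm_mult mult_ac)
  moreover have "T \<phi> = (\<integral>x. (inverse c * t x) * euler_op l \<phi> x \<partial>lborel)" if "test_fun \<phi>" for \<phi>
  proof -
    have "(\<integral>x. (inverse c * t x) * euler_op l \<phi> x \<partial>lborel) = inverse c * (\<integral>x. t x * euler_op l \<phi> x \<partial>lborel)"
      unfolding mult.assoc by (rule integral_mult_right_zero)
    then show ?thesis using rep[OF that] cnz by (simp add: field_simps)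
  qed
  ultimately show ?thesis by blast
qed

section \<open>From the integral representation to Euler operators on distributions\<close>

lemma test_linear_regular:
  fixes t :: "real^'d::finite \<Rightarrow> complex"
  assumes t: "t \<in> borel_measurable borel" and b: "\<And>x. norm (t x) \<le> C"
  shows "test_linear (regular t)"
proof -
  have i: "integrable lborel (\<lambda>x. t x * \<phi> x)" if phi: "test_fun \<phi>" for \<phi>
  proof (rule Bochner_Integration.integrable_bound)
    show "integrable lborel (\<lambda>x. C * norm (\<phi> x))" using integrable_test_fun[OF phi] by simp
    have "\<phi> \<in> borel_measurable lborel" using integrable_test_fun[OF phi] by auto
    then show "(\<lambda>x. t x * \<phi> x) \<in> borel_measurable lborel" using t by (intro borel_measurable_times) auto
    have "norm (t x * \<phi> x) \<le> norm (C * norm (\<phi> x))" for x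
    proof -
      have "norm (t x) * norm (\<phi> x) \<le> \<bar>C\<bar> * norm (\<phi> x)"
        using b[of x] abs_ge_self[of C] by (intro mult_right_mono) auto
      then show ?thesis by (simp add: norm_mult abs_mult)
    qed
    then show "AE x in lborel. norm (t x * \<phi> x) \<le> norm (C * norm (\<phi> x))" by simp
  qed
  show ?thesis
    unfolding test_linear_def regular_def
  proof (intro allI impI conjI)
    fix \<phi> \<psi> :: "real^'d \<Rightarrow> complex" and a assume "test_fun \<phi> \<and> test_fun \<psi>"
    then have t: "test_fun \<phi>" "test_fun \<psi>" by auto
    show "(\<integral>x. t x * (\<phi> x + \<psi> x) \<partial>lborel) = (\<integral>x. t x * \<phi> x \<partial>lborel) + (\<integral>x. t x * \<psi> x \<partial>lborel)"
      unfolding distrib_left by (rule Bochner_Integration.integral_add[OF i[OF t(1)] i[OF t(2)]])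
    have "(\<lambda>x. t x * (a * \<phi> x)) = (\<lambda>x. a * (t x * \<phi> x))" by (simp add: mult.left_commute)
    then show "(\<integral>x. t x * (a * \<phi> x) \<partial>lborel) = a * (\<integral>x. t x * \<phi> x \<partial>lborel)" by simp
  qed
qed

lemma euler_word_cmult: "euler_word js (\<lambda>\<phi>. c * S \<phi>) = (\<lambda>\<phi>. c * euler_word js S \<phi>)"
  unfolding euler_word_def by (induction js) (auto simp: euler_dist_def)

lemma regular_cmult: "regular (\<lambda>x. c * t x) = (\<lambda>\<phi>. c * regular t \<phi>)"
  unfolding regular_def mult.assoc by (rule ext) (rule integral_mult_right_zero)

lemma locally_integrable_bounded:
  fixes t :: "real^'d::finite \<Rightarrow> complex"
  assumes t: "t \<in> borel_measurable borel" and b: "\<And>x. norm (t x) \<le> C"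
  shows "locally_integrable t"
  unfolding locally_integrable_def set_integrable_def
proof (intro allI impI)
  fix K :: "(real^'d) set" assume K: "compact K"
  show "integrable lborel (\<lambda>x. indicator K x *\<^sub>R t x)"
  proof (rule Bochner_Integration.integrable_bound)
    show "integrable lborel (\<lambda>x. indicator K x *\<^sub>R C)" by (rule borel_integrable_compact[OF K]) simp
    have "K \<in> sets borel" using K by (simp add: borel_compact)
    then show "(\<lambda>x. indicator K x *\<^sub>R t x) \<in> borel_measurable lborel" using t by simp
    have "norm (indicator K x *\<^sub>R t x) \<le> norm (indicator K x *\<^sub>R C)" for x
      using b[of x] abs_ge_self[of C] by (auto simp: indicator_def)
    then show "AE x in lborel. norm (indicator K x *\<^sub>R t x) \<le> norm (indicator K x *\<^sub>R C)" by simp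
  qed
qed

text \<open>The factor (1 + |x|^2)^(k/2) is at least 1, so \<open>t\<close> itself is bounded. Hence
  \<open>regular t\<close> is linear on test functions, and \<open>euler_op_as_words\<close> moves
  the operator from \<phi> to the distribution.\<close>

lemma DH_euler_representation:
  fixes T :: "(real^'d::finite \<Rightarrow> complex) \<Rightarrow> complex"
  assumes T: "DH T"
  shows "\<exists>t A c C. t \<in> borel_measurable borel \<and> finite A \<and>
      (\<forall>x. (1 + norm x ^ 2) powr (real k / 2) * norm (t x) \<le> C) \<and> (\<forall>x. norm (t x) \<le> C) \<and>
      dist_eq T (\<lambda>\<phi>. \<Sum>js\<in>A. c js * euler_word js (regular t) \<phi>)"
proof -
  obtain t l C where t: "t \<in> borel_measurable borel"
    and b: "\<And>x. (1 + norm x ^ 2) powr (real k / 2) * norm (t x) \<le> C"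
    and rep: "\<And>\<phi>. test_fun \<phi> \<Longrightarrow> T \<phi> = (\<integral>x. t x * euler_op l \<phi> x \<partial>lborel)"
    using DH_representation[OF T, of k] by metis
  have tb: "norm (t x) \<le> C" for x
  proof -
    have "1 * norm (t x) \<le> (1 + norm x ^ 2) powr (real k / 2) * norm (t x)"
      by (intro mult_right_mono ge_one_powr_ge_zero) auto
    then show ?thesis using b[of x] by simp
  qed
  obtain A c where A: "finite A" "\<And>S \<phi>. test_linear S \<Longrightarrow> test_fun \<phi> \<Longrightarrow>
      S (euler_op l \<phi>) = (\<Sum>js\<in>A. c js * euler_word js S \<phi>)"
    using euler_op_as_words[of l] by metis
  have "dist_eq T (\<lambda>\<phi>. \<Sum>js\<in>A. c js * euler_word js (regular t) \<phi>)"
    unfolding dist_eq_def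
  proof (intro allI impI)
    fix \<phi> :: "real^'d \<Rightarrow> complex" assume phi: "test_fun \<phi>"
    have "T \<phi> = regular t (euler_op l \<phi>)" unfolding regular_def by (rule rep[OF phi])
    also have "\<dots> = (\<Sum>js\<in>A. c js * euler_word js (regular t) \<phi>)"
      by (rule A(2)[OF test_linear_regular[OF t tb] phi])
    finally show "T \<phi> = (\<Sum>js\<in>A. c js * euler_word js (regular t) \<phi>)" .
  qed
  then show ?thesis using t A(1) b tb by blast
qed

text \<open>|x^\<beta>| \<le> |x|^|\<beta>|, so boundedness of x^\<beta> t is a case of decay of
  order k = |\<beta>|.\<close>

lemma mono_pow_bound: "\<bar>mono_pow x \<beta>\<bar> \<le> (1 + norm x ^ 2) powr (real (\<Sum>j\<in>UNIV. \<beta> j) / 2)"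
proof -
  let ?k = "\<Sum>j\<in>UNIV. \<beta> j"
  have "\<bar>mono_pow x \<beta>\<bar> = (\<Prod>j\<in>UNIV. \<bar>x $ j\<bar> ^ \<beta> j)"
    unfolding mono_pow_def abs_prod power_abs ..
  also have "\<dots> \<le> (\<Prod>j\<in>UNIV. norm x ^ \<beta> j)"
    by (intro prod_mono conjI power_mono component_le_norm_cart) auto
  also have "\<dots> = norm x ^ ?k" by (rule power_sum[symmetric])
  also have "\<dots> \<le> sqrt (1 + norm x ^ 2) ^ ?k"
    by (intro power_mono) (auto intro: real_le_rsqrt)
  also have "\<dots> = sqrt (1 + norm x ^ 2) powr real ?k"
    by (rule powr_realpow[symmetric]) (simp add: add_pos_nonneg)
  also have "\<dots> = ((1 + norm x ^ 2) powr (1 / 2)) powr real ?k" by (simp add: powr_half_sqrt)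
  also have "\<dots> = (1 + norm x ^ 2) powr (real ?k / 2)" by (simp add: powr_powr)
  finally show ?thesis .
qed

theorem theorem4:
  fixes T :: "(real^'d::finite \<Rightarrow> complex) \<Rightarrow> complex"
  assumes "DH T"
  shows "(\<forall>\<beta>::'d \<Rightarrow> nat. \<exists>t A c.
            t \<in> borel_measurable lborel \<and> locally_integrable t \<and>
            (\<exists>C. AE x in lborel. norm (complex_of_real (mono_pow x \<beta>) * t x) \<le> C) \<and>
            finite A \<and>
            dist_eq T (\<lambda>\<phi>. \<Sum>js\<in>A. c js * euler_word js (regular t) \<phi>))
         \<and> OH T"
proof (intro conjI allI)
  fix \<beta> :: "'d \<Rightarrow> nat"
  obtain t A c C where t: "t \<in> borel_measurable borel" "finite A"
      "\<And>x. (1 + norm x ^ 2) powr (real (\<Sum>j\<in>UNIV. \<beta> j) / 2) * norm (t x) \<le> C" "\<And>x. norm (t x) \<le> C"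
      "dist_eq T (\<lambda>\<phi>. \<Sum>js\<in>A. c js * euler_word js (regular t) \<phi>)"
    using DH_euler_representation[OF assms, of "\<Sum>j\<in>UNIV. \<beta> j"] by blast
  have "norm (complex_of_real (mono_pow x \<beta>) * t x) \<le> C" for x
    using order_trans[OF mult_right_mono[OF mono_pow_bound[of x \<beta>] norm_ge_zero[of "t x"]] t(3)[of x]]
    by (simp add: norm_mult)
  then have "AE x in lborel. norm (complex_of_real (mono_pow x \<beta>) * t x) \<le> C" by simp
  moreover have "t \<in> borel_measurable lborel" using t(1) by simp
  ultimately show "\<exists>t A c. t \<in> borel_measurable lborel \<and> locally_integrable t \<and>
      (\<exists>C. AE x in lborel. norm (complex_of_real (mono_pow x \<beta>) * t x) \<le> C) \<and> finite A \<and>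
      dist_eq T (\<lambda>\<phi>. \<Sum>js\<in>A. c js * euler_word js (regular t) \<phi>)"
    using locally_integrable_bounded[OF t(1,4)] t(2,5) by blast
next
  show "OH T" unfolding OH_def
  proof (intro conjI allI)
    show "distribution T" by (rule DH_distribution[OF assms])
    fix k :: nat
    obtain t A c C where t: "t \<in> borel_measurable borel" "finite A"
        "\<And>x. (1 + norm x ^ 2) powr (real k / 2) * norm (t x) \<le> C"
        "dist_eq T (\<lambda>\<phi>. \<Sum>js\<in>A. c js * euler_word js (regular t) \<phi>)"
      using DH_euler_representation[OF assms, of k] by blast
    \<comment> \<open>\<open>OH\<close> asks for one function per word and no scalar coefficients,
      so each \<open>c js\<close> is absorbed into its own copy of \<open>t\<close>.\<close>
    let ?t = "\<lambda>js x. c js * t x"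
    have "?t js \<in> borel_measurable lborel" for js using t(1) by simp
    moreover have "\<exists>C. AE x in lborel. (1 + norm x ^ 2) powr (real k / 2) * norm (?t js x) \<le> C" for js
    proof (intro exI AE_I2)
      show "(1 + norm x ^ 2) powr (real k / 2) * norm (?t js x) \<le> norm (c js) * C" for x
        using mult_left_mono[OF t(3)[of x], of "norm (c js)"] by (simp add: norm_mult mult_ac)
    qed
    moreover have "dist_eq T (\<lambda>\<phi>. \<Sum>js\<in>A. euler_word js (regular (?t js)) \<phi>)"
      unfolding regular_cmult euler_word_cmult by (rule t(4))
    ultimately show "\<exists>A t. finite A \<and> (\<forall>js\<in>A. t js \<in> borel_measurable lborel \<and>
           (\<exists>C. AE x in lborel. (1 + norm x ^ 2) powr (real k / 2) * norm (t js x) \<le> C)) \<and>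
        dist_eq T (\<lambda>\<phi>. \<Sum>js\<in>A. euler_word js (regular (t js)) \<phi>)"
      using t(2) by (intro exI[of _ A] exI[of _ ?t]) blast
  qed
qed

end
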